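(* Let $f:[0,\infty)\to\mathbb R$ be $C^3$, $\beta\in\mathbb R$, $\ell>0$, and let $\phi$ be a real-valued solution of $\phi_{xx}+f(\phi^2)\phi+\beta\phi=0$ on $[0,\ell]$. Let $L_+=-\partial_{xx}-2f'(\phi^2)\phi^2-f(\phi^2)-\beta$ and $L_-=-\partial_{xx}-f(\phi^2)-\beta$ with Dirichlet boundary conditions on $[0,\ell]$, and $N=\begin{pmatrix}0&-L_-\\L_+&0\end{pmatrix}$. Assume that $0\in\operatorname{Spec}(L_+)\setminus\operatorname{Spec}(L_-)$ with eigenfunction $\phi'$. If $\{p,q\}$ is the fundamental set of solutions to the differential equation $L_-v=0$ with $p(0)=1,\ p'(0)=0,\ q(0)=0,\ q'(0)=1$, then $q(\ell)\ne0$ and $$\operatorname{sign}\ddot s(0)=\operatorname{sign}\left[\left(\int_0^\ell p^2\,dx\right)-\frac{p(\ell)}{q(\ell)}\,\ell^2\right],$$ where $s(\lambda)$ is the eigenvalue curve through $(\lambda,s)=(0,1)$.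
   Context: $L_\pm$ have domain $H^2(0,\ell)\cap H^1_0(0,\ell)\subset L^2(0,\ell)$ and $N$ has domain $(H^2(0,\ell)\cap H^1_0(0,\ell))^2$. The eigenvalue curve through $(0,1)$: $s(\lambda)$ is the $C^2$ function, defined for real $|\lambda|\ll1$, with $s(0)=1$ such that $\lambda$ is an eigenvalue of $N\mathbf u=\lambda\mathbf u$ on $[0,s(\lambda)\ell]$ with $\mathbf u(0)=\mathbf u(s(\lambda)\ell)=0$; it exists since $\dim\ker N=1$, and it satisfies $\dot s(0)=0$ (here $\phi$, hence the potentials, is taken to be defined slightly beyond $\ell$). Dot denotes $d/d\lambda$, prime denotes $d/dx$, and $\operatorname{sign}0=0$. *)

theory Defs
  imports "HOL-Analysis.Analysis"
begin

text \<open>Derivatives are taken within \<open>S\<close>, so they are one-sided at end points of \<open>S\<close>.\<close>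

definition Ck_on :: "nat \<Rightarrow> real set \<Rightarrow> (real \<Rightarrow> real) \<Rightarrow> bool" where
  "Ck_on k S f \<longleftrightarrow> (\<exists>D :: nat \<Rightarrow> real \<Rightarrow> real.
     (\<forall>x\<in>S. D 0 x = f x) \<and>
     (\<forall>j<k. \<forall>x\<in>S. (D j has_real_derivative D (Suc j) x) (at x within S)) \<and>
     continuous_on S (D k))"

text \<open>A classical solution \<open>v\<close>, with first derivative \<open>v'\<close>, of \<open>-v'' - V v = 0\<close> on \<open>S\<close>.\<close>

definition schroedinger_solution ::
  "real set \<Rightarrow> (real \<Rightarrow> real) \<Rightarrow> (real \<Rightarrow> real) \<Rightarrow> (real \<Rightarrow> real) \<Rightarrow> bool" where
  "schroedinger_solution S V v v' \<longleftrightarrow>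
     (\<forall>x\<in>S. (v has_real_derivative v' x) (at x within S)) \<and>
     (\<forall>x\<in>S. (v' has_real_derivative - (V x * v x)) (at x within S))"

text \<open>The Lebesgue and Sobolev spaces are those of the open interval \<open>(0,l)\<close>. Elements are complex-valued representatives; equality in \<open>L\<^sup>2\<close> is \<open>ae_eq\<close>.\<close>

definition L2 :: "real \<Rightarrow> (real \<Rightarrow> complex) set" where
  "L2 l = {u. u \<in> borel_measurable (lebesgue_on {0<..<l}) \<and>
              integrable (lebesgue_on {0<..<l}) (\<lambda>x. (cmod (u x))\<^sup>2)}"

definition ae_eq :: "real \<Rightarrow> (real \<Rightarrow> complex) \<Rightarrow> (real \<Rightarrow> complex) \<Rightarrow> bool" where
  "ae_eq l u v \<longleftrightarrow> (AE x in lebesgue_on {0<..<l}. u x = v x)"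

definition L2_norm :: "real \<Rightarrow> (real \<Rightarrow> complex) \<Rightarrow> real" where
  "L2_norm l u = sqrt (LINT x|lebesgue_on {0<..<l}. (cmod (u x))\<^sup>2)"

definition Cc1 :: "real \<Rightarrow> (real \<Rightarrow> complex) set" where
  "Cc1 l = {\<psi>. \<psi> C1_differentiable_on UNIV \<and>
                (\<exists>a b. 0 < a \<and> b < l \<and> (\<forall>x. x \<notin> {a..b} \<longrightarrow> \<psi> x = 0))}"

definition weak_deriv :: "real \<Rightarrow> (real \<Rightarrow> complex) \<Rightarrow> (real \<Rightarrow> complex) \<Rightarrow> bool" where
  "weak_deriv l u g \<longleftrightarrow> u \<in> L2 l \<and> g \<in> L2 l \<and>
     (\<forall>\<psi>\<in>Cc1 l. (LINT x|lebesgue_on {0<..<l}. u x * vector_derivative \<psi> (at x)) =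
              - (LINT x|lebesgue_on {0<..<l}. g x * \<psi> x))"

text \<open>A representative of the weak derivative (which is unique up to \<open>ae_eq\<close>).\<close>

definition weak_diff :: "real \<Rightarrow> (real \<Rightarrow> complex) \<Rightarrow> (real \<Rightarrow> complex)" where
  "weak_diff l u = (SOME g. weak_deriv l u g)"

definition H1 :: "real \<Rightarrow> (real \<Rightarrow> complex) set" where
  "H1 l = {u. \<exists>g. weak_deriv l u g}"

definition H2 :: "real \<Rightarrow> (real \<Rightarrow> complex) set" where
  "H2 l = {u. \<exists>g\<in>H1 l. weak_deriv l u g}"

text \<open>The closure of \<open>Cc1\<close> in the \<open>H\<^sup>1\<close> norm.\<close>

definition H10 :: "real \<Rightarrow> (real \<Rightarrow> complex) set" where
  "H10 l = {u\<in>H1 l. \<forall>e>0. \<exists>\<psi>\<in>Cc1 l.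
      (L2_norm l (\<lambda>x. u x - \<psi> x))\<^sup>2 +
      (L2_norm l (\<lambda>x. weak_diff l u x - vector_derivative \<psi> (at x)))\<^sup>2 < e}"

definition dirichlet_dom :: "real \<Rightarrow> (real \<Rightarrow> complex) set" where
  "dirichlet_dom l = H2 l \<inter> H10 l"

text \<open>The last condition of the resolvent set says that \<open>A - \<mu>\<close> is injective with bounded inverse.\<close>

definition resolvent_set ::
  "real \<Rightarrow> (real \<Rightarrow> complex) set \<Rightarrow> ((real \<Rightarrow> complex) \<Rightarrow> (real \<Rightarrow> complex)) \<Rightarrow> complex set" where
  "resolvent_set l D A = {\<mu>.
     (\<forall>g\<in>L2 l. \<exists>u\<in>D. ae_eq l (\<lambda>x. A u x - \<mu> * u x) g) \<and>
     (\<exists>C. \<forall>u\<in>D. L2_norm l u \<le> C * L2_norm l (\<lambda>x. A u x - \<mu> * u x))}"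

definition Spec ::
  "real \<Rightarrow> (real \<Rightarrow> complex) set \<Rightarrow> ((real \<Rightarrow> complex) \<Rightarrow> (real \<Rightarrow> complex)) \<Rightarrow> complex set" where
  "Spec l D A = - resolvent_set l D A"

definition is_eigenfunction ::
  "real \<Rightarrow> (real \<Rightarrow> complex) set \<Rightarrow> ((real \<Rightarrow> complex) \<Rightarrow> (real \<Rightarrow> complex)) \<Rightarrow>
   complex \<Rightarrow> (real \<Rightarrow> complex) \<Rightarrow> bool" where
  "is_eigenfunction l D A \<mu> u \<longleftrightarrow>
     u \<in> D \<and> \<not> ae_eq l u (\<lambda>_. 0) \<and> ae_eq l (A u) (\<lambda>x. \<mu> * u x)"

definition is_eigenvalue2 ::
  "real \<Rightarrow> ((real \<Rightarrow> complex) \<times> (real \<Rightarrow> complex)) set \<Rightarrow>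
   ((real \<Rightarrow> complex) \<times> (real \<Rightarrow> complex) \<Rightarrow> (real \<Rightarrow> complex) \<times> (real \<Rightarrow> complex)) \<Rightarrow>
   complex \<Rightarrow> bool" where
  "is_eigenvalue2 l D A \<mu> \<longleftrightarrow> (\<exists>w\<in>D.
     \<not> (ae_eq l (fst w) (\<lambda>_. 0) \<and> ae_eq l (snd w) (\<lambda>_. 0)) \<and>
     ae_eq l (fst (A w)) (\<lambda>x. \<mu> * fst w x) \<and>
     ae_eq l (snd (A w)) (\<lambda>x. \<mu> * snd w x))"

definition schroedinger_op ::
  "(real \<Rightarrow> real) \<Rightarrow> real \<Rightarrow> (real \<Rightarrow> complex) \<Rightarrow> (real \<Rightarrow> complex)" where
  "schroedinger_op V l u =
     (\<lambda>x. - weak_diff l (weak_diff l u) x - complex_of_real (V x) * u x)"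

definition V_minus :: "(real \<Rightarrow> real) \<Rightarrow> real \<Rightarrow> (real \<Rightarrow> real) \<Rightarrow> real \<Rightarrow> real" where
  "V_minus f \<beta> \<phi> x = f ((\<phi> x)\<^sup>2) + \<beta>"

text \<open>The nonlinearity \<open>f\<close> lives on \<open>[0,\<infinity>)\<close>, hence the one-sided derivative.\<close>

definition V_plus :: "(real \<Rightarrow> real) \<Rightarrow> real \<Rightarrow> (real \<Rightarrow> real) \<Rightarrow> real \<Rightarrow> real" where
  "V_plus f \<beta> \<phi> x =
     2 * vector_derivative f (at ((\<phi> x)\<^sup>2) within {0..}) * (\<phi> x)\<^sup>2 + f ((\<phi> x)\<^sup>2) + \<beta>"

definition L_minus ::
  "(real \<Rightarrow> real) \<Rightarrow> real \<Rightarrow> (real \<Rightarrow> real) \<Rightarrow> real \<Rightarrow> (real \<Rightarrow> complex) \<Rightarrow> (real \<Rightarrow> complex)" where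
  "L_minus f \<beta> \<phi> l = schroedinger_op (V_minus f \<beta> \<phi>) l"

definition L_plus ::
  "(real \<Rightarrow> real) \<Rightarrow> real \<Rightarrow> (real \<Rightarrow> real) \<Rightarrow> real \<Rightarrow> (real \<Rightarrow> complex) \<Rightarrow> (real \<Rightarrow> complex)" where
  "L_plus f \<beta> \<phi> l = schroedinger_op (V_plus f \<beta> \<phi>) l"

definition N_op ::
  "(real \<Rightarrow> real) \<Rightarrow> real \<Rightarrow> (real \<Rightarrow> real) \<Rightarrow> real \<Rightarrow>
   (real \<Rightarrow> complex) \<times> (real \<Rightarrow> complex) \<Rightarrow> (real \<Rightarrow> complex) \<times> (real \<Rightarrow> complex)" where
  "N_op f \<beta> \<phi> l w = ((\<lambda>x. - L_minus f \<beta> \<phi> l (snd w) x), L_plus f \<beta> \<phi> l (fst w))"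

text \<open>The profile \<open>\<phi>\<close> is defined on \<open>[0,R]\<close> for some \<open>R > l\<close>, and the intervals
  \<open>[0, s(\<mu>) l]\<close> must stay inside \<open>[0,R]\<close>. By continuity of \<open>s\<close> this only restricts \<open>e\<close>.\<close>

definition eigenvalue_curve ::
  "(real \<Rightarrow> real) \<Rightarrow> real \<Rightarrow> (real \<Rightarrow> real) \<Rightarrow> real \<Rightarrow> real \<Rightarrow> (real \<Rightarrow> real) \<Rightarrow> bool" where
  "eigenvalue_curve f \<beta> \<phi> l R s \<longleftrightarrow> s 0 = 1 \<and>
     (\<exists>e>0. Ck_on 2 {-e<..<e} s \<and>
       (\<forall>\<mu>\<in>{-e<..<e}. 0 < s \<mu> * l \<and> s \<mu> * l \<le> R \<and>
          is_eigenvalue2 (s \<mu> * l) (dirichlet_dom (s \<mu> * l) \<times> dirichlet_dom (s \<mu> * l))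
            (N_op f \<beta> \<phi> (s \<mu> * l)) (complex_of_real \<mu>)))"

end

theory Submission
  imports Defs
begin

text \<open>Write \<open>h = \<phi>'\<close>. Differentiating the profile equation gives \<open>h'' + V\<^sub>+ h = 0\<close>, so
\<open>h\<close> spans the Dirichlet kernel of \<open>L\<^sub>+\<close> on \<open>[0,l]\<close>, and \<open>\<phi>\<close> itself
solves \<open>\<phi>'' + V\<^sub>- \<phi> = 0\<close>. For an eigenpair \<open>(U,W)\<close> with small eigenvalue \<open>\<mu>\<close>
on \<open>[0,L]\<close>, \<open>L = s(\<mu>) l\<close>, the system reads \<open>U'' + V\<^sub>+ U = - \<mu> W\<close>, \<open>W'' +
V\<^sub>- W = \<mu> U\<close>. Testing the first equation with \<open>h\<close> gives \<open>U'(L) h(L) = - \<mu> \<integral> W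
h\<close> over \<open>[0,L]\<close>. Since \<open>q(l) \<noteq> 0\<close>, the second equation forces \<open>W = O(\<mu>)\<close>,
hence \<open>U = c h + O(\<mu>\<^sup>2)\<close>. If \<open>w\<close> is the Dirichlet solution of \<open>w'' + V\<^sub>- w = h\<close>
on \<open>[0,l]\<close>, testing the second equation with \<open>w\<close> replaces \<open>\<integral> W h\<close> by \<open>\<mu> c
\<integral> h w\<close> up to higher order, and \<open>h'(L) h(L) = - \<mu>\<^sup>2 \<integral> h w + O(\<mu>\<^sup>3)\<close>. This is
\<open>eigenpair_estimate\<close>. As \<open>h(l) = 0\<close> and \<open>h'(l) \<noteq> 0\<close>, it says that \<open>(s(\<mu>) - 1) /
\<mu>\<^sup>2\<close> tends to \<open>- \<integral> h w / (l h'(l)\<^sup>2)\<close>, which fixes the second derivative of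
\<open>s\<close> (\<open>curve_second_derivative\<close>).

The integral is explicit because \<open>(x \<phi>)'' + V\<^sub>- x \<phi> = 2 h\<close>: hence \<open>w = x \<phi> / 2 + B q\<close>
with \<open>B = - l \<phi>(l) / (2 q(l))\<close>. Partial integration, the Wronskian identity \<open>q' \<phi> - q h =
\<phi>(0)\<close> and \<open>\<phi> = \<phi>(0) p\<close> give \<open>\<integral> h w = - \<phi>(0)\<^sup>2 / 4 \<cdot> (\<integral>
p\<^sup>2 - l\<^sup>2 p(l) / q(l))\<close>, and \<open>\<phi>(0) \<noteq> 0\<close> (\<open>classical_sign_formula\<close>).

What remains is to pass from operators on \<open>L\<^sup>2\<close> to classical solutions. Elements of \<open>H\<^sup>1\<^sub>0\<close>
are primitives of their weak derivatives (\<open>H10_pair_primitive\<close>), so they are continuous and vanish at the end points. If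
the second weak derivative of an element of the Dirichlet domain is continuous, the element agrees with a classical solution of the
corresponding boundary value problem (\<open>dirichlet_regularity\<close>): the difference has a weak derivative that is orthogonal to
itself. Applied to an eigenpair, this yields real classical pairs \<open>(U,W)\<close>. Finally \<open>q(l) = 0\<close> would make
\<open>q\<close> orthogonal to the range of the symmetric operator \<open>L\<^sub>-\<close>, which contradicts \<open>0 \<notin>
Spec(L\<^sub>-)\<close> (\<open>resolvent_excludes_dirichlet_solution\<close>).\<close>

section \<open>Energy estimates for linear second-order equations\<close>

text \<open>Gronwall's inequality in differential form: \<open>E(t) exp(-C t)\<close> is nonincreasing.\<close>

lemma exponential_growth_bound:
  fixes E E' :: "real \<Rightarrow> real"
  assumes der: "\<And>t. t \<in> {0..T} \<Longrightarrow> (E has_real_derivative E' t) (at t within {0..T})"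
    and le: "\<And>t. t \<in> {0..T} \<Longrightarrow> E' t \<le> C * E t"
    and x: "x \<in> {0..T}"
  shows "E x \<le> E 0 * exp (C * x)"
proof (cases "x = 0")
  case False
  with x have "0 < x" by auto
  have d: "((\<lambda>t. E t * exp (- C * t)) has_derivative
      (\<lambda>y. y * ((E' t - C * E t) * exp (- C * t)))) (at t within {0..x})"
    if "0 \<le> t" "t \<le> x" for t
  proof -
    have "t \<in> {0..T}" using that x by auto
    then have "(E has_real_derivative E' t) (at t within {0..x})"
      using der x by (meson has_field_derivative_subset atLeastatMost_subset_iff order_refl atLeastAtMost_iff)
    then have "((\<lambda>t. E t * exp (- C * t)) has_real_derivative
      ((E' t - C * E t) * exp (- C * t))) (at t within {0..x})"
      by (auto intro!: derivative_eq_intros simp: algebra_simps)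
    then show ?thesis by (simp add: has_field_derivative_def mult_commute_abs)
  qed
  from mvt_simple[OF \<open>0 < x\<close> d] obtain t where t: "t \<in> {0<..<x}"
    and eq: "E x * exp (- C * x) - E 0 * exp (- C * 0) = (x - 0) * ((E' t - C * E t) * exp (- C * t))"
    by auto
  have "E' t - C * E t \<le> 0" using le[of t] t x by auto
  then have "(x - 0) * ((E' t - C * E t) * exp (- C * t)) \<le> 0"
    using \<open>0 < x\<close> by (simp add: mult_nonneg_nonpos mult_nonpos_nonneg)
  with eq have "E x * exp (- C * x) \<le> E 0" by simp
  then have "E x * exp (- C * x) * exp (C * x) \<le> E 0 * exp (C * x)"
    by (rule mult_right_mono) simp
  then show ?thesis by (simp add: mult.assoc flip: exp_add)
qed simp

lemma two_mult_le_squares: "2 * (x::real) * y \<le> x\<^sup>2 + y\<^sup>2"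
  using sum_squares_bound[of x y] by simp

lemma abs_two_mult_le_squares: "2 * \<bar>x * (y::real)\<bar> \<le> x\<^sup>2 + y\<^sup>2"
  using sum_squares_bound[of "\<bar>x\<bar>" "\<bar>y\<bar>"] by (simp add: abs_mult)

text \<open>The constant \<open>G\<^sup>2\<close> is added to the energy \<open>r\<^sup>2 + r'\<^sup>2\<close>, so that the forcing
term is absorbed and the growth is still at most proportional to the energy.\<close>

lemma schroedinger_gronwall:
  fixes r r' V g :: "real \<Rightarrow> real"
  assumes r: "\<And>t. t \<in> {0..T} \<Longrightarrow> (r has_real_derivative r' t) (at t within {0..T})"
    and r': "\<And>t. t \<in> {0..T} \<Longrightarrow> (r' has_real_derivative g t - V t * r t) (at t within {0..T})"
    and V: "\<And>t. t \<in> {0..T} \<Longrightarrow> \<bar>V t\<bar> \<le> M"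
    and g: "\<And>t. t \<in> {0..T} \<Longrightarrow> \<bar>g t\<bar> \<le> G"
    and x: "x \<in> {0..T}"
  shows "(r x)\<^sup>2 + (r' x)\<^sup>2 \<le> ((r 0)\<^sup>2 + (r' 0)\<^sup>2 + G\<^sup>2) * exp ((M + 2) * x)"
proof -
  have "0 \<in> {0..T}" using x by auto
  then have G0: "0 \<le> G" and M0: "0 \<le> M" using g[of 0] V[of 0] by auto
  have "(r x)\<^sup>2 + (r' x)\<^sup>2 + G\<^sup>2 \<le> ((r 0)\<^sup>2 + (r' 0)\<^sup>2 + G\<^sup>2) * exp ((M + 2) * x)"
  proof (rule exponential_growth_bound[OF _ _ x])
    fix t assume t: "t \<in> {0..T}"
    show "((\<lambda>x. (r x)\<^sup>2 + (r' x)\<^sup>2 + G\<^sup>2) has_real_derivative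
        2 * r t * r' t + 2 * r' t * (g t - V t * r t)) (at t within {0..T})"
      using r[OF t] r'[OF t] by (auto intro!: derivative_eq_intros)
    have 1: "2 * r t * r' t \<le> (r t)\<^sup>2 + (r' t)\<^sup>2" by (rule two_mult_le_squares)
    have "2 * r' t * g t \<le> (r' t)\<^sup>2 + (g t)\<^sup>2" by (rule two_mult_le_squares)
    moreover have "(g t)\<^sup>2 \<le> G\<^sup>2" using g[OF t] by (metis abs_ge_zero power2_abs power_mono)
    ultimately have 2: "2 * r' t * g t \<le> (r' t)\<^sup>2 + G\<^sup>2" by simp
    have "- (2 * (r' t * (V t * r t))) \<le> \<bar>2 * (r' t * (V t * r t))\<bar>"
      by (rule abs_ge_minus_self)
    also have "\<dots> = \<bar>V t\<bar> * (2 * \<bar>r' t * r t\<bar>)" by (simp add: abs_mult)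
    also have "\<dots> \<le> M * ((r' t)\<^sup>2 + (r t)\<^sup>2)"
      using V[OF t] abs_two_mult_le_squares by (intro mult_mono) auto
    finally have 3: "- (2 * (r' t * (V t * r t))) \<le> M * ((r' t)\<^sup>2 + (r t)\<^sup>2)" .
    have "0 \<le> M * G\<^sup>2 + (r t)\<^sup>2 + G\<^sup>2" using M0 by simp
    with 1 2 3 show "2 * r t * r' t + 2 * r' t * (g t - V t * r t) \<le> (M + 2) * ((r t)\<^sup>2 + (r' t)\<^sup>2 + G\<^sup>2)"
      by (simp add: algebra_simps)
  qed
  then show ?thesis by (smt (verit) zero_le_power2)
qed

text \<open>Smallness of the initial slope and of the forcing passes to the solution, with a factor that depends only on the bound of
the potential and on the interval \<open>[0,R]\<close>.\<close>

lemma schroedinger_small: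
  fixes r r' V g :: "real \<Rightarrow> real"
  assumes r: "\<And>t. t \<in> {0..T} \<Longrightarrow> (r has_real_derivative r' t) (at t within {0..T})"
    and r': "\<And>t. t \<in> {0..T} \<Longrightarrow> (r' has_real_derivative g t - V t * r t) (at t within {0..T})"
    and V: "\<And>t. t \<in> {0..T} \<Longrightarrow> \<bar>V t\<bar> \<le> M"
    and g: "\<And>t. t \<in> {0..T} \<Longrightarrow> \<bar>g t\<bar> \<le> G"
    and r0: "r 0 = 0" and r'0: "\<bar>r' 0\<bar> \<le> G'"
    and x: "x \<in> {0..T}" and "T \<le> R"
  shows "\<bar>r x\<bar> \<le> (G + G') * exp ((M + 2) * R)" "\<bar>r' x\<bar> \<le> (G + G') * exp ((M + 2) * R)"
proof -
  have "0 \<in> {0..T}" using x by auto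
  then have G0: "0 \<le> G" and M0: "0 \<le> M" using g[of 0] V[of 0] by auto
  have G'0: "0 \<le> G'" using r'0 by linarith
  have R0: "0 \<le> R" using x \<open>T \<le> R\<close> by auto
  let ?B = "exp ((M + 2) * R)"
  have B1: "1 \<le> ?B" using M0 R0 by simp
  have "(r x)\<^sup>2 + (r' x)\<^sup>2 \<le> ((r 0)\<^sup>2 + (r' 0)\<^sup>2 + G\<^sup>2) * exp ((M + 2) * x)"
    by (rule schroedinger_gronwall[OF r r' V g x])
  also have "\<dots> \<le> (G + G')\<^sup>2 * ?B"
  proof (rule mult_mono)
    have "(r' 0)\<^sup>2 \<le> G'\<^sup>2" using r'0 by (metis abs_ge_zero power2_abs power_mono)
    then show "(r 0)\<^sup>2 + (r' 0)\<^sup>2 + G\<^sup>2 \<le> (G + G')\<^sup>2"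
      using G0 G'0 r0 by (simp add: power2_sum add_increasing2)
    show "exp ((M + 2) * x) \<le> ?B" using x \<open>T \<le> R\<close> M0 by (auto intro!: mult_left_mono)
  qed auto
  also have "\<dots> \<le> (G + G')\<^sup>2 * ?B\<^sup>2"
    using B1 by (intro mult_left_mono) (auto simp: power2_eq_square)
  finally have *: "(r x)\<^sup>2 + (r' x)\<^sup>2 \<le> ((G + G') * ?B)\<^sup>2" by (simp add: power_mult_distrib)
  have "(r x)\<^sup>2 \<le> ((G + G') * ?B)\<^sup>2" "(r' x)\<^sup>2 \<le> ((G + G') * ?B)\<^sup>2"
    using * by (smt (verit) zero_le_power2)+
  then show "\<bar>r x\<bar> \<le> (G + G') * ?B" "\<bar>r' x\<bar> \<le> (G + G') * ?B"
    using G0 G'0 B1 by (simp_all add: abs_le_square_iff[symmetric])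
qed

text \<open>For \<open>|\<mu>| \<le> 1\<close> the coupling terms are bounded by the energy, so the growth rate does not depend on
\<open>\<mu>\<close>.\<close>

lemma system_gronwall:
  fixes U U' W W' Vp Vm :: "real \<Rightarrow> real"
  assumes U: "\<And>t. t \<in> {0..L} \<Longrightarrow> (U has_real_derivative U' t) (at t within {0..L})"
    and U': "\<And>t. t \<in> {0..L} \<Longrightarrow> (U' has_real_derivative - \<mu> * W t - Vp t * U t) (at t within {0..L})"
    and W: "\<And>t. t \<in> {0..L} \<Longrightarrow> (W has_real_derivative W' t) (at t within {0..L})"
    and W': "\<And>t. t \<in> {0..L} \<Longrightarrow> (W' has_real_derivative \<mu> * U t - Vm t * W t) (at t within {0..L})"
    and Vp: "\<And>t. t \<in> {0..L} \<Longrightarrow> \<bar>Vp t\<bar> \<le> M"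
    and Vm: "\<And>t. t \<in> {0..L} \<Longrightarrow> \<bar>Vm t\<bar> \<le> M"
    and mu: "\<bar>\<mu>\<bar> \<le> 1"
    and x: "x \<in> {0..L}"
  shows "(U x)\<^sup>2 + (U' x)\<^sup>2 + (W x)\<^sup>2 + (W' x)\<^sup>2
     \<le> ((U 0)\<^sup>2 + (U' 0)\<^sup>2 + (W 0)\<^sup>2 + (W' 0)\<^sup>2) * exp ((M + 2) * x)"
proof (rule exponential_growth_bound[OF _ _ x])
  fix t assume t: "t \<in> {0..L}"
  show "((\<lambda>x. (U x)\<^sup>2 + (U' x)\<^sup>2 + (W x)\<^sup>2 + (W' x)\<^sup>2) has_real_derivative
        2 * U t * U' t + 2 * U' t * (- \<mu> * W t - Vp t * U t) + 2 * W t * W' t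
        + 2 * W' t * (\<mu> * U t - Vm t * W t)) (at t within {0..L})"
    using U[OF t] U'[OF t] W[OF t] W'[OF t] by (auto intro!: derivative_eq_intros)
  have prod: "\<bar>2 * (c * (a * b))\<bar> \<le> K * (a\<^sup>2 + b\<^sup>2)" if "\<bar>c\<bar> \<le> K" for a b c K :: real
  proof -
    have "\<bar>2 * (c * (a * b))\<bar> = \<bar>c\<bar> * (2 * \<bar>a * b\<bar>)" by (simp add: abs_mult)
    also have "\<dots> \<le> K * (a\<^sup>2 + b\<^sup>2)"
      using that abs_two_mult_le_squares[of a b] by (intro mult_mono) auto
    finally show ?thesis .
  qed
  have "\<bar>2 * (1 * (U t * U' t))\<bar> \<le> 1 * ((U t)\<^sup>2 + (U' t)\<^sup>2)"
       "\<bar>2 * (1 * (W t * W' t))\<bar> \<le> 1 * ((W t)\<^sup>2 + (W' t)\<^sup>2)"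
       "\<bar>2 * (\<mu> * (U' t * W t))\<bar> \<le> 1 * ((U' t)\<^sup>2 + (W t)\<^sup>2)"
       "\<bar>2 * (\<mu> * (W' t * U t))\<bar> \<le> 1 * ((W' t)\<^sup>2 + (U t)\<^sup>2)"
       "\<bar>2 * (Vp t * (U' t * U t))\<bar> \<le> M * ((U' t)\<^sup>2 + (U t)\<^sup>2)"
       "\<bar>2 * (Vm t * (W' t * W t))\<bar> \<le> M * ((W' t)\<^sup>2 + (W t)\<^sup>2)"
    by (intro prod; use mu Vp[OF t] Vm[OF t] in simp)+
  then show "2 * U t * U' t + 2 * U' t * (- \<mu> * W t - Vp t * U t) + 2 * W t * W' t
        + 2 * W' t * (\<mu> * U t - Vm t * W t) \<le> (M + 2) * ((U t)\<^sup>2 + (U' t)\<^sup>2 + (W t)\<^sup>2 + (W' t)\<^sup>2)"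
    unfolding abs_le_iff by (simp add: algebra_simps)
qed

lemma lipschitz_bound:
  fixes F F' :: "real \<Rightarrow> real"
  assumes "\<And>t. t \<in> {a..b} \<Longrightarrow> (F has_real_derivative F' t) (at t within {a..b})"
    and "\<And>t. t \<in> {a..b} \<Longrightarrow> \<bar>F' t\<bar> \<le> K"
    and "x \<in> {a..b}" "y \<in> {a..b}"
  shows "\<bar>F x - F y\<bar> \<le> K * \<bar>x - y\<bar>"
  using field_differentiable_bound[of "{a..b}" F F' K x y] assms by auto

section \<open>The perturbed eigenpair to second order\<close>

lemma bounded_on_interval:
  fixes F :: "real \<Rightarrow> real"
  assumes "continuous_on {a..b} F"
  shows "\<exists>P. \<forall>t\<in>{a..b}. \<bar>F t\<bar> \<le> P"
proof -
  have "bounded (F ` {a..b})"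
    using assms compact_continuous_image compact_imp_bounded by blast
  then show ?thesis by (auto simp: bounded_iff)
qed

lemma deriv_subinterval:
  fixes F :: "real \<Rightarrow> real"
  assumes "(F has_real_derivative d) (at t within {0..R})" "0 \<le> a" "b \<le> R"
  shows "(F has_real_derivative d) (at t within {a..b})"
  using assms by (auto intro: has_field_derivative_subset)

text \<open>The second-order condition that an eigenpair \<open>(U,W)\<close> for \<open>\<mu>\<close> on \<open>[0,L]\<close> imposes
on \<open>L\<close>, with a constant that is uniform in \<open>\<mu>\<close>, \<open>L\<close> and the pair. Here \<open>h\<close>
spans the kernel at \<open>\<mu> = 0\<close>, \<open>w\<close> solves the inhomogeneous Dirichlet problem with right-hand side
\<open>h\<close>, and \<open>F\<close> is the primitive of \<open>h w\<close>. The functions \<open>w\<close> and \<open>q\<close> live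
on \<open>[0,l]\<close> only while \<open>U\<close> and \<open>W\<close> live on \<open>[0,L]\<close>; all identities are therefore
evaluated at \<open>m = min l L\<close>; the remaining piece has length \<open>O(\<mu>)\<close>.\<close>

lemma eigenpair_estimate:
  fixes h h1 w w1 q q1 F Vp Vm :: "real \<Rightarrow> real"
  assumes l: "0 < l" "l < R" and S: "0 \<le> S"
    and Vp: "\<And>t. t \<in> {0..R} \<Longrightarrow> \<bar>Vp t\<bar> \<le> M"
    and Vm: "\<And>t. t \<in> {0..R} \<Longrightarrow> \<bar>Vm t\<bar> \<le> M"
    and h: "\<And>t. t \<in> {0..R} \<Longrightarrow> (h has_real_derivative h1 t) (at t within {0..R})"
    and h1: "\<And>t. t \<in> {0..R} \<Longrightarrow> (h1 has_real_derivative - Vp t * h t) (at t within {0..R})"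
    and h_bdry: "h 0 = 0" "h l = 0" and h10: "h1 0 \<noteq> 0"
    and w: "\<And>t. t \<in> {0..l} \<Longrightarrow> (w has_real_derivative w1 t) (at t within {0..l})"
    and w1: "\<And>t. t \<in> {0..l} \<Longrightarrow> (w1 has_real_derivative h t - Vm t * w t) (at t within {0..l})"
    and w_bdry: "w 0 = 0" "w l = 0"
    and q: "\<And>t. t \<in> {0..l} \<Longrightarrow> (q has_real_derivative q1 t) (at t within {0..l})"
    and q1: "\<And>t. t \<in> {0..l} \<Longrightarrow> (q1 has_real_derivative - Vm t * q t) (at t within {0..l})"
    and q0: "q 0 = 0" "q1 0 = 1" and ql: "q l \<noteq> 0"
    and F: "\<And>t. t \<in> {0..l} \<Longrightarrow> (F has_real_derivative h t * w t) (at t within {0..l})"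
    and F0: "F 0 = 0"
  shows "\<exists>C \<delta>. 0 < \<delta> \<and> (\<forall>\<mu> L U U1 W W1. \<bar>\<mu>\<bar> < \<delta> \<longrightarrow> 0 < L \<longrightarrow> L \<le> R \<longrightarrow> \<bar>L - l\<bar> \<le> S * \<bar>\<mu>\<bar> \<longrightarrow>
     (\<forall>t\<in>{0..L}. (U has_real_derivative U1 t) (at t within {0..L})) \<longrightarrow>
     (\<forall>t\<in>{0..L}. (U1 has_real_derivative - \<mu> * W t - Vp t * U t) (at t within {0..L})) \<longrightarrow>
     (\<forall>t\<in>{0..L}. (W has_real_derivative W1 t) (at t within {0..L})) \<longrightarrow>
     (\<forall>t\<in>{0..L}. (W1 has_real_derivative \<mu> * U t - Vm t * W t) (at t within {0..L})) \<longrightarrow>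
     U 0 = 0 \<longrightarrow> U L = 0 \<longrightarrow> W 0 = 0 \<longrightarrow> W L = 0 \<longrightarrow> (U1 0)\<^sup>2 + (W1 0)\<^sup>2 = 1 \<longrightarrow>
     \<bar>h1 L * h L + \<mu>\<^sup>2 * F l\<bar> \<le> C * \<bar>\<mu>\<bar>^3)"
proof -
  have R: "0 < R" using l by simp
  have M: "0 \<le> M" using Vp[of 0] R by (smt (verit) atLeastAtMost_iff abs_ge_zero)
  obtain P1 P2 P3 P4 P5 P6 where P:
    "\<forall>t\<in>{0..R}. \<bar>h t\<bar> \<le> P1" "\<forall>t\<in>{0..R}. \<bar>h1 t\<bar> \<le> P2"
    "\<forall>t\<in>{0..l}. \<bar>w t\<bar> \<le> P3" "\<forall>t\<in>{0..l}. \<bar>w1 t\<bar> \<le> P4"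
    "\<forall>t\<in>{0..l}. \<bar>q t\<bar> \<le> P5" "\<forall>t\<in>{0..l}. \<bar>q1 t\<bar> \<le> P6"
    using bounded_on_interval[OF DERIV_continuous_on[of "{0..R}" h h1]]
      bounded_on_interval[OF DERIV_continuous_on[of "{0..R}" h1 "\<lambda>t. - Vp t * h t"]]
      bounded_on_interval[OF DERIV_continuous_on[of "{0..l}" w w1]]
      bounded_on_interval[OF DERIV_continuous_on[of "{0..l}" w1 "\<lambda>t. h t - Vm t * w t"]]
      bounded_on_interval[OF DERIV_continuous_on[of "{0..l}" q q1]]
      bounded_on_interval[OF DERIV_continuous_on[of "{0..l}" q1 "\<lambda>t. - Vm t * q t"]]
      h h1 w w1 q q1 by blast
  define P where "P = Max {1, P1, P2, P3, P4, P5, P6}"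
  have P_ge: "1 \<le> P" "P1 \<le> P" "P2 \<le> P" "P3 \<le> P" "P4 \<le> P" "P5 \<le> P" "P6 \<le> P"
    unfolding P_def by (rule Max_ge; simp)+
  have bh: "\<bar>h t\<bar> \<le> P" "\<bar>h1 t\<bar> \<le> P" if "t \<in> {0..R}" for t using P(1,2) P_ge that by force+
  have bw: "\<bar>w t\<bar> \<le> P" "\<bar>w1 t\<bar> \<le> P" "\<bar>q t\<bar> \<le> P" "\<bar>q1 t\<bar> \<le> P" if "t \<in> {0..l}" for t
    using P(3-6) P_ge that by force+
  define B where "B = exp ((M + 2) * R)"
  have B1: "1 \<le> B" unfolding B_def using M R by simp
  \<comment> \<open>The constants bound, in this order, the slope of W at 0, the function W, and the difference of U and c h; the last
  bound is quadratic in the eigenvalue.\<close>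
  define C1 where "C1 = (P * S + B * S + B * B) / \<bar>q l\<bar>"
  define C2 where "C2 = (B + C1) * B"
  define C3 where "C3 = C2 * B"
  have C1: "0 \<le> C1" unfolding C1_def using B1 P_ge S by simp
  have C2: "0 \<le> C2" unfolding C2_def using C1 B1 by simp
  have C3: "0 \<le> C3" unfolding C3_def using C2 B1 by simp
  define \<delta> where "\<delta> = min 1 (1 / (2 * (C1 + 1)))"
  have \<delta>0: "0 < \<delta>" unfolding \<delta>_def using C1 by simp
  define E where "E = C3 * P * R + C2 * P * S + 2 * C2 * P * S + P * P * S / \<bar>h1 0\<bar> + C3 * P * S"
  have "\<bar>h1 L * h L + \<mu>\<^sup>2 * F l\<bar> \<le> (E * (2 * P)) * \<bar>\<mu>\<bar>^3"
    if mu: "\<bar>\<mu>\<bar> < \<delta>" and L: "0 < L" "L \<le> R" "\<bar>L - l\<bar> \<le> S * \<bar>\<mu>\<bar>"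
      and U: "\<And>t. t \<in> {0..L} \<Longrightarrow> (U has_real_derivative U1 t) (at t within {0..L})"
      and U1: "\<And>t. t \<in> {0..L} \<Longrightarrow> (U1 has_real_derivative - \<mu> * W t - Vp t * U t) (at t within {0..L})"
      and W: "\<And>t. t \<in> {0..L} \<Longrightarrow> (W has_real_derivative W1 t) (at t within {0..L})"
      and W1: "\<And>t. t \<in> {0..L} \<Longrightarrow> (W1 has_real_derivative \<mu> * U t - Vm t * W t) (at t within {0..L})"
      and bdry: "U 0 = 0" "U L = 0" "W 0 = 0" "W L = 0" and normed: "(U1 0)\<^sup>2 + (W1 0)\<^sup>2 = 1"
    for \<mu> L U U1 W W1
  proof -
    define m where "m = min l L"
    have m: "0 < m" "m \<le> l" "m \<le> L" unfolding m_def using l L by auto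
    have lm: "\<bar>l - m\<bar> \<le> S * \<bar>\<mu>\<bar>" "\<bar>L - m\<bar> \<le> S * \<bar>\<mu>\<bar>" using L(3) S by (auto simp: m_def)
    have mu1: "\<bar>\<mu>\<bar> \<le> 1" "\<bar>\<mu>\<bar> * C1 \<le> 1/2"
    proof -
      show "\<bar>\<mu>\<bar> \<le> 1" using mu by (simp add: \<delta>_def)
      have "\<bar>\<mu>\<bar> * C1 \<le> 1 / (2 * (C1 + 1)) * C1"
        using mu C1 by (intro mult_right_mono) (auto simp: \<delta>_def)
      also have "\<dots> \<le> 1/2" using C1 by (simp add: field_simps)
      finally show "\<bar>\<mu>\<bar> * C1 \<le> 1/2" .
    qed
    have sysb: "\<bar>U t\<bar> \<le> B" "\<bar>U1 t\<bar> \<le> B" "\<bar>W t\<bar> \<le> B" "\<bar>W1 t\<bar> \<le> B" if t: "t \<in> {0..L}" for t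
    proof -
      have "(U t)\<^sup>2 + (U1 t)\<^sup>2 + (W t)\<^sup>2 + (W1 t)\<^sup>2
        \<le> ((U 0)\<^sup>2 + (U1 0)\<^sup>2 + (W 0)\<^sup>2 + (W1 0)\<^sup>2) * exp ((M + 2) * t)"
        by (rule system_gronwall[OF U U1 W W1 _ _ mu1(1) t]) (use Vp Vm L in auto)
      also have "\<dots> = exp ((M + 2) * t)" using bdry normed by simp
      also have "\<dots> \<le> B" unfolding B_def using t L M by (auto intro!: mult_left_mono)
      also have "\<dots> \<le> B\<^sup>2" using B1 by (simp add: power2_eq_square)
      finally have "(U t)\<^sup>2 + (U1 t)\<^sup>2 + (W t)\<^sup>2 + (W1 t)\<^sup>2 \<le> B\<^sup>2" .
      then have "(U t)\<^sup>2 \<le> B\<^sup>2" "(U1 t)\<^sup>2 \<le> B\<^sup>2" "(W t)\<^sup>2 \<le> B\<^sup>2" "(W1 t)\<^sup>2 \<le> B\<^sup>2"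
        by (smt (verit) zero_le_power2)+
      then show "\<bar>U t\<bar> \<le> B" "\<bar>U1 t\<bar> \<le> B" "\<bar>W t\<bar> \<le> B" "\<bar>W1 t\<bar> \<le> B"
        using B1 by (simp_all add: abs_le_square_iff[symmetric])
    qed
    define b where "b = W1 0"
    define c where "c = U1 0 / h1 0"
    have b1: "\<bar>b\<bar> \<le> 1"
    proof -
      have "b\<^sup>2 \<le> 1\<^sup>2" using normed unfolding b_def by (smt (verit) one_power2 zero_le_power2)
      then show ?thesis using abs_le_square_iff[of b 1] by simp
    qed
    \<comment> \<open>W - b q has zero initial data and small forcing, and W(L) = 0; thus b q(l) is small, and q(l) is not
    zero.\<close>
    have bsmall: "\<bar>b\<bar> \<le> C1 * \<bar>\<mu>\<bar>"
    proof -
      have r: "\<bar>W m - b * q m\<bar> \<le> (\<bar>\<mu>\<bar> * B + 0) * exp ((M + 2) * R)"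
      proof (rule schroedinger_small(1)[where T = m and V = Vm and g = "\<lambda>t. \<mu> * U t"
            and r = "\<lambda>t. W t - b * q t" and r' = "\<lambda>t. W1 t - b * q1 t"])
        fix t assume t: "t \<in> {0..m}"
        have tL: "t \<in> {0..L}" "t \<in> {0..l}" using t m by auto
        have d: "(W has_real_derivative W1 t) (at t within {0..m})"
          "(W1 has_real_derivative \<mu> * U t - Vm t * W t) (at t within {0..m})"
          "(q has_real_derivative q1 t) (at t within {0..m})"
          "(q1 has_real_derivative - Vm t * q t) (at t within {0..m})"
          using W[OF tL(1)] W1[OF tL(1)] q[OF tL(2)] q1[OF tL(2)] m
          by (auto intro: deriv_subinterval)
        show "((\<lambda>t. W t - b * q t) has_real_derivative W1 t - b * q1 t) (at t within {0..m})"
          using d by (auto intro!: derivative_eq_intros)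
        show "((\<lambda>t. W1 t - b * q1 t) has_real_derivative
            \<mu> * U t - Vm t * (W t - b * q t)) (at t within {0..m})"
          using d by (auto intro!: derivative_eq_intros simp: algebra_simps)
        show "\<bar>Vm t\<bar> \<le> M" using Vm tL L by auto
        show "\<bar>\<mu> * U t\<bar> \<le> \<bar>\<mu>\<bar> * B" using sysb(1)[OF tL(1)] by (simp add: abs_mult mult_left_mono)
      qed (use bdry q0 m L in \<open>auto simp: b_def\<close>)
      have "\<bar>W m - W L\<bar> \<le> B * \<bar>m - L\<bar>"
        by (rule lipschitz_bound[OF W sysb(4)]) (use m L in auto)
      then have Wm: "\<bar>W m\<bar> \<le> B * (S * \<bar>\<mu>\<bar>)" using bdry lm B1
        by (smt (verit) mult_left_mono)
      have "\<bar>q m - q l\<bar> \<le> P * \<bar>m - l\<bar>"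
        by (rule lipschitz_bound[OF q bw(4)]) (use m l in auto)
      then have "\<bar>q m - q l\<bar> \<le> P * (S * \<bar>\<mu>\<bar>)" using lm P_ge
        by (smt (verit) mult_left_mono)
      then have "\<bar>b * (q m - q l)\<bar> \<le> 1 * (P * (S * \<bar>\<mu>\<bar>))"
        unfolding abs_mult using b1 by (intro mult_mono) auto
      then have "\<bar>b * q l\<bar> \<le> \<bar>\<mu>\<bar> * B * B + B * (S * \<bar>\<mu>\<bar>) + P * (S * \<bar>\<mu>\<bar>)"
        using r Wm by (simp add: right_diff_distrib flip: B_def) linarith
      also have "\<dots> = (P * S + B * S + B * B) * \<bar>\<mu>\<bar>" by (simp add: algebra_simps)
      finally show ?thesis unfolding C1_def using ql by (simp add: abs_mult field_simps)
    qed
    have Wsmall: "\<bar>W t\<bar> \<le> C2 * \<bar>\<mu>\<bar>" "\<bar>W1 t\<bar> \<le> C2 * \<bar>\<mu>\<bar>" if t: "t \<in> {0..L}" for t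
    proof -
      have g: "\<bar>\<mu> * U t\<bar> \<le> \<bar>\<mu>\<bar> * B" if "t \<in> {0..L}" for t
        using sysb(1)[OF that] by (simp add: abs_mult mult_left_mono)
      have V: "\<bar>Vm t\<bar> \<le> M" if "t \<in> {0..L}" for t using Vm that L by auto
      have b: "\<bar>W1 0\<bar> \<le> C1 * \<bar>\<mu>\<bar>" using bsmall by (simp add: b_def)
      have "\<bar>W t\<bar> \<le> (\<bar>\<mu>\<bar> * B + C1 * \<bar>\<mu>\<bar>) * exp ((M + 2) * R)"
           "\<bar>W1 t\<bar> \<le> (\<bar>\<mu>\<bar> * B + C1 * \<bar>\<mu>\<bar>) * exp ((M + 2) * R)"
        using schroedinger_small[OF W W1 V g bdry(3) b t L(2)] by blast+
      then show "\<bar>W t\<bar> \<le> C2 * \<bar>\<mu>\<bar>" "\<bar>W1 t\<bar> \<le> C2 * \<bar>\<mu>\<bar>"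
        unfolding C2_def B_def[symmetric] by (simp_all add: algebra_simps)
    qed
    have Uc: "\<bar>U t - c * h t\<bar> \<le> C3 * \<mu>\<^sup>2" "\<bar>U1 t - c * h1 t\<bar> \<le> C3 * \<mu>\<^sup>2" if t: "t \<in> {0..L}" for t
    proof -
      have d: "((\<lambda>t. U t - c * h t) has_real_derivative U1 t - c * h1 t) (at t within {0..L})"
        "((\<lambda>t. U1 t - c * h1 t) has_real_derivative - \<mu> * W t - Vp t * (U t - c * h t)) (at t within {0..L})"
        if t: "t \<in> {0..L}" for t
      proof -
        have d: "(h has_real_derivative h1 t) (at t within {0..L})"
          "(h1 has_real_derivative - Vp t * h t) (at t within {0..L})"
          using h[of t] h1[of t] t L by (auto intro: deriv_subinterval)
        show "((\<lambda>t. U t - c * h t) has_real_derivative U1 t - c * h1 t) (at t within {0..L})"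
          using d U[OF t] by (auto intro!: derivative_eq_intros)
        show "((\<lambda>t. U1 t - c * h1 t) has_real_derivative - \<mu> * W t - Vp t * (U t - c * h t)) (at t within {0..L})"
          using d U1[OF t] by (auto intro!: derivative_eq_intros simp: algebra_simps)
      qed
      have V: "\<bar>Vp t\<bar> \<le> M" if "t \<in> {0..L}" for t using Vp that L by auto
      have g: "\<bar>- \<mu> * W t\<bar> \<le> C2 * \<mu>\<^sup>2" if "t \<in> {0..L}" for t
      proof -
        have "\<bar>- \<mu> * W t\<bar> \<le> \<bar>\<mu>\<bar> * (C2 * \<bar>\<mu>\<bar>)"
          using Wsmall(1)[OF that] by (simp add: abs_mult mult_left_mono)
        also have "\<dots> = C2 * \<mu>\<^sup>2" by (simp add: power2_eq_square)
        finally show ?thesis .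
      qed
      have z: "U 0 - c * h 0 = 0" "\<bar>U1 0 - c * h1 0\<bar> \<le> 0"
        using bdry h_bdry h10 by (auto simp: c_def)
      have "\<bar>U t - c * h t\<bar> \<le> (C2 * \<mu>\<^sup>2 + 0) * exp ((M + 2) * R)"
        "\<bar>U1 t - c * h1 t\<bar> \<le> (C2 * \<mu>\<^sup>2 + 0) * exp ((M + 2) * R)"
        using schroedinger_small[OF d(1) d(2) V g z t L(2)] by blast+
      then show "\<bar>U t - c * h t\<bar> \<le> C3 * \<mu>\<^sup>2" "\<bar>U1 t - c * h1 t\<bar> \<le> C3 * \<mu>\<^sup>2"
        unfolding C3_def B_def[symmetric] by (simp_all add: algebra_simps)
    qed
    \<comment> \<open>Y and Z are the Wronskians of U with h and of W with w. In T the terms of order \<open>\<mu>\<close> and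
    \<open>\<mu>\<^sup>2\<close> of the derivative cancel, up to U - c h.\<close>
    define Y where "Y t = U1 t * h t - U t * h1 t" for t
    define Z where "Z t = W1 t * w t - W t * w1 t" for t
    define T where "T t = Y t - \<mu> * Z t + \<mu>\<^sup>2 * c * F t" for t
    have dY: "(Y has_real_derivative - \<mu> * W t * h t) (at t within {0..L})" if t: "t \<in> {0..L}" for t
    proof -
      have d: "(h has_real_derivative h1 t) (at t within {0..L})"
        "(h1 has_real_derivative - Vp t * h t) (at t within {0..L})"
        using h[of t] h1[of t] t L by (auto intro: deriv_subinterval)
      then show ?thesis unfolding Y_def using U[OF t] U1[OF t]
        by (auto intro!: derivative_eq_intros simp: algebra_simps)
    qed
    have dT: "(T has_real_derivative - \<mu>\<^sup>2 * (U t - c * h t) * w t) (at t within {0..m})" if t: "t \<in> {0..m}" for t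
    proof -
      have tL: "t \<in> {0..L}" "t \<in> {0..l}" using t m by auto
      have "(Y has_real_derivative - \<mu> * W t * h t) (at t within {0..m})"
        "(W has_real_derivative W1 t) (at t within {0..m})"
        "(W1 has_real_derivative \<mu> * U t - Vm t * W t) (at t within {0..m})"
        "(w has_real_derivative w1 t) (at t within {0..m})"
        "(w1 has_real_derivative h t - Vm t * w t) (at t within {0..m})"
        "(F has_real_derivative h t * w t) (at t within {0..m})"
        using W[OF tL(1)] W1[OF tL(1)] w[OF tL(2)] w1[OF tL(2)] F[OF tL(2)] dY[OF tL(1)] m
        by (auto intro: deriv_subinterval)
      then show ?thesis unfolding T_def Z_def
        by (auto intro!: derivative_eq_intros simp: algebra_simps power2_eq_square)
    qed
    have Tm: "\<bar>T m\<bar> \<le> C3 * P * R * \<bar>\<mu>\<bar>^3"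
    proof -
      have "\<bar>T m - T 0\<bar> \<le> (\<mu>\<^sup>2 * (C3 * \<mu>\<^sup>2) * P) * \<bar>m - 0\<bar>"
      proof (rule lipschitz_bound[OF dT])
        fix t assume t: "t \<in> {0..m}"
        then have tL: "t \<in> {0..L}" "t \<in> {0..l}" using m by auto
        show "\<bar>- \<mu>\<^sup>2 * (U t - c * h t) * w t\<bar> \<le> \<mu>\<^sup>2 * (C3 * \<mu>\<^sup>2) * P"
          unfolding abs_mult using Uc(1)[OF tL(1)] bw(1)[OF tL(2)] C3
          by (intro mult_mono) auto
      qed (use m in auto)
      also have "T 0 = 0" using bdry h_bdry w_bdry F0 by (simp add: T_def Y_def Z_def)
      finally have "\<bar>T m\<bar> \<le> (\<mu>\<^sup>2 * (C3 * \<mu>\<^sup>2) * P) * m" using m by simp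
      also have "\<dots> \<le> (\<mu>\<^sup>2 * (C3 * \<mu>\<^sup>2) * P) * R"
        using C3 P_ge m l by (intro mult_left_mono) auto
      also have "\<dots> = C3 * P * R * (\<bar>\<mu>\<bar>^3 * \<bar>\<mu>\<bar>)"
        by (simp add: power2_eq_square power3_eq_cube abs_mult[symmetric] algebra_simps)
      also have "\<dots> \<le> C3 * P * R * (\<bar>\<mu>\<bar>^3 * 1)"
        using C3 P_ge R mu1 by (intro mult_left_mono) auto
      finally show ?thesis by simp
    qed
    have cube: "\<mu>\<^sup>2 * \<bar>\<mu>\<bar> = \<bar>\<mu>\<bar>^3" by (simp add: power2_eq_square power3_eq_cube abs_mult[symmetric])
    have YL: "\<bar>Y L - Y m\<bar> \<le> C2 * P * S * \<bar>\<mu>\<bar>^3"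
    proof -
      have "\<bar>Y L - Y m\<bar> \<le> (\<bar>\<mu>\<bar> * (C2 * \<bar>\<mu>\<bar>) * P) * \<bar>L - m\<bar>"
      proof (rule lipschitz_bound[OF dY])
        fix t assume t: "t \<in> {0..L}"
        show "\<bar>- \<mu> * W t * h t\<bar> \<le> \<bar>\<mu>\<bar> * (C2 * \<bar>\<mu>\<bar>) * P"
          unfolding abs_mult using Wsmall(1)[OF t] bh(1)[of t] C2 t L
          by (intro mult_mono) auto
      qed (use m in auto)
      also have "\<dots> \<le> (\<bar>\<mu>\<bar> * (C2 * \<bar>\<mu>\<bar>) * P) * (S * \<bar>\<mu>\<bar>)"
        using lm C2 P_ge by (intro mult_left_mono) auto
      also have "\<dots> = C2 * P * S * \<bar>\<mu>\<bar>^3" by (simp add: power3_eq_cube)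
      finally show ?thesis .
    qed
    have Zm: "\<bar>\<mu> * Z m\<bar> \<le> 2 * C2 * P * S * \<bar>\<mu>\<bar>^3"
    proof -
      have "\<bar>w m - w l\<bar> \<le> P * \<bar>m - l\<bar>"
        by (rule lipschitz_bound[OF w bw(2)]) (use m l in auto)
      then have wm: "\<bar>w m\<bar> \<le> P * (S * \<bar>\<mu>\<bar>)" using lm P_ge w_bdry by (smt (verit) mult_left_mono)
      have "\<bar>W m - W L\<bar> \<le> (C2 * \<bar>\<mu>\<bar>) * \<bar>m - L\<bar>"
        by (rule lipschitz_bound[OF W Wsmall(2)]) (use m L in auto)
      then have Wm: "\<bar>W m\<bar> \<le> (C2 * \<bar>\<mu>\<bar>) * (S * \<bar>\<mu>\<bar>)" using lm C2 bdry
        by (smt (verit) mult_left_mono mult_nonneg_nonneg abs_ge_zero)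
      have mm: "m \<in> {0..L}" "m \<in> {0..l}" using m by auto
      have "\<bar>W1 m * w m\<bar> \<le> (C2 * \<bar>\<mu>\<bar>) * (P * (S * \<bar>\<mu>\<bar>))"
        unfolding abs_mult using Wsmall(2)[OF mm(1)] wm C2 by (intro mult_mono) auto
      moreover have "\<bar>W m * w1 m\<bar> \<le> (C2 * \<bar>\<mu>\<bar>) * (S * \<bar>\<mu>\<bar>) * P"
        unfolding abs_mult using Wm bw(2)[OF mm(2)] C2 S by (intro mult_mono) auto
      ultimately have "\<bar>Z m\<bar> \<le> 2 * C2 * P * S * \<mu>\<^sup>2"
        unfolding Z_def by (simp add: power2_eq_square algebra_simps)
      then have "\<bar>\<mu>\<bar> * \<bar>Z m\<bar> \<le> \<bar>\<mu>\<bar> * (2 * C2 * P * S * \<mu>\<^sup>2)" by (rule mult_left_mono) simp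
      also have "\<dots> = 2 * C2 * P * S * \<bar>\<mu>\<bar>^3" by (simp flip: cube)
      finally show ?thesis by (simp add: abs_mult)
    qed
    \<comment> \<open>The slope of W at 0 is small, so by the normalization the slope of U is not; this keeps c away from 0.\<close>
    have a: "1/2 \<le> \<bar>U1 0\<bar>" "\<bar>U1 0\<bar> \<le> 1"
    proof -
      have "\<bar>b\<bar> \<le> 1/2" using bsmall mu1(2) by (simp add: mult.commute)
      then have "\<bar>b\<bar>\<^sup>2 \<le> (1/2)\<^sup>2" by (intro power_mono) auto
      then have "(U1 0)\<^sup>2 \<ge> (1/2)\<^sup>2" using normed by (simp add: b_def power2_eq_square)
      then show "1/2 \<le> \<bar>U1 0\<bar>" using abs_le_square_iff[of "1/2" "U1 0"] by simp
      have "(U1 0)\<^sup>2 \<le> 1\<^sup>2" using normed by (smt (verit) one_power2 zero_le_power2)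
      then show "\<bar>U1 0\<bar> \<le> 1" using abs_le_square_iff[of "U1 0" 1] by simp
    qed
    have c: "1 / (2 * P) \<le> \<bar>c\<bar>" "\<bar>c\<bar> \<le> 1 / \<bar>h1 0\<bar>"
    proof -
      have "\<bar>h1 0\<bar> \<le> P" using bh(2)[of 0] R by simp
      then have "(1/2) / P \<le> \<bar>U1 0\<bar> / \<bar>h1 0\<bar>"
        using a h10 P_ge by (intro frac_le) auto
      then show "1 / (2 * P) \<le> \<bar>c\<bar>" by (simp add: c_def)
      show "\<bar>c\<bar> \<le> 1 / \<bar>h1 0\<bar>" unfolding c_def abs_divide using a by (intro divide_right_mono) auto
    qed
    have Fm: "\<bar>\<mu>\<^sup>2 * c * (F l - F m)\<bar> \<le> P * P * S / \<bar>h1 0\<bar> * \<bar>\<mu>\<bar>^3"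
    proof -
      have "\<bar>F l - F m\<bar> \<le> (P * P) * \<bar>l - m\<bar>"
      proof (rule lipschitz_bound[OF F])
        fix t assume t: "t \<in> {0..l}"
        show "\<bar>h t * w t\<bar> \<le> P * P"
          unfolding abs_mult using bh(1)[of t] bw(1)[OF t] t l P_ge by (intro mult_mono) auto
      qed (use m l in auto)
      also have "\<dots> \<le> (P * P) * (S * \<bar>\<mu>\<bar>)"
        using lm P_ge by (intro mult_left_mono) auto
      finally have "\<bar>\<mu>\<^sup>2 * c * (F l - F m)\<bar> \<le> \<mu>\<^sup>2 * (1 / \<bar>h1 0\<bar>) * ((P * P) * (S * \<bar>\<mu>\<bar>))"
        unfolding abs_mult using c by (intro mult_mono) auto
      also have "\<dots> = P * P * S / \<bar>h1 0\<bar> * \<bar>\<mu>\<bar>^3" by (simp flip: cube)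
      finally show ?thesis .
    qed
    have hL: "\<bar>(c * h1 L - U1 L) * h L\<bar> \<le> C3 * P * S * \<bar>\<mu>\<bar>^3"
    proof -
      have "\<bar>h L - h l\<bar> \<le> P * \<bar>L - l\<bar>"
        by (rule lipschitz_bound[OF h bh(2)]) (use l L in auto)
      also have "\<dots> \<le> P * (S * \<bar>\<mu>\<bar>)" using L(3) P_ge by (intro mult_left_mono) auto
      finally have "\<bar>h L\<bar> \<le> P * (S * \<bar>\<mu>\<bar>)" using h_bdry by simp
      moreover have "\<bar>c * h1 L - U1 L\<bar> \<le> C3 * \<mu>\<^sup>2" using Uc(2)[of L] L by (simp add: abs_minus_commute)
      ultimately have "\<bar>(c * h1 L - U1 L) * h L\<bar> \<le> (C3 * \<mu>\<^sup>2) * (P * (S * \<bar>\<mu>\<bar>))"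
        unfolding abs_mult using C3 by (intro mult_mono) auto
      also have "\<dots> = C3 * P * S * \<bar>\<mu>\<bar>^3" by (simp flip: cube)
      finally show ?thesis .
    qed
    have "c * (h1 L * h L + \<mu>\<^sup>2 * F l) = T m + (Y L - Y m) + \<mu> * Z m + \<mu>\<^sup>2 * c * (F l - F m)
        + (c * h1 L - U1 L) * h L"
      using bdry by (simp add: T_def Y_def algebra_simps)
    then have "\<bar>c * (h1 L * h L + \<mu>\<^sup>2 * F l)\<bar> \<le> C3 * P * R * \<bar>\<mu>\<bar>^3 + C2 * P * S * \<bar>\<mu>\<bar>^3
        + 2 * C2 * P * S * \<bar>\<mu>\<bar>^3 + P * P * S / \<bar>h1 0\<bar> * \<bar>\<mu>\<bar>^3 + C3 * P * S * \<bar>\<mu>\<bar>^3"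
      using Tm YL Zm Fm hL by linarith
    also have "\<dots> = E * \<bar>\<mu>\<bar>^3" unfolding E_def by (simp only: distrib_right)
    finally have e: "\<bar>c\<bar> * \<bar>h1 L * h L + \<mu>\<^sup>2 * F l\<bar> \<le> E * \<bar>\<mu>\<bar>^3" by (simp add: abs_mult)
    have "1 / (2 * P) * \<bar>h1 L * h L + \<mu>\<^sup>2 * F l\<bar> \<le> \<bar>c\<bar> * \<bar>h1 L * h L + \<mu>\<^sup>2 * F l\<bar>"
      using c by (intro mult_right_mono) auto
    with e have "1 / (2 * P) * \<bar>h1 L * h L + \<mu>\<^sup>2 * F l\<bar> \<le> E * \<bar>\<mu>\<bar>^3" by linarith
    then show ?thesis using P_ge by (simp add: field_simps)
  qed
  then show ?thesis using \<delta>0 by (intro exI[of _ "E * (2 * P)"] exI[of _ \<delta>]) blast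
qed

text \<open>Since \<open>h(s l) = h'(l) l (s - 1) (1 + o(1))\<close>, the estimate determines the limit of \<open>(s - 1) /
\<mu>\<^sup>2\<close>. Existence of this limit forces \<open>s'(0) = 0\<close>, and l'Hopital's rule identifies it with half the second
derivative.\<close>

lemma curve_second_derivative:
  fixes s s1 h h1 :: "real \<Rightarrow> real"
  assumes l: "0 < l"
    and s0: "s 0 = 1"
    and s: "\<forall>\<^sub>F \<mu> in nhds 0. (s has_real_derivative s1 \<mu>) (at \<mu>)"
    and s1: "(s1 has_real_derivative s2) (at 0)"
    and h: "(h has_real_derivative h1 l) (at l)" and hl: "h l = 0"
    and h1: "isCont h1 l" "h1 l \<noteq> 0"
    and est: "\<forall>\<^sub>F \<mu> in at 0. \<bar>h1 (s \<mu> * l) * h (s \<mu> * l) + \<mu>\<^sup>2 * K\<bar> \<le> C * \<bar>\<mu>\<bar>^3"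
  shows "s2 = - 2 * K / (l * (h1 l)\<^sup>2)"
proof -
  have s_at0: "(s has_real_derivative s1 0) (at 0)" using eventually_nhds_x_imp_x[OF s] .
  have s_cont: "(s \<longlongrightarrow> 1) (at 0)"
    using DERIV_isCont[OF s_at0] s0 by (simp add: isCont_def)
  have L: "((\<lambda>\<mu>. s \<mu> * l) \<longlongrightarrow> l) (at 0)" using tendsto_mult[OF s_cont tendsto_const[of l]] by simp
  \<comment> \<open>Caratheodory's form of differentiability turns h(L) into a product with the factor L - l.\<close>
  from h obtain g where g: "\<And>z. h z - h l = g z * (z - l)" "isCont g l" "g l = h1 l"
    unfolding CARAT_DERIV by blast
  have lim_g: "((\<lambda>\<mu>. g (s \<mu> * l)) \<longlongrightarrow> h1 l) (at 0)"
    using isCont_tendsto_compose[OF g(2) L] g(3) by simp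
  have lim_h1: "((\<lambda>\<mu>. h1 (s \<mu> * l)) \<longlongrightarrow> h1 l) (at 0)"
    using isCont_tendsto_compose[OF h1(1) L] by simp
  have "((\<lambda>\<mu>. h1 (s \<mu> * l) * h (s \<mu> * l) / \<mu>\<^sup>2 + K) \<longlongrightarrow> 0) (at 0)"
  proof (rule Lim_null_comparison)
    show "((\<lambda>\<mu>. C * \<bar>\<mu>\<bar>) \<longlongrightarrow> 0) (at (0::real))"
      by (auto intro!: tendsto_eq_intros)
    have "\<forall>\<^sub>F \<mu> in at (0::real). \<mu> \<noteq> 0" by (simp add: eventually_at_filter)
    with est show "\<forall>\<^sub>F \<mu> in at 0. norm (h1 (s \<mu> * l) * h (s \<mu> * l) / \<mu>\<^sup>2 + K) \<le> C * \<bar>\<mu>\<bar>"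
    proof eventually_elim
      case (elim \<mu>)
      have "\<bar>h1 (s \<mu> * l) * h (s \<mu> * l) / \<mu>\<^sup>2 + K\<bar>
          = \<bar>h1 (s \<mu> * l) * h (s \<mu> * l) + \<mu>\<^sup>2 * K\<bar> / \<mu>\<^sup>2"
      proof -
        have "h1 (s \<mu> * l) * h (s \<mu> * l) / \<mu>\<^sup>2 + K
            = (h1 (s \<mu> * l) * h (s \<mu> * l) + \<mu>\<^sup>2 * K) / \<mu>\<^sup>2"
          using elim(2) by (simp add: add_divide_distrib)
        then show ?thesis by (simp add: abs_divide)
      qed
      also have "\<dots> \<le> C * \<bar>\<mu>\<bar>^3 / \<mu>\<^sup>2" using elim(1) by (rule divide_right_mono) simp
      also have "\<dots> = C * \<bar>\<mu>\<bar>"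
        using elim(2) power2_abs[of \<mu>] by (simp add: power2_eq_square power3_eq_cube field_simps)
      finally show ?case by simp
    qed
  qed
  then have "((\<lambda>\<mu>. (h1 (s \<mu> * l) * h (s \<mu> * l) / \<mu>\<^sup>2 + K) - K) \<longlongrightarrow> 0 - K) (at 0)"
    by (intro tendsto_intros)
  then have "((\<lambda>\<mu>. h1 (s \<mu> * l) * g (s \<mu> * l) * l * ((s \<mu> - 1) / \<mu>\<^sup>2)) \<longlongrightarrow> - K) (at 0)"
  proof -
    have "h (s \<mu> * l) = g (s \<mu> * l) * l * (s \<mu> - 1)" for \<mu>
      using g(1)[of "s \<mu> * l"] hl by (simp add: algebra_simps)
    with \<open>((\<lambda>\<mu>. (h1 (s \<mu> * l) * h (s \<mu> * l) / \<mu>\<^sup>2 + K) - K) \<longlongrightarrow> 0 - K) (at 0)\<close>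
    show ?thesis by (simp add: mult.assoc)
  qed
  then have lim1: "((\<lambda>\<mu>. h1 (s \<mu> * l) * g (s \<mu> * l) * l * ((s \<mu> - 1) / \<mu>\<^sup>2) / (h1 (s \<mu> * l) * g (s \<mu> * l) * l))
      \<longlongrightarrow> - K / (h1 l * h1 l * l)) (at 0)"
    using lim_g lim_h1 h1(2) l by (intro tendsto_intros) auto
  have ne: "\<forall>\<^sub>F \<mu> in at 0. h1 (s \<mu> * l) * g (s \<mu> * l) * l \<noteq> 0"
  proof -
    have "((\<lambda>\<mu>. h1 (s \<mu> * l) * g (s \<mu> * l) * l) \<longlongrightarrow> h1 l * h1 l * l) (at 0)"
      using lim_g lim_h1 by (intro tendsto_intros)
    then show ?thesis by (rule tendsto_imp_eventually_ne) (use h1(2) l in auto)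
  qed
  have lim2: "((\<lambda>\<mu>. (s \<mu> - 1) / \<mu>\<^sup>2) \<longlongrightarrow> - K / (h1 l * h1 l * l)) (at 0)"
    by (rule Lim_transform_eventually[OF lim1 eventually_mono[OF ne]]) simp
  have "((\<lambda>\<mu>. (s \<mu> - 1) / \<mu>\<^sup>2 * \<mu>) \<longlongrightarrow> - K / (h1 l * h1 l * l) * 0) (at 0)"
    by (intro tendsto_mult lim2 tendsto_ident_at)
  moreover have "(s \<mu> - 1) / \<mu>\<^sup>2 * \<mu> = (s \<mu> - s 0) / (\<mu> - 0)" for \<mu>
    using s0 by (cases "\<mu> = 0") (simp_all add: power2_eq_square)
  ultimately have "((\<lambda>\<mu>. (s \<mu> - s 0) / (\<mu> - 0)) \<longlongrightarrow> 0) (at 0)" by simp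
  then have "(s has_real_derivative 0) (at 0)" by (simp add: has_field_derivative_iff)
  then have s1_0: "s1 0 = 0" using s_at0 DERIV_unique by blast
  have "((\<lambda>\<mu>. (s \<mu> - 1) / \<mu>\<^sup>2) \<longlongrightarrow> s2 / 2) (at 0)"
  proof (rule lhopital[where f' = s1 and g' = "\<lambda>\<mu>. 2 * \<mu>"])
    show "((\<lambda>\<mu>. s \<mu> - 1) \<longlongrightarrow> 0) (at 0)"
      using tendsto_diff[OF s_cont tendsto_const[of 1]] by simp
    show "((\<lambda>\<mu>. \<mu>\<^sup>2) \<longlongrightarrow> 0) (at (0::real))" by (auto intro!: tendsto_eq_intros)
    show "\<forall>\<^sub>F \<mu> in at (0::real). \<mu>\<^sup>2 \<noteq> 0" "\<forall>\<^sub>F \<mu> in at (0::real). 2 * \<mu> \<noteq> 0"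
      by (simp_all add: eventually_at_filter)
    have "\<forall>\<^sub>F \<mu> in at 0. (s has_real_derivative s1 \<mu>) (at \<mu>)"
      using s by (simp add: eventually_at_filter eventually_mono)
    then show "\<forall>\<^sub>F \<mu> in at 0. ((\<lambda>\<mu>. s \<mu> - 1) has_real_derivative s1 \<mu>) (at \<mu>)"
      by eventually_elim (auto intro!: derivative_eq_intros)
    show "\<forall>\<^sub>F \<mu> in at 0. ((\<lambda>\<mu>. \<mu>\<^sup>2) has_real_derivative 2 * \<mu>) (at \<mu>)"
      by (intro always_eventually allI) (auto intro!: derivative_eq_intros)
    have "((\<lambda>\<mu>. (s1 \<mu> - s1 0) / (\<mu> - 0)) \<longlongrightarrow> s2) (at 0)"
      using s1 by (simp add: has_field_derivative_iff)
    then have "((\<lambda>\<mu>. (s1 \<mu> - s1 0) / (\<mu> - 0) / 2) \<longlongrightarrow> s2 / 2) (at 0)" by (intro tendsto_intros) auto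
    then show "((\<lambda>\<mu>. s1 \<mu> / (2 * \<mu>)) \<longlongrightarrow> s2 / 2) (at 0)" using s1_0 by (simp add: mult.commute)
  qed
  then have "s2 / 2 = - K / (h1 l * h1 l * l)" using lim2 tendsto_unique[OF trivial_limit_at] by blast
  then show ?thesis by (simp add: power2_eq_square mult_ac)
qed

section \<open>The sign formula for classical solutions\<close>

lemma schroedinger_unique:
  fixes r r' V :: "real \<Rightarrow> real"
  assumes r: "\<And>t. t \<in> {0..T} \<Longrightarrow> (r has_real_derivative r' t) (at t within {0..T})"
    and r': "\<And>t. t \<in> {0..T} \<Longrightarrow> (r' has_real_derivative - V t * r t) (at t within {0..T})"
    and V: "\<And>t. t \<in> {0..T} \<Longrightarrow> \<bar>V t\<bar> \<le> M"
    and "r 0 = 0" "r' 0 = 0" and x: "x \<in> {0..T}"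
  shows "r x = 0"
proof -
  have "\<bar>r x\<bar> \<le> (0 + 0) * exp ((M + 2) * T)"
    by (rule schroedinger_small(1)[OF r _ V, where g = "\<lambda>_. 0"])
      (use assms in auto)
  then show ?thesis by simp
qed

lemma schroedinger_unique_backward:
  fixes r r' V :: "real \<Rightarrow> real"
  assumes r: "\<And>t. t \<in> {0..T} \<Longrightarrow> (r has_real_derivative r' t) (at t within {0..T})"
    and r': "\<And>t. t \<in> {0..T} \<Longrightarrow> (r' has_real_derivative - V t * r t) (at t within {0..T})"
    and V: "\<And>t. t \<in> {0..T} \<Longrightarrow> \<bar>V t\<bar> \<le> M"
    and "r T = 0" "r' T = 0" and x: "x \<in> {0..T}"
  shows "r x = 0"
proof -
  have refl: "((\<lambda>t. F (T - t)) has_real_derivative - d) (at t within {0..T})"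
    if "(F has_real_derivative d) (at (T - t) within {0..T})" for F d t
  proof -
    have im: "(\<lambda>t. T - t) ` {0..T} = {0..T}" by (auto simp: image_iff intro!: bexI[of _ "T - _"])
    have "((\<lambda>t. T - t) has_real_derivative - 1) (at t within {0..T})"
      by (auto intro!: derivative_eq_intros)
    from DERIV_image_chain[OF _ this, of F d] that show ?thesis by (simp add: im o_def)
  qed
  have "(\<lambda>t. r (T - t)) (T - x) = 0"
  proof (rule schroedinger_unique[where r = "\<lambda>t. r (T - t)" and x = "T - x" and V = "\<lambda>t. V (T - t)" and T = T and M = M and r' = "\<lambda>t. - r' (T - t)"])
    fix t assume t: "t \<in> {0..T}"
    then have t': "T - t \<in> {0..T}" by auto
    show "((\<lambda>t. r (T - t)) has_real_derivative - r' (T - t)) (at t within {0..T})"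
      by (rule refl[OF r[OF t']])
    show "((\<lambda>t. - r' (T - t)) has_real_derivative - V (T - t) * r (T - t)) (at t within {0..T})"
      using DERIV_minus[OF refl[OF r'[OF t']]] by simp
    show "\<bar>V (T - t)\<bar> \<le> M" using V[OF t'] .
  qed (use assms in auto)
  then show ?thesis by simp
qed

text \<open>The sign formula when the eigenpairs are given as real classical solutions. Each pair is normalized by its initial slopes,
which do not both vanish by uniqueness.\<close>

lemma classical_sign_formula:
  fixes \<phi> h Vp Vm p p1 q q1 s s1 :: "real \<Rightarrow> real"
  assumes l: "0 < l" "l < R"
    and Vp: "\<And>t. t \<in> {0..R} \<Longrightarrow> \<bar>Vp t\<bar> \<le> M"
    and Vm: "\<And>t. t \<in> {0..R} \<Longrightarrow> \<bar>Vm t\<bar> \<le> M"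
    and phi: "\<And>t. t \<in> {0..R} \<Longrightarrow> (\<phi> has_real_derivative h t) (at t within {0..R})"
    and h: "\<And>t. t \<in> {0..R} \<Longrightarrow> (h has_real_derivative - (Vm t * \<phi> t)) (at t within {0..R})"
    and h1: "\<And>t. t \<in> {0..R} \<Longrightarrow> ((\<lambda>t. - (Vm t * \<phi> t)) has_real_derivative - Vp t * h t) (at t within {0..R})"
    and h_bdry: "h 0 = 0" "h l = 0" and h_ne: "\<exists>t\<in>{0..l}. h t \<noteq> 0"
    and p: "schroedinger_solution {0..l} Vm p p1" "p 0 = 1" "p1 0 = 0"
    and q: "schroedinger_solution {0..l} Vm q q1" "q 0 = 0" "q1 0 = 1"
    and ql: "q l \<noteq> 0"
    and s0: "s 0 = 1" and e: "0 < e"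
    and s: "\<And>\<mu>. \<mu> \<in> {-e<..<e} \<Longrightarrow> (s has_real_derivative s1 \<mu>) (at \<mu>)"
    and s1: "(s1 has_real_derivative s2) (at 0)"
    and eig: "\<And>\<mu>. \<mu> \<in> {-e<..<e} \<Longrightarrow> 0 < s \<mu> * l \<and> s \<mu> * l \<le> R \<and> (\<exists>U U1 W W1.
       (\<forall>t\<in>{0..s \<mu> * l}. (U has_real_derivative U1 t) (at t within {0..s \<mu> * l})) \<and>
       (\<forall>t\<in>{0..s \<mu> * l}. (U1 has_real_derivative - \<mu> * W t - Vp t * U t) (at t within {0..s \<mu> * l})) \<and>
       (\<forall>t\<in>{0..s \<mu> * l}. (W has_real_derivative W1 t) (at t within {0..s \<mu> * l})) \<and>
       (\<forall>t\<in>{0..s \<mu> * l}. (W1 has_real_derivative \<mu> * U t - Vm t * W t) (at t within {0..s \<mu> * l})) \<and>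
       U 0 = 0 \<and> U (s \<mu> * l) = 0 \<and> W 0 = 0 \<and> W (s \<mu> * l) = 0 \<and>
       (\<exists>t\<in>{0..s \<mu> * l}. U t \<noteq> 0 \<or> W t \<noteq> 0))"
  shows "sgn s2 = sgn (integral {0..l} (\<lambda>x. (p x)\<^sup>2) - p l / q l * l\<^sup>2)"
proof -
  define h1 where "h1 t = - (Vm t * \<phi> t)" for t
  have h': "(h has_real_derivative h1 t) (at t within {0..R})"
    and h1': "(h1 has_real_derivative - Vp t * h t) (at t within {0..R})" if "t \<in> {0..R}" for t
    using h[OF that] h1[OF that] unfolding h1_def by auto
  note sub = deriv_subinterval[of _ _ _ R 0 l]
  have phi_l: "(\<phi> has_real_derivative h t) (at t within {0..l})"
    and h_l: "(h has_real_derivative h1 t) (at t within {0..l})"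
    and h1_l: "(h1 has_real_derivative - Vp t * h t) (at t within {0..l})" if "t \<in> {0..l}" for t
    using phi[of t] h'[of t] h1'[of t] that l by (auto intro!: sub)
  have p': "(p has_real_derivative p1 t) (at t within {0..l})"
       "(p1 has_real_derivative - Vm t * p t) (at t within {0..l})" if "t \<in> {0..l}" for t
    using p(1) that by (auto simp: schroedinger_solution_def)
  have q': "(q has_real_derivative q1 t) (at t within {0..l})"
       "(q1 has_real_derivative - Vm t * q t) (at t within {0..l})" if "t \<in> {0..l}" for t
    using q(1) that by (auto simp: schroedinger_solution_def)
  have Vpl: "\<bar>Vp t\<bar> \<le> M" and Vml: "\<bar>Vm t\<bar> \<le> M" if "t \<in> {0..l}" for t using Vp Vm l that by auto
  have h10: "h1 0 \<noteq> 0"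
    using schroedinger_unique[OF h_l h1_l Vpl h_bdry(1)] h_ne by blast
  have h1l: "h1 l \<noteq> 0"
    using schroedinger_unique_backward[OF h_l h1_l Vpl h_bdry(2)] h_ne by blast
  have phi0: "\<phi> 0 \<noteq> 0" using h10 by (auto simp: h1_def)
  have phi_p: "\<phi> t = \<phi> 0 * p t" if t: "t \<in> {0..l}" for t
  proof -
    have "\<phi> t - \<phi> 0 * p t = 0"
    proof (rule schroedinger_unique[where V = Vm and T = l and M = M and r' = "\<lambda>t. h t - \<phi> 0 * p1 t" and r = "\<lambda>t. \<phi> t - \<phi> 0 * p t"])
      fix t assume t: "t \<in> {0..l}"
      show "((\<lambda>t. \<phi> t - \<phi> 0 * p t) has_real_derivative h t - \<phi> 0 * p1 t) (at t within {0..l})"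
        using phi_l[OF t] p'[OF t] by (auto intro!: derivative_eq_intros)
      show "((\<lambda>t. h t - \<phi> 0 * p1 t) has_real_derivative - Vm t * (\<phi> t - \<phi> 0 * p t)) (at t within {0..l})"
        using h_l[OF t] p'[OF t] by (auto intro!: derivative_eq_intros simp: h1_def algebra_simps)
    qed (use p h_bdry t Vml in auto)
    then show ?thesis by simp
  qed
  have wronskian: "q1 t * \<phi> t - q t * h t = \<phi> 0" if t: "t \<in> {0..l}" for t
  proof -
    have "\<bar>(q1 t * \<phi> t - q t * h t) - (q1 0 * \<phi> 0 - q 0 * h 0)\<bar> \<le> 0 * \<bar>t - 0\<bar>"
    proof (rule lipschitz_bound[where F' = "\<lambda>_. 0"])
      fix t assume t: "t \<in> {0..l}"
      show "((\<lambda>t. q1 t * \<phi> t - q t * h t) has_real_derivative 0) (at t within {0..l})"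
        using phi_l[OF t] h_l[OF t] q'[OF t] by (auto intro!: derivative_eq_intros simp: h1_def)
    qed (use t in auto)
    then show ?thesis using q by simp
  qed
  \<comment> \<open>\<open>x \<phi> / 2\<close> solves the inhomogeneous equation because \<open>(x \<phi>)'' = x \<phi>'' + 2
  \<phi>'\<close>; the multiple of q restores the boundary value at l.\<close>
  define B where "B = - l * \<phi> l / (2 * q l)"
  define w where "w t = t * \<phi> t / 2 + B * q t" for t
  define w1 where "w1 t = \<phi> t / 2 + t * h t / 2 + B * q1 t" for t
  define I where "I t = integral {0..t} (\<lambda>x. (\<phi> x)\<^sup>2)" for t
  \<comment> \<open>Partial integration of h w; the second bracket is a primitive of 2 q h by the Wronskian identity.\<close>
  define F where "F t = (t * (\<phi> t)\<^sup>2 - I t) / 4 + B / 2 * (q t * \<phi> t - \<phi> 0 * t)" for t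
  have w': "(w has_real_derivative w1 t) (at t within {0..l})"
    and w1': "(w1 has_real_derivative h t - Vm t * w t) (at t within {0..l})" if t: "t \<in> {0..l}" for t
    unfolding w_def w1_def using phi_l[OF t] h_l[OF t] q'[OF t]
    by (auto intro!: derivative_eq_intros simp: h1_def field_simps)
  have w_bdry: "w 0 = 0" "w l = 0" using q ql by (auto simp: w_def B_def)
  have phi_cont: "continuous_on {0..l} \<phi>" by (rule DERIV_continuous_on[OF phi_l])
  have F': "(F has_real_derivative h t * w t) (at t within {0..l})" if t: "t \<in> {0..l}" for t
  proof -
    have "(I has_real_derivative (\<phi> t)\<^sup>2) (at t within {0..l})"
      unfolding I_def by (rule integral_has_real_derivative) (use t in \<open>auto intro!: continuous_intros phi_cont\<close>)
    moreover have "q1 t * \<phi> t = q t * h t + \<phi> 0" using wronskian[OF t] by simp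
    ultimately show ?thesis
      unfolding F_def w_def using phi_l[OF t] q'[OF t]
      by (auto intro!: derivative_eq_intros) (simp add: field_simps power2_eq_square)
  qed
  have F0: "F 0 = 0" using q by (simp add: F_def I_def)
  have Il: "I l = (\<phi> 0)\<^sup>2 * integral {0..l} (\<lambda>x. (p x)\<^sup>2)"
  proof -
    have "I l = integral {0..l} (\<lambda>x. (\<phi> 0)\<^sup>2 * (p x)\<^sup>2)"
      unfolding I_def
    proof (rule integral_cong)
      fix x assume "x \<in> {0..l}"
      from phi_p[OF this] show "(\<phi> x)\<^sup>2 = (\<phi> 0)\<^sup>2 * (p x)\<^sup>2" by (simp add: power_mult_distrib)
    qed
    then show ?thesis by simp
  qed
  have Fl: "F l = - (\<phi> 0)\<^sup>2 / 4 * (integral {0..l} (\<lambda>x. (p x)\<^sup>2) - p l / q l * l\<^sup>2)"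
  proof -
    have "\<phi> l = \<phi> 0 * p l" using phi_p[of l] l by simp
    then show ?thesis unfolding F_def B_def Il using ql
      by (simp add: field_simps power2_eq_square)
  qed
  \<comment> \<open>The eigenvalue curve is differentiable at 0, so the interval length is Lipschitz there with any constant above
  \<open>|s'(0)| l\<close>.\<close>
  define S where "S = (\<bar>s1 0\<bar> + 1) * l"
  have S: "0 \<le> S" using l by (simp add: S_def)
  obtain C \<delta> where \<delta>: "0 < \<delta>" and est: "\<And>\<mu> L U U1 W W1. \<bar>\<mu>\<bar> < \<delta> \<Longrightarrow> 0 < L \<Longrightarrow> L \<le> R \<Longrightarrow> \<bar>L - l\<bar> \<le> S * \<bar>\<mu>\<bar> \<Longrightarrow>
     (\<forall>t\<in>{0..L}. (U has_real_derivative U1 t) (at t within {0..L})) \<Longrightarrow>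
     (\<forall>t\<in>{0..L}. (U1 has_real_derivative - \<mu> * W t - Vp t * U t) (at t within {0..L})) \<Longrightarrow>
     (\<forall>t\<in>{0..L}. (W has_real_derivative W1 t) (at t within {0..L})) \<Longrightarrow>
     (\<forall>t\<in>{0..L}. (W1 has_real_derivative \<mu> * U t - Vm t * W t) (at t within {0..L})) \<Longrightarrow>
     U 0 = 0 \<Longrightarrow> U L = 0 \<Longrightarrow> W 0 = 0 \<Longrightarrow> W L = 0 \<Longrightarrow> (U1 0)\<^sup>2 + (W1 0)\<^sup>2 = 1 \<Longrightarrow>
     \<bar>h1 L * h L + \<mu>\<^sup>2 * F l\<bar> \<le> C * \<bar>\<mu>\<bar>^3"
    using eigenpair_estimate[OF l S Vp Vm h' h1' h_bdry h10 w' w1' w_bdry q'(1) q'(2) q(2,3) ql F' F0]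
    by blast
  have ev: "\<forall>\<^sub>F \<mu> in at 0. \<bar>h1 (s \<mu> * l) * h (s \<mu> * l) + \<mu>\<^sup>2 * F l\<bar> \<le> C * \<bar>\<mu>\<bar>^3"
  proof -
    have s_at0: "(s has_real_derivative s1 0) (at 0)" using s e by auto
    have "((\<lambda>\<mu>. (s \<mu> - 1) / \<mu>) \<longlongrightarrow> s1 0) (at 0)"
      using s_at0 s0 by (simp add: has_field_derivative_iff)
    then have 1: "\<forall>\<^sub>F \<mu> in at 0. dist ((s \<mu> - 1) / \<mu>) (s1 0) < 1" by (rule tendstoD) simp
    have 2: "\<forall>\<^sub>F \<mu> in at (0::real). \<mu> \<noteq> 0 \<and> \<bar>\<mu>\<bar> < Min {e, \<delta>, 1}"
      unfolding eventually_at using e \<delta> by (intro exI[of _ "Min {e, \<delta>, 1}"]) auto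
    show ?thesis using 1 2
    proof eventually_elim
      case (elim \<mu>)
      let ?L = "s \<mu> * l"
      have mu: "\<mu> \<in> {-e<..<e}" "\<bar>\<mu>\<bar> < \<delta>" "\<bar>\<mu>\<bar> \<le> 1" "\<mu> \<noteq> 0" using elim by auto
      have "\<bar>(s \<mu> - 1) / \<mu>\<bar> \<le> \<bar>s1 0\<bar> + 1" using elim by (simp add: dist_real_def)
      then have "\<bar>s \<mu> - 1\<bar> \<le> (\<bar>s1 0\<bar> + 1) * \<bar>\<mu>\<bar>" using mu(4) by (simp add: abs_divide field_simps)
      then have "\<bar>s \<mu> - 1\<bar> * l \<le> (\<bar>s1 0\<bar> + 1) * \<bar>\<mu>\<bar> * l" using l by (intro mult_right_mono) auto
      moreover have "\<bar>?L - l\<bar> = \<bar>s \<mu> - 1\<bar> * l" 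
        using l abs_mult[of "s \<mu> - 1" l] by (simp add: left_diff_distrib)
      ultimately have Ll: "\<bar>?L - l\<bar> \<le> S * \<bar>\<mu>\<bar>" by (simp add: S_def mult_ac)
      from eig[OF mu(1)] obtain U U1 W W1 where L: "0 < ?L" "?L \<le> R" and
        U: "\<And>t. t \<in> {0..?L} \<Longrightarrow> (U has_real_derivative U1 t) (at t within {0..?L})" and
        U1: "\<And>t. t \<in> {0..?L} \<Longrightarrow> (U1 has_real_derivative - \<mu> * W t - Vp t * U t) (at t within {0..?L})" and
        W: "\<And>t. t \<in> {0..?L} \<Longrightarrow> (W has_real_derivative W1 t) (at t within {0..?L})" and
        W1: "\<And>t. t \<in> {0..?L} \<Longrightarrow> (W1 has_real_derivative \<mu> * U t - Vm t * W t) (at t within {0..?L})" and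
        bdry: "U 0 = 0" "U ?L = 0" "W 0 = 0" "W ?L = 0" and
        ne: "\<exists>t\<in>{0..?L}. U t \<noteq> 0 \<or> W t \<noteq> 0"
        by blast
      define N where "N = sqrt ((U1 0)\<^sup>2 + (W1 0)\<^sup>2)"
      have "(U1 0)\<^sup>2 + (W1 0)\<^sup>2 \<noteq> 0"
      proof
        assume z: "(U1 0)\<^sup>2 + (W1 0)\<^sup>2 = 0"
        have "(U t)\<^sup>2 + (U1 t)\<^sup>2 + (W t)\<^sup>2 + (W1 t)\<^sup>2 \<le> 0" if t: "t \<in> {0..?L}" for t
        proof -
          have "(U t)\<^sup>2 + (U1 t)\<^sup>2 + (W t)\<^sup>2 + (W1 t)\<^sup>2
            \<le> ((U 0)\<^sup>2 + (U1 0)\<^sup>2 + (W 0)\<^sup>2 + (W1 0)\<^sup>2) * exp ((M + 2) * t)"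
            by (rule system_gronwall[OF U U1 W W1 _ _ mu(3) t]) (use Vp Vm L in auto)
          then show ?thesis using z bdry by simp
        qed
        then have "U t = 0 \<and> W t = 0" if t: "t \<in> {0..?L}" for t
        proof -
          have "(U t)\<^sup>2 + (W t)\<^sup>2 \<le> 0"
            using \<open>\<And>t. t \<in> {0..?L} \<Longrightarrow> (U t)\<^sup>2 + (U1 t)\<^sup>2 + (W t)\<^sup>2 + (W1 t)\<^sup>2 \<le> 0\<close>[OF t]
              zero_le_power2[of "U1 t"] zero_le_power2[of "W1 t"] by linarith
          then show ?thesis by (simp add: sum_power2_le_zero_iff)
        qed
        with ne show False by blast
      qed
      then have N: "N \<noteq> 0" "N\<^sup>2 = (U1 0)\<^sup>2 + (W1 0)\<^sup>2" by (simp_all add: N_def)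
      show ?case
      proof (rule est[of \<mu> ?L "\<lambda>t. U t / N" "\<lambda>t. U1 t / N" "\<lambda>t. W t / N" "\<lambda>t. W1 t / N"])
        show "\<forall>t\<in>{0..?L}. ((\<lambda>t. U t / N) has_real_derivative U1 t / N) (at t within {0..?L})"
          using DERIV_cdivide[OF U, of _ N] by simp
        show "\<forall>t\<in>{0..?L}. ((\<lambda>t. W t / N) has_real_derivative W1 t / N) (at t within {0..?L})"
          using DERIV_cdivide[OF W, of _ N] by simp
        show "\<forall>t\<in>{0..?L}. ((\<lambda>t. U1 t / N) has_real_derivative - \<mu> * (W t / N) - Vp t * (U t / N)) (at t within {0..?L})"
          using DERIV_cdivide[OF U1, of _ N] by (simp add: diff_divide_distrib)
        show "\<forall>t\<in>{0..?L}. ((\<lambda>t. W1 t / N) has_real_derivative \<mu> * (U t / N) - Vm t * (W t / N)) (at t within {0..?L})"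
          using DERIV_cdivide[OF W1, of _ N] by (simp add: diff_divide_distrib)
        show "(U1 0 / N)\<^sup>2 + (W1 0 / N)\<^sup>2 = 1"
          using N by (auto simp add: power_divide simp flip: add_divide_distrib)
      qed (use mu L Ll bdry in auto)
    qed
  qed
  have at_l: "at l within {0..R} = at l" using l by (intro at_within_interior) auto
  have s2: "s2 = - 2 * F l / (l * (h1 l)\<^sup>2)"
  proof (rule curve_second_derivative[OF l(1) s0 _ s1 _ h_bdry(2) _ h1l ev])
    have "\<forall>\<^sub>F \<mu> in nhds 0. \<mu> \<in> {-e<..<e}" by (rule eventually_nhds_in_open) (use e in auto)
    then show "\<forall>\<^sub>F \<mu> in nhds 0. (s has_real_derivative s1 \<mu>) (at \<mu>)"
      by eventually_elim (rule s)
    show "(h has_real_derivative h1 l) (at l)" using h'[of l] l by (simp add: at_l)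
    show "isCont h1 l" using h1'[of l] l by (auto simp: at_l intro: DERIV_isCont)
  qed
  have "s2 = (\<phi> 0)\<^sup>2 / (2 * l * (h1 l)\<^sup>2) * (integral {0..l} (\<lambda>x. (p x)\<^sup>2) - p l / q l * l\<^sup>2)"
    unfolding s2 Fl using l h1l by (simp add: field_simps)
  moreover have "0 < (\<phi> 0)\<^sup>2 / (2 * l * (h1 l)\<^sup>2)" using phi0 l h1l by simp
  ultimately show ?thesis by (simp only: sgn_mult sgn_pos mult_1_left)
qed

section \<open>Square-integrable functions on an interval\<close>

abbreviation leb :: "real \<Rightarrow> real measure" where
  "leb l \<equiv> lebesgue_on {0<..<l}"

lemma finite_measure_leb: "finite_measure (leb l)"
  by (rule finite_measure_lebesgue_on) simp

lemma L2_D: "u \<in> L2 l \<Longrightarrow> u \<in> borel_measurable (leb l)"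
    "u \<in> L2 l \<Longrightarrow> integrable (leb l) (\<lambda>x. (cmod (u x))\<^sup>2)"
  by (auto simp: L2_def)

lemma L2_dominated:
  assumes "u \<in> borel_measurable (leb l)" "integrable (leb l) w"
    and "\<And>x. 0 < x \<Longrightarrow> x < l \<Longrightarrow> (cmod (u x))\<^sup>2 \<le> w x"
  shows "u \<in> L2 l"
proof -
  have "integrable (leb l) (\<lambda>x. (cmod (u x))\<^sup>2)"
  proof (rule Bochner_Integration.integrable_bound[OF assms(2)])
    show "AE x in leb l. norm ((cmod (u x))\<^sup>2) \<le> norm (w x)"
    proof (rule AE_I2)
      fix x assume "x \<in> space (leb l)"
      then show "norm ((cmod (u x))\<^sup>2) \<le> norm (w x)" using assms(3)[of x] by simp
    qed
  qed (use assms(1) in measurable)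
  with assms(1) show ?thesis by (simp add: L2_def)
qed

lemma L2_bounded:
  assumes "u \<in> borel_measurable (leb l)" "\<And>x. 0 < x \<Longrightarrow> x < l \<Longrightarrow> cmod (u x) \<le> K"
  shows "u \<in> L2 l"
proof (rule L2_dominated[OF assms(1)])
  interpret finite_measure "leb l" by (rule finite_measure_leb)
  show "integrable (leb l) (\<lambda>x. K\<^sup>2)" by simp
qed (use assms(2) in \<open>auto intro: power_mono\<close>)

lemma L2_continuous:
  assumes "continuous_on {0..l} u"
  shows "u \<in> L2 l"
proof -
  have "bounded (u ` {0..l})" using assms compact_continuous_image compact_imp_bounded by blast
  then obtain K where K: "\<forall>x\<in>{0..l}. cmod (u x) \<le> K" by (auto simp: bounded_iff)
  have "continuous_on {0<..<l} u" using assms by (rule continuous_on_subset) auto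
  then have "u \<in> borel_measurable (leb l)" by (rule continuous_imp_measurable_on_sets_lebesgue) simp
  then show ?thesis by (rule L2_bounded[where K = K]) (use K in auto)
qed

lemma norm_add_squared_le: "(norm (a + b))\<^sup>2 \<le> 2 * (norm a)\<^sup>2 + 2 * (norm b)\<^sup>2"
  for a b :: "'a :: real_normed_vector"
proof -
  have "(norm (a + b))\<^sup>2 \<le> (norm a + norm b)\<^sup>2" by (intro power_mono norm_triangle_ineq) simp
  also have "\<dots> \<le> 2 * (norm a)\<^sup>2 + 2 * (norm b)\<^sup>2"
    using sum_squares_bound[of "norm a" "norm b"] by (simp add: power2_sum)
  finally show ?thesis .
qed

lemma L2_add:
  assumes "u \<in> L2 l" "v \<in> L2 l"
  shows "(\<lambda>x. u x + v x) \<in> L2 l"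
proof (rule L2_dominated)
  show "integrable (leb l) (\<lambda>x. 2 * (cmod (u x))\<^sup>2 + 2 * (cmod (v x))\<^sup>2)"
    using L2_D(2)[OF assms(1)] L2_D(2)[OF assms(2)] by simp
qed (use L2_D(1)[OF assms(1)] L2_D(1)[OF assms(2)] norm_add_squared_le in auto)

lemma L2_uminus: "u \<in> L2 l \<Longrightarrow> (\<lambda>x. - u x) \<in> L2 l"
  by (auto simp: L2_def)

lemma L2_diff: "u \<in> L2 l \<Longrightarrow> v \<in> L2 l \<Longrightarrow> (\<lambda>x. u x - v x) \<in> L2 l"
  using L2_add[of u l "\<lambda>x. - v x"] L2_uminus[of v l] by simp

lemma L2_cnj: "u \<in> L2 l \<Longrightarrow> (\<lambda>x. cnj (u x)) \<in> L2 l"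
  unfolding L2_def using borel_measurable_continuous_on[of cnj u] continuous_on_cnj continuous_on_id
  by (auto simp: o_def)

lemma L2_mult_integrable:
  assumes "u \<in> L2 l" "v \<in> L2 l"
  shows "integrable (leb l) (\<lambda>x. u x * v x)"
proof (rule Bochner_Integration.integrable_bound)
  show "integrable (leb l) (\<lambda>x. (cmod (u x))\<^sup>2 + (cmod (v x))\<^sup>2)"
    using L2_D(2)[OF assms(1)] L2_D(2)[OF assms(2)] by simp
  show "(\<lambda>x. u x * v x) \<in> borel_measurable (leb l)"
    using L2_D(1)[OF assms(1)] L2_D(1)[OF assms(2)] by measurable
  have "norm (a * b) \<le> norm ((cmod a)\<^sup>2 + (cmod b)\<^sup>2)" for a b
  proof -
    have "cmod a * cmod b \<le> (cmod a)\<^sup>2 + (cmod b)\<^sup>2"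
      using sum_squares_bound[of "cmod a" "cmod b"] mult_nonneg_nonneg[OF norm_ge_zero[of a] norm_ge_zero[of b]]
      by linarith
    then show ?thesis by (simp add: norm_mult)
  qed
  then show "AE x in leb l. norm (u x * v x) \<le> norm ((cmod (u x))\<^sup>2 + (cmod (v x))\<^sup>2)" by simp
qed

lemma L2_integrable: "u \<in> L2 l \<Longrightarrow> integrable (leb l) u"
  using L2_mult_integrable[of u l "\<lambda>_. 1"] L2_continuous[of l "\<lambda>_. 1"] by simp

lemma L2_norm_nonneg: "0 \<le> L2_norm l u"
  by (simp add: L2_norm_def)

lemma L2_norm_squared: "(L2_norm l u)\<^sup>2 = (LINT x|leb l. (cmod (u x))\<^sup>2)"
  by (simp add: L2_norm_def)

lemma L2_norm_eq_0_iff: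
  assumes "u \<in> L2 l"
  shows "L2_norm l u = 0 \<longleftrightarrow> ae_eq l u (\<lambda>_. 0)"
proof -
  have "L2_norm l u = 0 \<longleftrightarrow> (LINT x|leb l. (cmod (u x))\<^sup>2) = 0" by (simp add: L2_norm_def)
  also have "\<dots> \<longleftrightarrow> (AE x in leb l. (cmod (u x))\<^sup>2 = 0)"
    by (rule integral_nonneg_eq_0_iff_AE) (use L2_D(2)[OF assms] in auto)
  finally show ?thesis by (simp add: ae_eq_def)
qed

text \<open>The quadratic \<open>t \<mapsto> \<integral> (|u| - t |v|)\<^sup>2\<close> is nonnegative, so its discriminant is not
positive.\<close>

lemma L2_Cauchy_Schwarz_norm:
  assumes "u \<in> L2 l" "v \<in> L2 l"
  shows "(LINT x|leb l. cmod (u x * v x)) \<le> L2_norm l u * L2_norm l v"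
proof -
  let ?A = "LINT x|leb l. (cmod (u x))\<^sup>2" and ?B = "LINT x|leb l. (cmod (v x))\<^sup>2"
    and ?D = "LINT x|leb l. cmod (u x * v x)"
  note int = L2_D(2)[OF assms(1)] L2_D(2)[OF assms(2)] integrable_norm[OF L2_mult_integrable[OF assms]]
  have B0: "0 \<le> ?B" by (rule integral_nonneg_AE) simp
  have D0: "0 \<le> ?D" by (rule integral_nonneg_AE) simp
  have quad: "0 \<le> ?A - 2 * t * ?D + t\<^sup>2 * ?B" for t
  proof -
    have "0 \<le> (LINT x|leb l. (cmod (u x) - t * cmod (v x))\<^sup>2)" by (rule integral_nonneg_AE) simp
    also have "(LINT x|leb l. (cmod (u x) - t * cmod (v x))\<^sup>2)
       = (LINT x|leb l. (cmod (u x))\<^sup>2 - 2 * t * cmod (u x * v x) + t\<^sup>2 * (cmod (v x))\<^sup>2)"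
      by (simp add: power2_diff power_mult_distrib norm_mult algebra_simps)
    also have "\<dots> = ?A - 2 * t * ?D + t\<^sup>2 * ?B" using int by simp
    finally show ?thesis .
  qed
  have "?D\<^sup>2 \<le> ?A * ?B"
  proof (cases "?B = 0")
    case True
    have "?D = 0"
    proof (rule ccontr)
      assume "?D \<noteq> 0"
      \<comment> \<open>When v vanishes almost everywhere the quadratic is affine, and this value of t would make it -1.\<close>
      then show False using quad[of "(?A + 1) / (2 * ?D)"] True by (simp add: field_simps)
    qed
    then show ?thesis using True by simp
  next
    case False
    then have "0 < ?B" using B0 by linarith
    moreover have "?A - 2 * (?D / ?B) * ?D + (?D / ?B)\<^sup>2 * ?B = ?A - ?D\<^sup>2 / ?B"
      using False by (simp add: power2_eq_square)
    moreover from this quad[of "?D / ?B"] have "?D\<^sup>2 / ?B \<le> ?A" by linarith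
    ultimately show ?thesis by (simp add: pos_divide_le_eq)
  qed
  then have "?D \<le> sqrt (?A * ?B)" by (rule real_le_rsqrt)
  then show ?thesis by (simp add: L2_norm_def real_sqrt_mult)
qed

lemma L2_Cauchy_Schwarz:
  assumes "u \<in> L2 l" "v \<in> L2 l"
  shows "cmod (LINT x|leb l. u x * v x) \<le> L2_norm l u * L2_norm l v"
  using integral_norm_bound[of "leb l" "\<lambda>x. u x * v x"] L2_Cauchy_Schwarz_norm[OF assms] by linarith

lemma L2_norm_add_squared:
  assumes "u \<in> L2 l" "v \<in> L2 l"
  shows "(L2_norm l (\<lambda>x. u x + v x))\<^sup>2 \<le> 2 * (L2_norm l u)\<^sup>2 + 2 * (L2_norm l v)\<^sup>2"
proof -
  note int = L2_D(2)[OF assms(1)] L2_D(2)[OF assms(2)]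
  have "(L2_norm l (\<lambda>x. u x + v x))\<^sup>2 \<le> (LINT x|leb l. 2 * (cmod (u x))\<^sup>2 + 2 * (cmod (v x))\<^sup>2)"
    unfolding L2_norm_squared
    by (rule integral_mono) (use int L2_D(2)[OF L2_add[OF assms]] norm_add_squared_le in auto)
  also have "\<dots> = 2 * (L2_norm l u)\<^sup>2 + 2 * (L2_norm l v)\<^sup>2" using int by (simp add: L2_norm_squared)
  finally show ?thesis .
qed

lemma L2_norm_uniform:
  assumes "0 < l" "0 \<le> K" "u \<in> L2 l" "\<And>x. 0 < x \<Longrightarrow> x < l \<Longrightarrow> cmod (u x) \<le> K"
  shows "(L2_norm l u)\<^sup>2 \<le> l * K\<^sup>2"
proof -
  interpret finite_measure "leb l" by (rule finite_measure_leb)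
  have "(L2_norm l u)\<^sup>2 \<le> (LINT x|leb l. K\<^sup>2)"
    unfolding L2_norm_squared
    by (rule integral_mono) (use assms L2_D(2) in \<open>auto intro: power_mono\<close>)
  also have "\<dots> = l * K\<^sup>2" using assms(1) by (simp add: measure_restrict_space)
  finally show ?thesis .
qed

lemma LINT_eq_integral:
  fixes f :: "real \<Rightarrow> complex"
  assumes "integrable (leb l) f"
  shows "(LINT x|leb l. f x) = integral {0..l} f" "f absolutely_integrable_on {0..l}"
proof -
  show "(LINT x|leb l. f x) = integral {0..l} f"
    using lebesgue_integral_eq_integral[OF assms] integral_open_interval[of 0 l f] by simp
  have "f absolutely_integrable_on {0<..<l}"
    using assms by (simp add: integrable_restrict_space set_integrable_def)
  then show "f absolutely_integrable_on {0..l}"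
    
    using absolutely_integrable_on_open_interval[where f = f and a = 0 and b = l] by simp
qed

text \<open>Convergence of derivatives in \<open>L\<^sup>2\<close> gives uniform convergence of primitives.\<close>

lemma primitive_bound:
  assumes l: "0 < l" and g: "g \<in> L2 l" and x: "x \<in> {0..l}"
  shows "cmod (integral {0..x} g) \<le> sqrt l * L2_norm l g"
proof -
  have ai: "g absolutely_integrable_on {0..l}" using LINT_eq_integral(2)[OF L2_integrable[OF g]] .
  have ax: "g absolutely_integrable_on {0..x}"
    using ai by (rule absolutely_integrable_on_subinterval) (use x in auto)
  have "cmod (integral {0..x} g) \<le> integral {0..x} (\<lambda>x. cmod (g x))"
    using ax by (simp add: absolutely_integrable_on_def integral_norm_bound_integral)
  also have "\<dots> \<le> integral {0..l} (\<lambda>x. cmod (g x))"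
    using ai ax x by (intro integral_subset_le) (auto simp: absolutely_integrable_on_def)
  also have "\<dots> = (LINT x|leb l. cmod (g x))"
    using lebesgue_integral_eq_integral[OF integrable_norm[OF L2_integrable[OF g]]]
      integral_open_interval[of 0 l "\<lambda>x. cmod (g x)"] by simp
  also have "\<dots> \<le> L2_norm l (\<lambda>_. 1) * L2_norm l g"
    using L2_Cauchy_Schwarz_norm[OF L2_continuous[of l "\<lambda>_. 1"] g] by simp
  also have "L2_norm l (\<lambda>_. 1) = sqrt l" using l by (simp add: L2_norm_def measure_restrict_space)
  finally show ?thesis .
qed

section \<open>Test functions, weak derivatives and \<open>H\<^sup>1\<^sub>0\<close>\<close>

lemma Cc1_D:
  assumes "\<psi> \<in> Cc1 l"
  shows "(\<psi> has_vector_derivative vector_derivative \<psi> (at x)) (at x)"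
    and "continuous_on UNIV (\<lambda>x. vector_derivative \<psi> (at x))"
    and "continuous_on S \<psi>"
    and "\<psi> 0 = 0" and "\<psi> l = 0"
proof -
  have C1: "\<psi> C1_differentiable_on UNIV" using assms by (simp add: Cc1_def)
  show d: "(\<psi> has_vector_derivative vector_derivative \<psi> (at x)) (at x)" for x
    using C1 by (simp add: C1_differentiable_on_eq vector_derivative_works)
  show "continuous_on UNIV (\<lambda>x. vector_derivative \<psi> (at x))"
    using C1 by (simp add: C1_differentiable_on_eq)
  show "continuous_on S \<psi>"
    using d by (meson continuous_at_imp_continuous_on has_vector_derivative_continuous)
  show "\<psi> 0 = 0" "\<psi> l = 0" using assms by (auto simp: Cc1_def)
qed

lemma Cc1_I:
  assumes "\<And>x. (\<psi> has_vector_derivative \<psi>' x) (at x)" "continuous_on UNIV \<psi>'"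
    and "0 < a" "b < l" "\<And>x. x \<notin> {a..b} \<Longrightarrow> \<psi> x = 0"
  shows "\<psi> \<in> Cc1 l" "vector_derivative \<psi> (at x) = \<psi>' x"
proof -
  show "\<psi> \<in> Cc1 l"
    unfolding Cc1_def C1_differentiable_on_def using assms by blast
  show "vector_derivative \<psi> (at x) = \<psi>' x" using assms(1) by (rule vector_derivative_at)
qed

lemma Cc1_L2:
  assumes "\<psi> \<in> Cc1 l"
  shows "\<psi> \<in> L2 l" "(\<lambda>x. vector_derivative \<psi> (at x)) \<in> L2 l"
  using Cc1_D[OF assms] by (auto intro!: L2_continuous intro: continuous_on_subset)

lemma Cc1_diff:
  assumes "\<psi> \<in> Cc1 l" "\<theta> \<in> Cc1 l"
  shows "(\<lambda>x. \<psi> x - \<theta> x) \<in> Cc1 l"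
    and "vector_derivative (\<lambda>x. \<psi> x - \<theta> x) (at x) = vector_derivative \<psi> (at x) - vector_derivative \<theta> (at x)"
proof -
  obtain a b where ab: "0 < a" "b < l" "\<And>x. x \<notin> {a..b} \<Longrightarrow> \<psi> x = 0" using assms(1) by (auto simp: Cc1_def)
  obtain c d where cd: "0 < c" "d < l" "\<And>x. x \<notin> {c..d} \<Longrightarrow> \<theta> x = 0" using assms(2) by (auto simp: Cc1_def)
  have 1: "((\<lambda>x. \<psi> x - \<theta> x) has_vector_derivative vector_derivative \<psi> (at x) - vector_derivative \<theta> (at x)) (at x)" for x
    using Cc1_D(1)[OF assms(1)] Cc1_D(1)[OF assms(2)] by (rule has_vector_derivative_diff)
  have 2: "continuous_on UNIV (\<lambda>x. vector_derivative \<psi> (at x) - vector_derivative \<theta> (at x))"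
    using Cc1_D(2)[OF assms(1)] Cc1_D(2)[OF assms(2)] by (intro continuous_intros)
  have 3: "\<psi> x - \<theta> x = 0" if "x \<notin> {min a c..max b d}" for x
  proof -
    have "x \<notin> {a..b}" "x \<notin> {c..d}" using that by auto
    then show ?thesis using ab(3) cd(3) by simp
  qed
  have 4: "0 < min a c" "max b d < l" using ab cd by auto
  show "(\<lambda>x. \<psi> x - \<theta> x) \<in> Cc1 l" by (rule Cc1_I(1)[OF 1 2 4 3])
  show "vector_derivative (\<lambda>x. \<psi> x - \<theta> x) (at x) = vector_derivative \<psi> (at x) - vector_derivative \<theta> (at x)"
    by (rule Cc1_I(2)[OF 1 2 4 3])
qed

lemma Cc1_cnj:
  assumes "\<psi> \<in> Cc1 l"
  shows "(\<lambda>x. cnj (\<psi> x)) \<in> Cc1 l"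
    and "vector_derivative (\<lambda>x. cnj (\<psi> x)) (at x) = cnj (vector_derivative \<psi> (at x))"
proof -
  obtain a b where ab: "0 < a" "b < l" "\<And>x. x \<notin> {a..b} \<Longrightarrow> \<psi> x = 0" using assms(1) by (auto simp: Cc1_def)
  have 1: "((\<lambda>x. cnj (\<psi> x)) has_vector_derivative cnj (vector_derivative \<psi> (at x))) (at x)" for x
    using Cc1_D(1)[OF assms(1)] by (rule has_vector_derivative_cnj)
  have 2: "continuous_on UNIV (\<lambda>x. cnj (vector_derivative \<psi> (at x)))"
    using Cc1_D(2)[OF assms(1)] by (intro continuous_intros)
  have 3: "cnj (\<psi> x) = 0" if "x \<notin> {a..b}" for x using ab(3)[OF that] by simp
  show "(\<lambda>x. cnj (\<psi> x)) \<in> Cc1 l" by (rule Cc1_I(1)[OF 1 2 ab(1,2) 3])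
  show "vector_derivative (\<lambda>x. cnj (\<psi> x)) (at x) = cnj (vector_derivative \<psi> (at x))"
    by (rule Cc1_I(2)[OF 1 2 ab(1,2) 3])
qed

text \<open>Membership in \<open>H\<^sup>1\<^sub>0\<close> together with the derivative \<open>g\<close>: the pair \<open>(u,g)\<close>
lies in the closure of the pairs \<open>(\<psi>,\<psi>')\<close>. Naming \<open>g\<close> avoids the arbitrary choice in
\<open>weak_diff\<close>, so that classical derivatives can be used and pairs can be subtracted.\<close>

definition H10_pair :: "real \<Rightarrow> (real \<Rightarrow> complex) \<Rightarrow> (real \<Rightarrow> complex) \<Rightarrow> bool" where
  "H10_pair l u g \<longleftrightarrow> u \<in> L2 l \<and> g \<in> L2 l \<and> (\<forall>e>0. \<exists>\<psi>\<in>Cc1 l.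
      (L2_norm l (\<lambda>x. u x - \<psi> x))\<^sup>2 +
      (L2_norm l (\<lambda>x. g x - vector_derivative \<psi> (at x)))\<^sup>2 < e)"

lemma weak_diff_weak_deriv: "u \<in> H1 l \<Longrightarrow> weak_deriv l u (weak_diff l u)"
  by (simp add: weak_diff_def H1_def someI_ex)

lemma H10_imp_pair: "u \<in> H10 l \<Longrightarrow> H10_pair l u (weak_diff l u)"
  using weak_diff_weak_deriv by (auto simp: H10_def H10_pair_def weak_deriv_def)

lemma H10_pair_diff:
  assumes 1: "H10_pair l u g" and 2: "H10_pair l v k"
  shows "H10_pair l (\<lambda>x. u x - v x) (\<lambda>x. g x - k x)"
  unfolding H10_pair_def
proof (intro conjI allI impI)
  show "(\<lambda>x. u x - v x) \<in> L2 l" "(\<lambda>x. g x - k x) \<in> L2 l"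
    using assms by (auto simp: H10_pair_def intro: L2_diff)
  fix e :: real assume "0 < e"
  then have "0 < e / 4" by simp
  obtain \<psi> where \<psi>: "\<psi> \<in> Cc1 l" "(L2_norm l (\<lambda>x. u x - \<psi> x))\<^sup>2 + (L2_norm l (\<lambda>x. g x - vector_derivative \<psi> (at x)))\<^sup>2 < e / 4"
    using 1 \<open>0 < e / 4\<close> unfolding H10_pair_def by blast
  obtain \<theta> where \<theta>: "\<theta> \<in> Cc1 l" "(L2_norm l (\<lambda>x. v x - \<theta> x))\<^sup>2 + (L2_norm l (\<lambda>x. k x - vector_derivative \<theta> (at x)))\<^sup>2 < e / 4"
    using 2 \<open>0 < e / 4\<close> unfolding H10_pair_def by blast
  have tri: "(L2_norm l (\<lambda>x. (a x - c x) - (b x - d x)))\<^sup>2 \<le> 2 * (L2_norm l (\<lambda>x. a x - b x))\<^sup>2 + 2 * (L2_norm l (\<lambda>x. c x - d x))\<^sup>2"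
    if "a \<in> L2 l" "b \<in> L2 l" "c \<in> L2 l" "d \<in> L2 l" for a b c d
  proof -
    have "(L2_norm l (\<lambda>x. (a x - b x) + - (c x - d x)))\<^sup>2
        \<le> 2 * (L2_norm l (\<lambda>x. a x - b x))\<^sup>2 + 2 * (L2_norm l (\<lambda>x. - (c x - d x)))\<^sup>2"
      by (rule L2_norm_add_squared) (intro L2_diff L2_uminus that)+
    moreover have "L2_norm l (\<lambda>x. - (c x - d x)) = L2_norm l (\<lambda>x. c x - d x)"
      by (simp add: L2_norm_def norm_minus_commute)
    ultimately show ?thesis by (simp add: algebra_simps)
  qed
  show "\<exists>\<psi>\<in>Cc1 l. (L2_norm l (\<lambda>x. u x - v x - \<psi> x))\<^sup>2 +
      (L2_norm l (\<lambda>x. g x - k x - vector_derivative \<psi> (at x)))\<^sup>2 < e"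
  proof (rule bexI[OF _ Cc1_diff(1)[OF \<psi>(1) \<theta>(1)]])
    have "(L2_norm l (\<lambda>x. u x - v x - (\<psi> x - \<theta> x)))\<^sup>2
       \<le> 2 * (L2_norm l (\<lambda>x. u x - \<psi> x))\<^sup>2 + 2 * (L2_norm l (\<lambda>x. v x - \<theta> x))\<^sup>2"
      by (rule tri) (use assms Cc1_L2 \<psi>(1) \<theta>(1) in \<open>auto simp: H10_pair_def\<close>)
    moreover have "(L2_norm l (\<lambda>x. g x - k x - (vector_derivative \<psi> (at x) - vector_derivative \<theta> (at x))))\<^sup>2
       \<le> 2 * (L2_norm l (\<lambda>x. g x - vector_derivative \<psi> (at x)))\<^sup>2
        + 2 * (L2_norm l (\<lambda>x. k x - vector_derivative \<theta> (at x)))\<^sup>2"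
      by (rule tri) (use assms Cc1_L2 \<psi>(1) \<theta>(1) in \<open>auto simp: H10_pair_def\<close>)
    ultimately show "(L2_norm l (\<lambda>x. u x - v x - (\<psi> x - \<theta> x)))\<^sup>2 +
      (L2_norm l (\<lambda>x. g x - k x - vector_derivative (\<lambda>x. \<psi> x - \<theta> x) (at x)))\<^sup>2 < e"
      unfolding Cc1_diff(2)[OF \<psi>(1) \<theta>(1)] using \<psi>(2) \<theta>(2) by linarith
  qed
qed

lemma H10_pair_cnj:
  assumes "H10_pair l u g"
  shows "H10_pair l (\<lambda>x. cnj (u x)) (\<lambda>x. cnj (g x))"
  unfolding H10_pair_def
proof (intro conjI allI impI)
  show "(\<lambda>x. cnj (u x)) \<in> L2 l" "(\<lambda>x. cnj (g x)) \<in> L2 l"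
    using assms by (auto simp: H10_pair_def intro: L2_cnj)
  fix e :: real assume "0 < e"
  then obtain \<psi> where \<psi>: "\<psi> \<in> Cc1 l" "(L2_norm l (\<lambda>x. u x - \<psi> x))\<^sup>2 + (L2_norm l (\<lambda>x. g x - vector_derivative \<psi> (at x)))\<^sup>2 < e"
    using assms unfolding H10_pair_def by blast
  show "\<exists>\<psi>\<in>Cc1 l. (L2_norm l (\<lambda>x. cnj (u x) - \<psi> x))\<^sup>2 +
      (L2_norm l (\<lambda>x. cnj (g x) - vector_derivative \<psi> (at x)))\<^sup>2 < e"
  proof (rule bexI[OF _ Cc1_cnj(1)[OF \<psi>(1)]])
    show "(L2_norm l (\<lambda>x. cnj (u x) - cnj (\<psi> x)))\<^sup>2 +
      (L2_norm l (\<lambda>x. cnj (g x) - vector_derivative (\<lambda>x. cnj (\<psi> x)) (at x)))\<^sup>2 < e"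
      using \<psi>(2) by (simp add: Cc1_cnj(2)[OF \<psi>(1)] L2_norm_def flip: complex_cnj_diff)
  qed
qed

lemma zero_if_small_multiples:
  fixes X c :: real
  assumes "0 \<le> X" "0 \<le> c" "\<And>e. 0 < e \<Longrightarrow> X \<le> c * e"
  shows "X = 0"
proof (rule ccontr)
  assume "X \<noteq> 0"
  with assms(1) have "0 < X" by simp
  then have "0 < X / (2 * (c + 1))" using assms(2) by simp
  then have "X \<le> c * (X / (2 * (c + 1)))" by (rule assms(3))
  also have "\<dots> \<le> X / 2" using assms(2) \<open>0 < X\<close> by (simp add: field_simps)
  finally show False using \<open>0 < X\<close> by simp
qed

lemma H10_pair_approx:
  assumes "H10_pair l u g" "0 < e"
  obtains \<psi> where "\<psi> \<in> Cc1 l" "L2_norm l (\<lambda>x. u x - \<psi> x) \<le> e"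
    "L2_norm l (\<lambda>x. g x - vector_derivative \<psi> (at x)) \<le> e"
proof -
  have "0 < e\<^sup>2" using assms(2) by simp
  then obtain \<psi> where \<psi>: "\<psi> \<in> Cc1 l" "(L2_norm l (\<lambda>x. u x - \<psi> x))\<^sup>2 + (L2_norm l (\<lambda>x. g x - vector_derivative \<psi> (at x)))\<^sup>2 < e\<^sup>2"
    using assms(1) unfolding H10_pair_def by blast
  have "(L2_norm l (\<lambda>x. u x - \<psi> x))\<^sup>2 \<le> e\<^sup>2" "(L2_norm l (\<lambda>x. g x - vector_derivative \<psi> (at x)))\<^sup>2 \<le> e\<^sup>2"
    using \<psi>(2) zero_le_power2[of "L2_norm l (\<lambda>x. u x - \<psi> x)"]
      zero_le_power2[of "L2_norm l (\<lambda>x. g x - vector_derivative \<psi> (at x))"] by linarith+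
  then have "L2_norm l (\<lambda>x. u x - \<psi> x) \<le> e" "L2_norm l (\<lambda>x. g x - vector_derivative \<psi> (at x)) \<le> e"
    using assms(2) by (auto intro: power2_le_imp_le)
  with \<psi>(1) show ?thesis by (rule that)
qed

text \<open>The defining identity of the weak derivative extends from test functions to \<open>H\<^sup>1\<^sub>0\<close>, because both
sides are continuous in the \<open>H\<^sup>1\<close> norm. This is the symmetry of the Dirichlet operators in the form that is used
below.\<close>

lemma H10_pair_weak_deriv:
  assumes u: "H10_pair l u g" and w: "weak_deriv l w k"
  shows "(LINT x|leb l. w x * g x) = - (LINT x|leb l. k x * u x)"
proof -
  have L2: "u \<in> L2 l" "g \<in> L2 l" "w \<in> L2 l" "k \<in> L2 l"
    using u w by (auto simp: H10_pair_def weak_deriv_def)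
  have "cmod ((LINT x|leb l. w x * g x) + (LINT x|leb l. k x * u x)) = 0"
  proof (rule zero_if_small_multiples)
    show "0 \<le> L2_norm l w + L2_norm l k" using L2_norm_nonneg by (intro add_nonneg_nonneg)
    fix e :: real assume "0 < e"
    from u this obtain \<psi> where \<psi>: "\<psi> \<in> Cc1 l" "L2_norm l (\<lambda>x. u x - \<psi> x) \<le> e"
      "L2_norm l (\<lambda>x. g x - vector_derivative \<psi> (at x)) \<le> e"
      by (rule H10_pair_approx)
    note c = Cc1_L2[OF \<psi>(1)]
    have "(LINT x|leb l. w x * vector_derivative \<psi> (at x)) = - (LINT x|leb l. k x * \<psi> x)"
      using w \<psi>(1) by (simp add: weak_deriv_def)
    moreover have "(LINT x|leb l. w x * (g x - vector_derivative \<psi> (at x)))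
        = (LINT x|leb l. w x * g x) - (LINT x|leb l. w x * vector_derivative \<psi> (at x))"
      using L2_mult_integrable[OF L2(3,2)] L2_mult_integrable[OF L2(3) c(2)] by (simp add: right_diff_distrib)
    moreover have "(LINT x|leb l. k x * (u x - \<psi> x)) = (LINT x|leb l. k x * u x) - (LINT x|leb l. k x * \<psi> x)"
      using L2_mult_integrable[OF L2(4,1)] L2_mult_integrable[OF L2(4) c(1)] by (simp add: right_diff_distrib)
    ultimately have "(LINT x|leb l. w x * g x) + (LINT x|leb l. k x * u x)
      = (LINT x|leb l. w x * (g x - vector_derivative \<psi> (at x))) + (LINT x|leb l. k x * (u x - \<psi> x))" by simp
    also have "cmod \<dots> \<le> L2_norm l w * L2_norm l (\<lambda>x. g x - vector_derivative \<psi> (at x))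
         + L2_norm l k * L2_norm l (\<lambda>x. u x - \<psi> x)"
      by (intro norm_triangle_mono L2_Cauchy_Schwarz L2_diff L2 c)
    also have "\<dots> \<le> L2_norm l w * e + L2_norm l k * e"
      using \<psi> by (intro add_mono mult_left_mono L2_norm_nonneg)
    finally show "cmod ((LINT x|leb l. w x * g x) + (LINT x|leb l. k x * u x)) \<le> (L2_norm l w + L2_norm l k) * e"
      by (simp add: distrib_right)
  qed simp
  then show ?thesis by (simp add: eq_neg_iff_add_eq_0)
qed

lemma Cc1_primitive:
  assumes \<psi>: "\<psi> \<in> Cc1 l" and x: "0 \<le> x"
  shows "integral {0..x} (\<lambda>t. vector_derivative \<psi> (at t)) = \<psi> x"
proof -
  have "((\<lambda>t. vector_derivative \<psi> (at t)) has_integral (\<psi> x - \<psi> 0)) {0..x}"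
    by (rule fundamental_theorem_of_calculus[OF x])
      (use Cc1_D(1)[OF \<psi>] in \<open>auto intro: has_vector_derivative_at_within\<close>)
  then show ?thesis using Cc1_D(4)[OF \<psi>] by (simp add: integral_unique)
qed

text \<open>A test function is the integral of its derivative and vanishes at \<open>l\<close>; both properties survive the limit,
since primitives converge uniformly.\<close>

lemma H10_pair_primitive:
  assumes l: "0 < l" and u: "H10_pair l u g"
  shows "continuous_on {0..l} (\<lambda>x. integral {0..x} g)"
    and "integral {0..l} g = 0"
    and "ae_eq l u (\<lambda>x. integral {0..x} g)"
proof -
  have L2: "u \<in> L2 l" "g \<in> L2 l" using u by (auto simp: H10_pair_def)
  have int: "g integrable_on {0..l}"
    using LINT_eq_integral(2)[OF L2_integrable[OF L2(2)]] by (simp add: absolutely_integrable_on_def)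
  show cont: "continuous_on {0..l} (\<lambda>x. integral {0..x} g)"
    by (rule indefinite_integral_continuous_1[OF int])
  have close: "cmod (integral {0..x} g - \<psi> x) \<le> sqrt l * e"
    if \<psi>: "\<psi> \<in> Cc1 l" "L2_norm l (\<lambda>x. g x - vector_derivative \<psi> (at x)) \<le> e" and x: "x \<in> {0..l}" for \<psi> e x
  proof -
    have "g integrable_on {0..x}" using int by (rule integrable_subinterval_real) (use x in auto)
    moreover have "(\<lambda>t. vector_derivative \<psi> (at t)) integrable_on {0..x}"
      using Cc1_D(2)[OF \<psi>(1)] by (intro integrable_continuous_real) (rule continuous_on_subset, auto)
    ultimately have "integral {0..x} g - \<psi> x = integral {0..x} (\<lambda>t. g t - vector_derivative \<psi> (at t))"
      using Cc1_primitive[OF \<psi>(1), of x] x by (simp add: integral_diff)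
    also have "cmod \<dots> \<le> sqrt l * L2_norm l (\<lambda>t. g t - vector_derivative \<psi> (at t))"
      using primitive_bound[OF l L2_diff[OF L2(2) Cc1_L2(2)[OF \<psi>(1)]] x] .
    also have "\<dots> \<le> sqrt l * e" using \<psi>(2) l by (intro mult_left_mono) auto
    finally show ?thesis .
  qed
  have "cmod (integral {0..l} g) = 0"
  proof (rule zero_if_small_multiples)
    fix e :: real assume "0 < e"
    from u this obtain \<psi> where \<psi>: "\<psi> \<in> Cc1 l"
      "L2_norm l (\<lambda>x. g x - vector_derivative \<psi> (at x)) \<le> e"
      by (rule H10_pair_approx)
    show "cmod (integral {0..l} g) \<le> sqrt l * e"
      using close[OF \<psi>, of l] Cc1_D(5)[OF \<psi>(1)] l by simp
  qed (use l in auto)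
  then show "integral {0..l} g = 0" by simp
  let ?G = "\<lambda>x. integral {0..x} g"
  have GL2: "?G \<in> L2 l" by (rule L2_continuous[OF cont])
  have "L2_norm l (\<lambda>x. u x - ?G x) = 0"
  proof (rule zero_if_small_multiples[OF L2_norm_nonneg])
    show "0 \<le> sqrt (2 + 2 * l * l)" using l by simp
    fix e :: real assume e: "0 < e"
    from u this obtain \<psi> where \<psi>: "\<psi> \<in> Cc1 l" "L2_norm l (\<lambda>x. u x - \<psi> x) \<le> e"
      "L2_norm l (\<lambda>x. g x - vector_derivative \<psi> (at x)) \<le> e"
      by (rule H10_pair_approx)
    note c = Cc1_L2(1)[OF \<psi>(1)]
    have "(L2_norm l (\<lambda>x. (u x - \<psi> x) + (\<psi> x - ?G x)))\<^sup>2
        \<le> 2 * (L2_norm l (\<lambda>x. u x - \<psi> x))\<^sup>2 + 2 * (L2_norm l (\<lambda>x. \<psi> x - ?G x))\<^sup>2"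
      by (intro L2_norm_add_squared L2_diff L2 c GL2)
    also have "(L2_norm l (\<lambda>x. \<psi> x - ?G x))\<^sup>2 \<le> l * (sqrt l * e)\<^sup>2"
      by (rule L2_norm_uniform[OF l _ L2_diff[OF c GL2]])
        (use l e close[OF \<psi>(1,3)] in \<open>auto simp: norm_minus_commute\<close>)
    also have "(L2_norm l (\<lambda>x. u x - \<psi> x))\<^sup>2 \<le> e\<^sup>2" using \<psi>(2) L2_norm_nonneg by (intro power_mono)
    finally have "(L2_norm l (\<lambda>x. u x - ?G x))\<^sup>2 \<le> (2 + 2 * l * l) * e\<^sup>2"
      using l by (simp add: power_mult_distrib algebra_simps)
    also have "\<dots> = (sqrt (2 + 2 * l * l) * e)\<^sup>2" using l by (simp add: power_mult_distrib)
    finally show "L2_norm l (\<lambda>x. u x - ?G x) \<le> sqrt (2 + 2 * l * l) * e"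
      using l e by (auto intro: power2_le_imp_le)
  qed
  then have "ae_eq l (\<lambda>x. u x - ?G x) (\<lambda>_. 0)" using L2_norm_eq_0_iff[OF L2_diff[OF L2(1) GL2]] by simp
  then show "ae_eq l u ?G" by (simp add: ae_eq_def)
qed

lemma classical_weak_deriv:
  assumes l: "0 < l" and W: "\<And>x. x \<in> {0..l} \<Longrightarrow> (W has_vector_derivative W' x) (at x within {0..l})"
    and W': "continuous_on {0..l} W'"
  shows "weak_deriv l W W'"
proof -
  have cW: "continuous_on {0..l} W"
    using W by (meson continuous_on_eq_continuous_within has_vector_derivative_continuous)
  have L2: "W \<in> L2 l" "W' \<in> L2 l" using cW W' by (auto intro: L2_continuous)
  have "(LINT x|leb l. W x * vector_derivative \<psi> (at x)) = - (LINT x|leb l. W' x * \<psi> x)" if \<psi>: "\<psi> \<in> Cc1 l" for \<psi>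
  proof -
    note c = Cc1_L2[OF \<psi>]
    have i: "integrable (leb l) (\<lambda>x. W x * vector_derivative \<psi> (at x))" "integrable (leb l) (\<lambda>x. W' x * \<psi> x)"
      using L2 c by (auto intro: L2_mult_integrable)
    have "((\<lambda>x. W x * vector_derivative \<psi> (at x) + W' x * \<psi> x) has_integral (W l * \<psi> l - W 0 * \<psi> 0)) {0..l}"
    proof (rule fundamental_theorem_of_calculus)
      fix x assume "x \<in> {0..l}"
      show "((\<lambda>x. W x * \<psi> x) has_vector_derivative W x * vector_derivative \<psi> (at x) + W' x * \<psi> x) (at x within {0..l})"
        using W[OF \<open>x \<in> {0..l}\<close>] has_vector_derivative_at_within[OF Cc1_D(1)[OF \<psi>]]
        by (rule has_vector_derivative_mult)
    qed (use l in auto)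
    then have "integral {0..l} (\<lambda>x. W x * vector_derivative \<psi> (at x) + W' x * \<psi> x) = 0"
      using Cc1_D(4,5)[OF \<psi>] by (simp add: integral_unique)
    then have "(LINT x|leb l. W x * vector_derivative \<psi> (at x) + W' x * \<psi> x) = 0"
      using LINT_eq_integral(1)[OF Bochner_Integration.integrable_add[OF i]] by simp
    then show ?thesis using i by (simp add: eq_neg_iff_add_eq_0)
  qed
  then show ?thesis using L2 by (simp add: weak_deriv_def)
qed

lemma weak_deriv_diff:
  assumes "weak_deriv l u g" "weak_deriv l v k"
  shows "weak_deriv l (\<lambda>x. u x - v x) (\<lambda>x. g x - k x)"
  unfolding weak_deriv_def
proof (intro conjI ballI)
  have L2: "u \<in> L2 l" "g \<in> L2 l" "v \<in> L2 l" "k \<in> L2 l" using assms by (auto simp: weak_deriv_def)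
  show "(\<lambda>x. u x - v x) \<in> L2 l" "(\<lambda>x. g x - k x) \<in> L2 l" using L2 by (auto intro: L2_diff)
  fix \<psi> assume \<psi>: "\<psi> \<in> Cc1 l"
  note c = Cc1_L2[OF \<psi>]
  show "(LINT x|leb l. (u x - v x) * vector_derivative \<psi> (at x)) = - (LINT x|leb l. (g x - k x) * \<psi> x)"
    using assms \<psi> L2_mult_integrable[OF L2(1) c(2)] L2_mult_integrable[OF L2(3) c(2)]
      L2_mult_integrable[OF L2(2) c(1)] L2_mult_integrable[OF L2(4) c(1)]
    by (simp add: weak_deriv_def left_diff_distrib)
qed

lemma LINT_dominated_convergence:
  fixes f :: "real \<Rightarrow> 'a :: {banach, second_countable_topology}"
  assumes "f \<in> borel_measurable (leb l)" "\<And>n. s n \<in> borel_measurable (leb l)" "integrable (leb l) w"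
    and "\<And>x. 0 < x \<Longrightarrow> x < l \<Longrightarrow> (\<lambda>n. s n x) \<longlonglongrightarrow> f x"
    and "\<And>n x. 0 < x \<Longrightarrow> x < l \<Longrightarrow> norm (s n x) \<le> w x"
  shows "(\<lambda>n. LINT x|leb l. s n x) \<longlonglongrightarrow> (LINT x|leb l. f x)"
  by (rule integral_dominated_convergence[OF assms(1-3)]) (use assms(4,5) in \<open>auto intro!: AE_I2\<close>)

lemma vector_derivative_sequence:
  fixes \<psi> :: "real \<Rightarrow> 'a :: real_normed_vector"
  assumes "(\<psi> has_vector_derivative D) (at x)" "h \<longlonglongrightarrow> 0" "\<And>n. h n \<noteq> 0"
  shows "(\<lambda>n. (\<psi> (x + h n) - \<psi> x) /\<^sub>R h n) \<longlonglongrightarrow> D"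
proof -
  have "(\<lambda>k. norm (\<psi> (x + k) - \<psi> x - k *\<^sub>R D) / norm k) \<midarrow>0\<rightarrow> 0"
    using assms(1) by (simp add: has_vector_derivative_def has_derivative_at)
  moreover have "filterlim h (at 0) sequentially" using assms by (auto simp: filterlim_at)
  ultimately have "(\<lambda>n. norm (\<psi> (x + h n) - \<psi> x - h n *\<^sub>R D) / norm (h n)) \<longlonglongrightarrow> 0"
    by (rule filterlim_compose)
  moreover have "norm (\<psi> (x + h n) - \<psi> x - h n *\<^sub>R D) / norm (h n) = norm ((\<psi> (x + h n) - \<psi> x) /\<^sub>R h n - D)" for n
  proof -
    have "(\<psi> (x + h n) - \<psi> x) /\<^sub>R h n - D = (\<psi> (x + h n) - \<psi> x - h n *\<^sub>R D) /\<^sub>R h n"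
      using assms(3)[of n] by (simp add: scaleR_diff_right)
    then show ?thesis by (simp add: divide_inverse mult.commute)
  qed
  ultimately show ?thesis by (simp add: tendsto_norm_zero_iff LIM_zero_iff)
qed

text \<open>Two weak derivatives have equal integrals against test functions, but \<open>\<psi>'\<close> is only continuous. The
difference quotients of \<open>\<psi>\<close> are test functions that converge boundedly to \<open>\<psi>'\<close>.\<close>

lemma weak_deriv_unique_tested:
  assumes g: "weak_deriv l u g" and g': "weak_deriv l u g'" and \<psi>: "\<psi> \<in> Cc1 l"
  shows "(LINT x|leb l. g x * vector_derivative \<psi> (at x)) = (LINT x|leb l. g' x * vector_derivative \<psi> (at x))"
proof -
  define d where "d x = g x - g' x" for x
  define D where "D x = vector_derivative \<psi> (at x)" for x
  have L2: "g \<in> L2 l" "g' \<in> L2 l" "d \<in> L2 l" using g g' L2_diff unfolding d_def[abs_def] by (auto simp: weak_deriv_def)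
  have dz: "(LINT x|leb l. d x * \<theta> x) = 0" if \<theta>: "\<theta> \<in> Cc1 l" for \<theta>
  proof -
    have "(LINT x|leb l. g x * \<theta> x) = (LINT x|leb l. g' x * \<theta> x)"
      using g g' \<theta> by (simp add: weak_deriv_def)
    then show ?thesis using L2_mult_integrable[OF L2(1) Cc1_L2(1)[OF \<theta>]] L2_mult_integrable[OF L2(2) Cc1_L2(1)[OF \<theta>]]
      by (simp add: d_def left_diff_distrib)
  qed
  obtain a b where ab: "0 < a" "b < l" "\<And>x. x \<notin> {a..b} \<Longrightarrow> \<psi> x = 0" using \<psi> by (auto simp: Cc1_def)
  \<comment> \<open>All step sizes are below a, so the shifted functions still vanish near 0; the added 2 makes the inequality strict
  from n = 0.\<close>
  define h where "h n = a / (real n + 2)" for n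
  have h: "0 < h n" "h n < a" for n using ab(1) by (auto simp: h_def field_simps add_pos_nonneg)
  have h0: "h \<longlonglongrightarrow> 0" unfolding h_def
    using LIMSEQ_ignore_initial_segment[OF lim_const_over_n[of a], of 2] by (simp add: add.commute)
  have der: "(\<psi> has_vector_derivative D x) (at x)" for x unfolding D_def by (rule Cc1_D(1)[OF \<psi>])
  have cD: "continuous_on S D" for S
    using Cc1_D(2)[OF \<psi>] unfolding D_def[abs_def] by (rule continuous_on_subset) simp
  have "bounded (D ` {0..l + a})" using cD compact_continuous_image compact_imp_bounded by blast
  then obtain K where K: "\<And>x. x \<in> {0..l + a} \<Longrightarrow> cmod (D x) \<le> K" unfolding bounded_iff by blast
  define \<theta> where "\<theta> n x = (\<psi> (x + h n) - \<psi> x) /\<^sub>R h n" for n x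
  have \<theta>: "\<theta> n \<in> Cc1 l" for n
  proof (rule Cc1_I(1))
    show "(\<theta> n has_vector_derivative (D (x + h n) - D x) /\<^sub>R h n) (at x)" for x
    proof -
      have "((\<lambda>x. x + h n) has_vector_derivative 1) (at x)" by (auto intro!: derivative_eq_intros)
      from vector_diff_chain_at[OF this, of \<psi> "D (x + h n)"] der[of "x + h n"]
      have "((\<lambda>x. \<psi> (x + h n)) has_vector_derivative D (x + h n)) (at x)" by (simp add: o_def)
      then show ?thesis unfolding \<theta>_def[abs_def] using der[of x]
        by (auto intro!: derivative_eq_intros)
    qed
    show "continuous_on UNIV (\<lambda>x. (D (x + h n) - D x) /\<^sub>R h n)"
      using cD[of UNIV] by (intro continuous_intros continuous_on_compose2[OF cD[of UNIV]]) auto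
    show "0 < a - h n" "b < l" using h[of n] ab by auto
    fix x assume x: "x \<notin> {a - h n..b}"
    then have "x \<notin> {a..b}" "x + h n \<notin> {a..b}" using h[of n] by auto
    then show "\<theta> n x = 0" using ab(3) by (simp add: \<theta>_def)
  qed
  have "(\<lambda>n. LINT x|leb l. d x * \<theta> n x) \<longlonglongrightarrow> (LINT x|leb l. d x * D x)"
  proof (rule LINT_dominated_convergence)
    have "D \<in> L2 l" by (rule L2_continuous[OF cD])
    then show "(\<lambda>x. d x * D x) \<in> borel_measurable (leb l)"
      using L2_D(1) L2 by (intro borel_measurable_times)
    show "(\<lambda>x. d x * \<theta> n x) \<in> borel_measurable (leb l)" for n
      using L2_D(1)[OF L2(3)] L2_D(1)[OF Cc1_L2(1)[OF \<theta>[of n]]] by (intro borel_measurable_times)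
    show "integrable (leb l) (\<lambda>x. cmod (d x) * K)"
      using L2_integrable[OF L2(3)] by (intro integrable_mult_left integrable_norm)
    fix x :: real assume x: "0 < x" "x < l"
    show "(\<lambda>n. d x * \<theta> n x) \<longlonglongrightarrow> d x * D x"
      unfolding \<theta>_def
      using vector_derivative_sequence[OF der h0] h(1) by (intro tendsto_mult tendsto_const) (auto simp: less_imp_neq[symmetric])
    fix n
    have "cmod (\<psi> (x + h n) - \<psi> x) \<le> K * (x + h n) - K * x"
    proof (rule differentiable_bound_general[where \<phi> = "\<lambda>x. K * x" and \<phi>' = "\<lambda>_. K" and f' = D])
      show "continuous_on {x..x + h n} \<psi>" by (rule Cc1_D(3)[OF \<psi>])
      show "((\<lambda>x. K * x) has_vector_derivative K) (at t)" for t
        by (auto intro!: derivative_eq_intros)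
      show "cmod (D t) \<le> K" if "x < t" "t < x + h n" for t
        using K[of t] that x h[of n] by auto
    qed (use h der in \<open>auto intro!: continuous_intros\<close>)
    then have "cmod (\<psi> (x + h n) - \<psi> x) \<le> K * h n" by (simp add: algebra_simps)
    moreover have "cmod (\<theta> n x) = cmod (\<psi> (x + h n) - \<psi> x) / h n"
      unfolding \<theta>_def norm_scaleR using h(1)[of n] by (simp add: divide_inverse mult.commute)
    ultimately have "cmod (\<theta> n x) \<le> K" using h(1)[of n] by (simp add: pos_divide_le_eq)
    then show "norm (d x * \<theta> n x) \<le> cmod (d x) * K" by (simp add: norm_mult mult_left_mono)
  qed
  then have "(LINT x|leb l. d x * D x) = 0" using dz[OF \<theta>] by (simp add: LIMSEQ_const_iff)
  then show ?thesis
    using L2_mult_integrable[OF L2(1) Cc1_L2(2)[OF \<psi>]] L2_mult_integrable[OF L2(2) Cc1_L2(2)[OF \<psi>]]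
    by (simp add: d_def D_def left_diff_distrib)
qed

text \<open>The derivative chosen by \<open>weak_diff\<close> may differ from the one that witnesses \<open>H\<^sup>2\<close>; it is
again weakly differentiable because test functions do not distinguish the two.\<close>

lemma H2_weak_diff:
  assumes "u \<in> H2 l"
  shows "weak_deriv l u (weak_diff l u)"
    and "weak_deriv l (weak_diff l u) (weak_diff l (weak_diff l u))"
proof -
  from assms obtain g h where g: "weak_deriv l u g" and h: "weak_deriv l g h"
    unfolding H2_def H1_def by blast
  show 1: "weak_deriv l u (weak_diff l u)" by (rule weak_diff_weak_deriv) (use g in \<open>auto simp: H1_def\<close>)
  have "weak_deriv l (weak_diff l u) h"
    using h 1 weak_deriv_unique_tested[OF g 1] by (auto simp: weak_deriv_def)
  then show "weak_deriv l (weak_diff l u) (weak_diff l (weak_diff l u))"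
    by (intro weak_diff_weak_deriv) (auto simp: H1_def)
qed

section \<open>Classical functions with zero boundary values are in \<open>H\<^sup>1\<^sub>0\<close>\<close>

lemma Cc1_antiderivative:
  fixes \<eta> :: "real \<Rightarrow> complex"
  assumes l: "0 < l" and \<eta>: "continuous_on UNIV \<eta>" and ab: "0 < a" "b < l"
    and supp: "\<And>x. x \<notin> {a..b} \<Longrightarrow> \<eta> x = 0" and zero: "integral {0..l} \<eta> = 0"
  shows "(\<lambda>x. integral {0..x} \<eta>) \<in> Cc1 l"
    and "vector_derivative (\<lambda>x. integral {0..x} \<eta>) (at x) = \<eta> x"
proof -
  have int: "\<eta> integrable_on {c..d}" for c d
    by (rule integrable_continuous_real) (rule continuous_on_subset[OF \<eta>], simp)
  have vanish: "integral {c..d} \<eta> = 0" if "\<And>x. x \<in> {c..d} \<Longrightarrow> x \<notin> {a..b}" for c d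
  proof -
    have "integral {c..d} \<eta> = integral {c..d} (\<lambda>_. 0)"
      by (rule integral_cong) (use supp that in blast)
    then show ?thesis by simp
  qed
  have left: "integral {0..x} \<eta> = 0" if "x < a" for x
    by (rule vanish) (use that in auto)
  have der: "((\<lambda>x. integral {0..x} \<eta>) has_vector_derivative \<eta> x) (at x)" for x
  proof (cases "x < a")
    case True
    have "((\<lambda>_. 0 :: complex) has_vector_derivative \<eta> x) (at x)" using True supp[of x] by simp
    then show ?thesis
      by (rule has_vector_derivative_transform_within_open[of _ _ _ "{..<a}"]) (use True left in auto)
  next
    case False
    have "((\<lambda>x. integral {0..x} \<eta>) has_vector_derivative \<eta> x) (at x within {0..x + 1})"
      by (rule integral_has_vector_derivative) (use False ab continuous_on_subset[OF \<eta>] in auto)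
    moreover have "at x within {0..x + 1} = at x" using False ab by (intro at_within_interior) auto
    ultimately show ?thesis by simp
  qed
  have supp': "integral {0..x} \<eta> = 0" if "x \<notin> {a..b}" for x
  proof (cases "x < a")
    case False
    with that have x: "b < x" "a \<le> x" by auto
    show ?thesis
    proof (cases "x \<le> l")
      case True
      have "integral {0..x} \<eta> + integral {x..l} \<eta> = integral {0..l} \<eta>"
        by (rule Henstock_Kurzweil_Integration.integral_combine[OF _ _ int]) (use True x ab in auto)
      moreover have "integral {x..l} \<eta> = 0" by (rule vanish) (use x in auto)
      ultimately show ?thesis using zero by simp
    next
      case False
      have "integral {0..l} \<eta> + integral {l..x} \<eta> = integral {0..x} \<eta>"
        by (rule Henstock_Kurzweil_Integration.integral_combine[OF _ _ int]) (use False l in auto)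
      moreover have "integral {l..x} \<eta> = 0" by (rule vanish) (use ab in auto)
      ultimately show ?thesis using zero by simp
    qed
  qed (rule left)
  show "(\<lambda>x. integral {0..x} \<eta>) \<in> Cc1 l" by (rule Cc1_I(1)[OF der \<eta> ab supp'])
  show "vector_derivative (\<lambda>x. integral {0..x} \<eta>) (at x) = \<eta> x" by (rule Cc1_I(2)[OF der \<eta> ab supp'])
qed

text \<open>Each factor is a linear ramp clipped to \<open>[0,1]\<close>: the product is continuous, has compact support in
\<open>(0,l)\<close>, and increases to 1 there.\<close>

definition cutoff :: "real \<Rightarrow> nat \<Rightarrow> real \<Rightarrow> real" where
  "cutoff l n x = max 0 (min 1 (real (Suc n) * x - 1)) * max 0 (min 1 (real (Suc n) * (l - x) - 1))"

lemma cutoff_range: "0 \<le> cutoff l n x" "cutoff l n x \<le> 1"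
  by (auto simp: cutoff_def intro!: mult_le_one)

lemma cutoff_continuous: "continuous_on S (cutoff l n)"
  unfolding cutoff_def[abs_def] by (intro continuous_intros)

lemma cutoff_support: "x \<notin> {1 / real (Suc n)..l - 1 / real (Suc n)} \<Longrightarrow> cutoff l n x = 0"
proof -
  assume "x \<notin> {1 / real (Suc n)..l - 1 / real (Suc n)}"
  then consider "x < 1 / real (Suc n)" | "l - x < 1 / real (Suc n)" by fastforce
  then show ?thesis
  proof cases
    case 1
    then have "real (Suc n) * x - 1 < 0" by (simp add: field_simps del: of_nat_Suc)
    then show ?thesis by (simp add: cutoff_def del: of_nat_Suc)
  next
    case 2
    then have "real (Suc n) * (l - x) - 1 < 0" by (simp add: field_simps del: of_nat_Suc)
    then show ?thesis by (simp add: cutoff_def del: of_nat_Suc)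
  qed
qed

lemma cutoff_tendsto:
  assumes "0 < x" "x < l"
  shows "(\<lambda>n. cutoff l n x) \<longlonglongrightarrow> 1"
proof (rule tendsto_eventually)
  obtain N :: nat where N: "2 / x < N" "2 / (l - x) < N" by (metis reals_Archimedean2 max_less_iff_conj)
  show "\<forall>\<^sub>F n in sequentially. cutoff l n x = 1"
    unfolding eventually_sequentially
  proof (intro exI[of _ N] allI impI)
    fix n assume "N \<le> n"
    then have n: "2 / x < real (Suc n)" "2 / (l - x) < real (Suc n)" using N by linarith+
    then have "2 < real (Suc n) * x" "2 < real (Suc n) * (l - x)" using assms
      by (simp_all add: pos_divide_less_eq del: of_nat_Suc)
    then show "cutoff l n x = 1" by (simp add: cutoff_def del: of_nat_Suc)
  qed
qed

text \<open>With \<open>\<tau>\<close> a cutoff, the primitive of \<open>\<tau> (W' - c)\<close> is a test function if the constant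
\<open>c\<close> makes the integral over \<open>[0,l]\<close> vanish. Since \<open>\<integral> W' = W(l) - W(0) = 0\<close>, these
constants tend to 0 as the cutoffs tend to 1, so the derivatives converge to \<open>W'\<close> and their primitives to
\<open>W\<close>.\<close>

lemma classical_H10_pair:
  fixes W W' :: "real \<Rightarrow> complex"
  assumes l: "0 < l" and W: "\<And>x. x \<in> {0..l} \<Longrightarrow> (W has_vector_derivative W' x) (at x within {0..l})"
    and W': "continuous_on {0..l} W'" and bdry: "W 0 = 0" "W l = 0"
  shows "H10_pair l W W'"
proof -
  have cW: "continuous_on {0..l} W"
    using W by (meson continuous_on_eq_continuous_within has_vector_derivative_continuous)
  have L2: "W \<in> L2 l" "W' \<in> L2 l" using cW W' by (auto intro: L2_continuous)
  \<comment> \<open>W' is extended by constants, so that its product with a cutoff is continuous on the whole line.\<close>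
  define V where "V x = W' (max 0 (min l x))" for x
  have cV: "continuous_on S V" for S
  proof -
    have "continuous_on UNIV V" unfolding V_def[abs_def]
      by (rule continuous_on_compose2[OF W']) (use l in \<open>auto intro!: continuous_intros\<close>)
    then show ?thesis by (rule continuous_on_subset) simp
  qed
  have VW: "V x = W' x" if "x \<in> {0..l}" for x using that by (simp add: V_def)
  have FTC: "(W' has_integral (W x - W 0)) {0..x}" if "x \<in> {0..l}" for x
  proof (rule fundamental_theorem_of_calculus)
    fix t assume "t \<in> {0..x}"
    with that show "(W has_vector_derivative W' t) (at t within {0..x})"
      by (intro has_vector_derivative_within_subset[OF W]) auto
  qed (use that in auto)
  have iV: "(LINT x|leb l. V x) = 0"
  proof -
    have "(LINT x|leb l. V x) = integral {0..l} V"
      by (rule LINT_eq_integral(1)[OF L2_integrable[OF L2_continuous[OF cV]]])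
    also have "\<dots> = integral {0..l} W'" by (rule integral_cong) (rule VW)
    also have "\<dots> = 0" using FTC[of l] l bdry by (simp add: integral_unique)
    finally show ?thesis .
  qed
  define T where "T n x = complex_of_real (cutoff l n x)" for n x
  have cT: "continuous_on S (T n)" for S n
    unfolding T_def[abs_def] by (intro continuous_on_of_real cutoff_continuous)
  have T1: "cmod (T n x) \<le> 1" for n x using cutoff_range by (simp add: T_def)
  have Tlim: "(\<lambda>n. T n x) \<longlonglongrightarrow> 1" if "0 < x" "x < l" for x
    using tendsto_of_real[OF cutoff_tendsto[OF that], where 'a = complex] by (simp add: T_def)
  obtain K where K: "\<And>x. x \<in> {0..l} \<Longrightarrow> cmod (V x) \<le> K"
  proof -
    have "bounded (V ` {0..l})" using cV compact_continuous_image compact_imp_bounded by blast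
    then show ?thesis using that unfolding bounded_iff by blast
  qed
  have K0: "0 \<le> K" using K[of 0] l by (smt (verit) atLeastAtMost_iff norm_ge_zero)
  interpret finite_measure "leb l" by (rule finite_measure_leb)
  define m where "m n = (LINT x|leb l. T n x)" for n
  define j where "j n = (LINT x|leb l. T n x * V x)" for n
  have meas: "f \<in> borel_measurable (leb l)" if "continuous_on {0..l} f" for f :: "real \<Rightarrow> complex"
    by (rule L2_D(1)[OF L2_continuous[OF that]])
  have "m \<longlonglongrightarrow> (LINT x|leb l. 1)" unfolding m_def
    by (rule LINT_dominated_convergence[where w = "\<lambda>_. 1"]) (auto intro: meas cT Tlim T1)
  then have m: "m \<longlonglongrightarrow> of_real l" using l by (simp add: measure_restrict_space scaleR_conv_of_real)
  have j: "j \<longlonglongrightarrow> 0" unfolding j_def iV[symmetric]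
  proof (rule LINT_dominated_convergence[where w = "\<lambda>_. K"])
    fix x :: real assume x: "0 < x" "x < l"
    show "(\<lambda>n. T n x * V x) \<longlonglongrightarrow> V x" using tendsto_mult[OF Tlim[OF x] tendsto_const[of "V x"]] by simp
    show "norm (T n x * V x) \<le> K" for n
      using mult_mono[OF T1[of n x] K[of x]] x by (simp add: norm_mult)
  qed (auto intro!: meas cT cV continuous_on_mult)
  define c where "c n = j n / m n" for n
  have c: "c \<longlonglongrightarrow> 0" unfolding c_def using tendsto_divide[OF j m] l by simp
  then obtain Kc where Kc: "\<And>n. cmod (c n) \<le> Kc"
    using convergent_imp_Bseq[of c] by (auto simp: convergent_def Bseq_def)
  define \<eta> where "\<eta> n x = T n x * (V x - c n)" for n x
  have c\<eta>: "continuous_on S (\<eta> n)" for S n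
    unfolding \<eta>_def[abs_def] by (intro continuous_intros cT cV)
  have L2\<eta>: "\<eta> n \<in> L2 l" for n by (rule L2_continuous[OF c\<eta>])
  have "(\<lambda>n. LINT x|leb l. (cmod (W' x - \<eta> n x))\<^sup>2) \<longlonglongrightarrow> (LINT x|leb l. 0)"
  proof (rule LINT_dominated_convergence[where w = "\<lambda>_. (K + (K + Kc))\<^sup>2"])
    show "(\<lambda>x. (cmod (W' x - \<eta> n x))\<^sup>2) \<in> borel_measurable (leb l)" for n
      using L2_D(2)[OF L2_diff[OF L2(2) L2\<eta>]] by (rule borel_measurable_integrable)
    fix x :: real assume x: "0 < x" "x < l"
    have "(\<lambda>n. (cmod (W' x - \<eta> n x))\<^sup>2) \<longlonglongrightarrow> (cmod (W' x - 1 * (V x - 0)))\<^sup>2"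
      unfolding \<eta>_def by (intro tendsto_intros Tlim[OF x] c)
    then show "(\<lambda>n. (cmod (W' x - \<eta> n x))\<^sup>2) \<longlonglongrightarrow> 0" using VW[of x] x by simp
    fix n
    have "cmod (\<eta> n x) \<le> 1 * (K + Kc)" unfolding \<eta>_def norm_mult
      using T1 K[of x] Kc[of n] K0 x norm_triangle_ineq4[of "V x" "c n"] by (intro mult_mono) auto
    then have "cmod (W' x - \<eta> n x) \<le> K + (K + Kc)"
      using norm_triangle_ineq4[of "W' x" "\<eta> n x"] K[of x] VW[of x] x by simp
    then show "norm ((cmod (W' x - \<eta> n x))\<^sup>2) \<le> (K + (K + Kc))\<^sup>2" by (simp add: power_mono)
  qed auto
  then have lim: "(\<lambda>n. (L2_norm l (\<lambda>x. W' x - \<eta> n x))\<^sup>2) \<longlonglongrightarrow> 0" by (simp add: L2_norm_squared)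
  show ?thesis unfolding H10_pair_def
  proof (intro conjI L2 allI impI)
    fix e :: real assume e: "0 < e"
    have "\<forall>\<^sub>F n in sequentially. (L2_norm l (\<lambda>x. W' x - \<eta> n x))\<^sup>2 < e / (l\<^sup>2 + 1)"
      using order_tendstoD(2)[OF lim] e by (simp add: add_nonneg_pos)
    moreover have "\<forall>\<^sub>F n in sequentially. m n \<noteq> 0" by (rule tendsto_imp_eventually_ne[OF m]) (use l in simp)
    ultimately have "\<forall>\<^sub>F n in sequentially. (L2_norm l (\<lambda>x. W' x - \<eta> n x))\<^sup>2 < e / (l\<^sup>2 + 1) \<and> m n \<noteq> 0"
      by (rule eventually_conj)
    then obtain n where n: "(L2_norm l (\<lambda>x. W' x - \<eta> n x))\<^sup>2 < e / (l\<^sup>2 + 1)" "m n \<noteq> 0"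
      by (auto simp: eventually_sequentially)
    define \<psi> where "\<psi> x = integral {0..x} (\<eta> n)" for x
    have z: "integral {0..l} (\<eta> n) = 0"
    proof -
      have "(LINT x|leb l. \<eta> n x) = j n - c n * m n"
      proof -
        have i: "integrable (leb l) (\<lambda>x. T n x * V x)" "integrable (leb l) (T n)"
          by (auto intro!: L2_integrable L2_continuous cT cV continuous_on_mult)
        have "(LINT x|leb l. \<eta> n x) = (LINT x|leb l. T n x * V x - c n * T n x)"
          by (simp add: \<eta>_def algebra_simps)
        then show ?thesis using i by (simp add: j_def m_def)
      qed
      then show ?thesis using n(2) LINT_eq_integral(1)[OF L2_integrable[OF L2\<eta>[of n]]] by (simp add: c_def)
    qed
    have ab: "0 < 1 / real (Suc n)" "l - 1 / real (Suc n) < l" by auto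
    have supp: "\<eta> n x = 0" if "x \<notin> {1 / real (Suc n)..l - 1 / real (Suc n)}" for x
      using cutoff_support[OF that] by (simp add: \<eta>_def T_def)
    have \<psi>: "\<psi> \<in> Cc1 l" "\<And>x. vector_derivative \<psi> (at x) = \<eta> n x"
      unfolding \<psi>_def[abs_def]
      using Cc1_antiderivative[OF l c\<eta> ab supp z] by auto
    have "(L2_norm l (\<lambda>x. W x - \<psi> x))\<^sup>2 \<le> l * (sqrt l * L2_norm l (\<lambda>x. W' x - \<eta> n x))\<^sup>2"
    proof (rule L2_norm_uniform[OF l _ L2_diff[OF L2(1) Cc1_L2(1)[OF \<psi>(1)]]])
      show "0 \<le> sqrt l * L2_norm l (\<lambda>x. W' x - \<eta> n x)" using l L2_norm_nonneg by simp
      fix x :: real assume x: "0 < x" "x < l"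
      have "W x - \<psi> x = integral {0..x} (\<lambda>t. W' t - \<eta> n t)"
      proof -
        have "W' integrable_on {0..x}" "integral {0..x} W' = W x"
          using FTC[of x] x bdry by (auto simp: integral_unique has_integral_integrable)
        moreover have "\<eta> n integrable_on {0..x}" by (rule integrable_continuous_real[OF c\<eta>])
        ultimately show ?thesis by (simp add: \<psi>_def integral_diff)
      qed
      then show "cmod (W x - \<psi> x) \<le> sqrt l * L2_norm l (\<lambda>x. W' x - \<eta> n x)"
        using primitive_bound[OF l L2_diff[OF L2(2) L2\<eta>], of x n] x by simp
    qed
    also have "\<dots> = l\<^sup>2 * (L2_norm l (\<lambda>x. W' x - \<eta> n x))\<^sup>2"
      using l by (simp add: power_mult_distrib power2_eq_square)
    finally have "(L2_norm l (\<lambda>x. W x - \<psi> x))\<^sup>2 + (L2_norm l (\<lambda>x. W' x - \<eta> n x))\<^sup>2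
       \<le> (l\<^sup>2 + 1) * (L2_norm l (\<lambda>x. W' x - \<eta> n x))\<^sup>2" by (simp add: distrib_right)
    also have "\<dots> < e" using n(1) by (simp add: pos_less_divide_eq add_nonneg_pos mult.commute)
    finally show "\<exists>\<psi>\<in>Cc1 l. (L2_norm l (\<lambda>x. W x - \<psi> x))\<^sup>2 +
        (L2_norm l (\<lambda>x. W' x - vector_derivative \<psi> (at x)))\<^sup>2 < e"
      using \<psi> by (intro bexI[of _ \<psi>]) simp_all
  qed
qed

section \<open>Regularity in the Dirichlet domain\<close>

lemma ae_eq_sym: "ae_eq l u v \<Longrightarrow> ae_eq l v u"
  by (auto simp: ae_eq_def)

lemma ae_eq_trans: assumes "ae_eq l u v" "ae_eq l v w" shows "ae_eq l u w"
  using assms unfolding ae_eq_def by eventually_elim simp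

lemma ae_eq_continuous:
  assumes l: "0 < l" and U: "continuous_on {0..l} U" and V: "continuous_on {0..l} V"
    and ae: "ae_eq l U V" and x: "x \<in> {0..l}"
  shows "U x = V x"
proof -
  have c: "continuous_on {0..l} (\<lambda>x. U x - V x)" using U V by (intro continuous_intros)
  have L2: "(\<lambda>x. U x - V x) \<in> L2 l" by (rule L2_continuous[OF c])
  have "ae_eq l (\<lambda>x. U x - V x) (\<lambda>_. 0)" using ae by (simp add: ae_eq_def)
  then have "L2_norm l (\<lambda>x. U x - V x) = 0" using L2_norm_eq_0_iff[OF L2] by simp
  then have "(LINT x|leb l. (cmod (U x - V x))\<^sup>2) = 0" by (simp flip: L2_norm_squared)
  then have "integral {0..l} (\<lambda>x. (cmod (U x - V x))\<^sup>2) = 0"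
    using lebesgue_integral_eq_integral[OF L2_D(2)[OF L2]]
      integral_open_interval[of 0 l "\<lambda>x. (cmod (U x - V x))\<^sup>2"] by simp
  moreover have "continuous_on {0..l} (\<lambda>x. (cmod (U x - V x))\<^sup>2)" by (intro continuous_on_power continuous_on_norm c)
  ultimately have "\<forall>x\<in>{0..l}. (cmod (U x - V x))\<^sup>2 = 0"
    using integral_eq_0_iff[of 0 l "\<lambda>x. (cmod (U x - V x))\<^sup>2"] l by simp
  then show ?thesis using x by simp
qed

lemma dirichlet_dom_D:
  assumes "u \<in> dirichlet_dom l"
  shows "H10_pair l u (weak_diff l u)"
    and "weak_deriv l (weak_diff l u) (weak_diff l (weak_diff l u))"
  using assms H10_imp_pair H2_weak_diff by (auto simp: dirichlet_dom_def)

lemma dirichlet_dom_continuous_representative: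
  assumes "0 < l" "u \<in> dirichlet_dom l"
  obtains G where "continuous_on {0..l} G" "G 0 = 0" "G l = 0" "ae_eq l u G"
proof -
  note H10_pair_primitive[OF assms(1) dirichlet_dom_D(1)[OF assms(2)]]
  then show ?thesis by (intro that[of "\<lambda>x. integral {0..x} (weak_diff l u)"]) auto
qed

text \<open>Let \<open>U\<close> be the classical solution of \<open>U'' = k\<close> with Dirichlet conditions and \<open>d = u -
U\<close>. Then \<open>d\<close> is in \<open>H\<^sup>1\<^sub>0\<close> and \<open>d'\<close> has weak derivative 0, so
\<open>\<integral> |d'|\<^sup>2 = 0\<close> and \<open>d\<close>, the primitive of \<open>d'\<close>, vanishes.\<close>

lemma dirichlet_regularity:
  assumes l: "0 < l" and u: "u \<in> dirichlet_dom l"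
    and k: "continuous_on {0..l} k" and uk: "ae_eq l (weak_diff l (weak_diff l u)) k"
  obtains U U' where "\<And>x. x \<in> {0..l} \<Longrightarrow> (U has_vector_derivative U' x) (at x within {0..l})"
    "\<And>x. x \<in> {0..l} \<Longrightarrow> (U' has_vector_derivative k x) (at x within {0..l})"
    "U 0 = 0" "U l = 0" "ae_eq l u U"
proof -
  define g where "g = weak_diff l u"
  define h where "h = weak_diff l g"
  have pair: "H10_pair l u g" and wd: "weak_deriv l g h"
    using dirichlet_dom_D[OF u] by (simp_all add: g_def h_def)
  define A where "A x = integral {0..x} k" for x
  have A: "(A has_vector_derivative k x) (at x within {0..l})" if "x \<in> {0..l}" for x
    unfolding A_def[abs_def] by (rule integral_has_vector_derivative[OF k that])
  have cA: "continuous_on {0..l} A"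
    using A by (meson continuous_on_eq_continuous_within has_vector_derivative_continuous)
  define B where "B x = integral {0..x} A" for x
  have B: "(B has_vector_derivative A x) (at x within {0..l})" if "x \<in> {0..l}" for x
    unfolding B_def[abs_def] by (rule integral_has_vector_derivative[OF cA that])
  define c where "c = B l / of_real l"
  define U where "U x = B x - c * of_real x" for x
  define U' where "U' x = A x - c" for x
  have dU: "(U has_vector_derivative U' x) (at x within {0..l})" if "x \<in> {0..l}" for x
  proof -
    have "((\<lambda>x. c * of_real x) has_vector_derivative c) (at x within {0..l})"
      by (auto intro!: derivative_eq_intros)
    from has_vector_derivative_diff[OF B[OF that] this] show ?thesis
      by (simp add: U_def[abs_def] U'_def)
  qed
  have dU': "(U' has_vector_derivative k x) (at x within {0..l})" if "x \<in> {0..l}" for x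
    unfolding U'_def[abs_def] using A[OF that] by (auto intro!: derivative_eq_intros)
  have cU': "continuous_on {0..l} U'" unfolding U'_def[abs_def] using cA by (intro continuous_intros)
  have bdry: "U 0 = 0" "U l = 0" using l by (auto simp: U_def B_def c_def)
  have pair2: "H10_pair l (\<lambda>x. u x - U x) (\<lambda>x. g x - U' x)"
    by (rule H10_pair_diff[OF pair classical_H10_pair[OF l dU cU' bdry]])
  have wd2: "weak_deriv l (\<lambda>x. g x - U' x) (\<lambda>x. h x - k x)"
    by (rule weak_deriv_diff[OF wd classical_weak_deriv[OF l dU' k]])
  have L2: "(\<lambda>x. g x - U' x) \<in> L2 l" using wd2 by (simp add: weak_deriv_def)
  have "complex_of_real (LINT x|leb l. (cmod (g x - U' x))\<^sup>2) = (LINT x|leb l. (g x - U' x) * cnj (g x - U' x))"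
    unfolding integral_complex_of_real[symmetric] complex_norm_square ..
  also have "\<dots> = - (LINT x|leb l. (h x - k x) * cnj (u x - U x))"
    by (rule H10_pair_weak_deriv[OF H10_pair_cnj[OF pair2] wd2])
  also have "(LINT x|leb l. (h x - k x) * cnj (u x - U x)) = 0"
  proof (rule integral_eq_zero_AE)
    show "AE x in leb l. (h x - k x) * cnj (u x - U x) = 0"
      using uk unfolding ae_eq_def g_def h_def by eventually_elim simp
  qed
  finally have z: "L2_norm l (\<lambda>x. g x - U' x) = 0" by (simp add: L2_norm_def)
  have zero: "integral {0..x} (\<lambda>x. g x - U' x) = 0" if "x \<in> {0..l}" for x
    using primitive_bound[OF l L2 that] z by simp
  have "ae_eq l (\<lambda>x. u x - U x) (\<lambda>x. integral {0..x} (\<lambda>x. g x - U' x))"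
    by (rule H10_pair_primitive(3)[OF l pair2])
  then have "AE x in leb l. u x - U x = integral {0..x} (\<lambda>x. g x - U' x)" by (simp add: ae_eq_def)
  moreover have "AE x in leb l. x \<in> space (leb l)" by (rule AE_space)
  ultimately have "ae_eq l u U" unfolding ae_eq_def
  proof eventually_elim
    case (elim x)
    then show ?case using zero[of x] by simp
  qed
  with dU dU' bdry show ?thesis by (rule that[of U U'])
qed

lemma has_vector_derivative_Re_Im:
  assumes "(U has_vector_derivative d) F"
  shows "((\<lambda>x. Re (U x)) has_vector_derivative Re d) F"
    and "((\<lambda>x. Im (U x)) has_vector_derivative Im d) F"
  using bounded_linear.has_vector_derivative[OF bounded_linear_Re assms]
    bounded_linear.has_vector_derivative[OF bounded_linear_Im assms] by auto

text \<open>The components have continuous representatives, so the equations make their second weak derivatives continuous, and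
regularity applies. Since \<open>\<mu>\<close> and the potentials are real, real and imaginary parts solve the same system, and one of
them is not trivial.\<close>

lemma eigenvalue_classical_pair:
  assumes L: "0 < L"
    and Vp: "continuous_on {0..L} (V_plus f \<beta> \<phi>)" and Vm: "continuous_on {0..L} (V_minus f \<beta> \<phi>)"
    and eig: "is_eigenvalue2 L (dirichlet_dom L \<times> dirichlet_dom L) (N_op f \<beta> \<phi> L) (complex_of_real \<mu>)"
  shows "\<exists>U U1 W W1.
       (\<forall>t\<in>{0..L}. (U has_real_derivative U1 t) (at t within {0..L})) \<and>
       (\<forall>t\<in>{0..L}. (U1 has_real_derivative - \<mu> * W t - V_plus f \<beta> \<phi> t * U t) (at t within {0..L})) \<and>
       (\<forall>t\<in>{0..L}. (W has_real_derivative W1 t) (at t within {0..L})) \<and>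
       (\<forall>t\<in>{0..L}. (W1 has_real_derivative \<mu> * U t - V_minus f \<beta> \<phi> t * W t) (at t within {0..L})) \<and>
       U 0 = 0 \<and> U L = 0 \<and> W 0 = 0 \<and> W L = 0 \<and>
       (\<exists>t\<in>{0..L}. U t \<noteq> 0 \<or> W t \<noteq> 0)"
proof -
  define P where "P t = complex_of_real (V_plus f \<beta> \<phi> t)" for t
  define Q where "Q t = complex_of_real (V_minus f \<beta> \<phi> t)" for t
  have cPQ: "continuous_on {0..L} P" "continuous_on {0..L} Q"
    unfolding P_def[abs_def] Q_def[abs_def] using Vp Vm by (auto intro: continuous_on_of_real)
  from eig obtain u v :: "real \<Rightarrow> complex" where u: "u \<in> dirichlet_dom L" and v: "v \<in> dirichlet_dom L"
    and ne: "\<not> (ae_eq L u (\<lambda>_. 0) \<and> ae_eq L v (\<lambda>_. 0))"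
    and eq1: "ae_eq L (\<lambda>x. Q x * v x + weak_diff L (weak_diff L v) x) (\<lambda>x. \<mu> * u x)"
    and eq2: "ae_eq L (\<lambda>x. - weak_diff L (weak_diff L u) x - P x * u x) (\<lambda>x. \<mu> * v x)"
    by (auto simp: is_eigenvalue2_def N_op_def L_minus_def L_plus_def schroedinger_op_def P_def Q_def)
  obtain G where G: "continuous_on {0..L} G" "ae_eq L u G"
    using dirichlet_dom_continuous_representative[OF L u] by blast
  obtain H where H: "continuous_on {0..L} H" "ae_eq L v H"
    using dirichlet_dom_continuous_representative[OF L v] by blast
  have ku: "ae_eq L (weak_diff L (weak_diff L u)) (\<lambda>x. - \<mu> * H x - P x * G x)"
    using eq2 G(2) H(2) unfolding ae_eq_def
  proof eventually_elim
    case (elim x)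
    have "weak_diff L (weak_diff L u) x = - (\<mu> * v x) - P x * u x"
      by (simp flip: elim(1))
    then show ?case using elim by simp
  qed
  have kv: "ae_eq L (weak_diff L (weak_diff L v)) (\<lambda>x. \<mu> * G x - Q x * H x)"
    using eq1 G(2) H(2) unfolding ae_eq_def
  proof eventually_elim
    case (elim x)
    from elim(1) have "weak_diff L (weak_diff L v) x = \<mu> * u x - Q x * v x"
      by (simp flip: elim(1))
    then show ?case using elim by simp
  qed
  have c: "continuous_on {0..L} (\<lambda>x. - \<mu> * H x - P x * G x)" "continuous_on {0..L} (\<lambda>x. \<mu> * G x - Q x * H x)"
    using G(1) H(1) cPQ by (auto intro!: continuous_intros)
  obtain U U' where dU: "\<And>x. x \<in> {0..L} \<Longrightarrow> (U has_vector_derivative U' x) (at x within {0..L})"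
    "\<And>x. x \<in> {0..L} \<Longrightarrow> (U' has_vector_derivative - \<mu> * H x - P x * G x) (at x within {0..L})"
    and U: "U 0 = 0" "U L = 0" "ae_eq L u U"
    by (rule dirichlet_regularity[OF L u c(1) ku]) blast
  obtain W W' where dW: "\<And>x. x \<in> {0..L} \<Longrightarrow> (W has_vector_derivative W' x) (at x within {0..L})"
    "\<And>x. x \<in> {0..L} \<Longrightarrow> (W' has_vector_derivative \<mu> * G x - Q x * H x) (at x within {0..L})"
    and W: "W 0 = 0" "W L = 0" "ae_eq L v W"
    by (rule dirichlet_regularity[OF L v c(2) kv]) blast
  have cU: "continuous_on {0..L} U" "continuous_on {0..L} W"
    using dU(1) dW(1) by (meson continuous_on_eq_continuous_within has_vector_derivative_continuous)+
  have GU: "G x = U x" if "x \<in> {0..L}" for x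
    by (rule ae_eq_continuous[OF L G(1) cU(1) ae_eq_trans[OF ae_eq_sym[OF G(2)] U(3)] that])
  have HW: "H x = W x" if "x \<in> {0..L}" for x
    by (rule ae_eq_continuous[OF L H(1) cU(2) ae_eq_trans[OF ae_eq_sym[OF H(2)] W(3)] that])
  have ne': "\<exists>x\<in>{0..L}. U x \<noteq> 0 \<or> W x \<noteq> 0"
  proof (rule ccontr)
    assume "\<not> ?thesis"
    then have "ae_eq L U (\<lambda>_. 0)" "ae_eq L W (\<lambda>_. 0)" by (auto simp: ae_eq_def intro!: AE_I2)
    with U(3) W(3) ne show False using ae_eq_trans by blast
  qed
  \<comment> \<open>r stands for the real or the imaginary part.\<close>
  have real_pair: ?thesis
    if r: "\<And>U d F. (U has_vector_derivative d) F \<Longrightarrow> ((\<lambda>x. r (U x)) has_vector_derivative r d) F"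
      and r_lin: "\<And>a b x y. r (of_real a * x - of_real b * y) = a * r x - b * r y"
      and ne_r: "\<exists>x\<in>{0..L}. r (U x) \<noteq> 0 \<or> r (W x) \<noteq> 0" for r :: "complex \<Rightarrow> real"
  proof (intro exI conjI)
    have r0: "r 0 = 0" using r_lin[of 0 0 0 0] by simp
    show "r (U 0) = 0" "r (U L) = 0" "r (W 0) = 0" "r (W L) = 0" using U W r0 by auto
    show "\<exists>t\<in>{0..L}. r (U t) \<noteq> 0 \<or> r (W t) \<noteq> 0" by (rule ne_r)
    show "\<forall>t\<in>{0..L}. ((\<lambda>t. r (U t)) has_real_derivative r (U' t)) (at t within {0..L})"
      using r[OF dU(1)] by (simp add: has_real_derivative_iff_has_vector_derivative)
    show "\<forall>t\<in>{0..L}. ((\<lambda>t. r (W t)) has_real_derivative r (W' t)) (at t within {0..L})"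
      using r[OF dW(1)] by (simp add: has_real_derivative_iff_has_vector_derivative)
    show "\<forall>t\<in>{0..L}. ((\<lambda>t. r (U' t)) has_real_derivative - \<mu> * r (W t) - V_plus f \<beta> \<phi> t * r (U t)) (at t within {0..L})"
    proof
      fix t assume t: "t \<in> {0..L}"
      show "((\<lambda>t. r (U' t)) has_real_derivative - \<mu> * r (W t) - V_plus f \<beta> \<phi> t * r (U t)) (at t within {0..L})"
        using r[OF dU(2)[OF t]] r_lin[of "- \<mu>" "H t" "V_plus f \<beta> \<phi> t" "G t"] GU[OF t] HW[OF t]
        by (simp add: has_real_derivative_iff_has_vector_derivative P_def)
    qed
    show "\<forall>t\<in>{0..L}. ((\<lambda>t. r (W' t)) has_real_derivative \<mu> * r (U t) - V_minus f \<beta> \<phi> t * r (W t)) (at t within {0..L})"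
    proof
      fix t assume t: "t \<in> {0..L}"
      show "((\<lambda>t. r (W' t)) has_real_derivative \<mu> * r (U t) - V_minus f \<beta> \<phi> t * r (W t)) (at t within {0..L})"
        using r[OF dW(2)[OF t]] r_lin[of \<mu> "G t" "V_minus f \<beta> \<phi> t" "H t"] GU[OF t] HW[OF t]
        by (simp add: has_real_derivative_iff_has_vector_derivative Q_def)
    qed
  qed
  from ne' consider "\<exists>x\<in>{0..L}. Re (U x) \<noteq> 0 \<or> Re (W x) \<noteq> 0" | "\<exists>x\<in>{0..L}. Im (U x) \<noteq> 0 \<or> Im (W x) \<noteq> 0"
    unfolding complex_eq_iff by auto
  then show ?thesis
  proof cases
    case 1
    show ?thesis by (rule real_pair[of Re, OF has_vector_derivative_Re_Im(1) _ 1]) simp_all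
  next
    case 2
    show ?thesis by (rule real_pair[of Im, OF has_vector_derivative_Re_Im(2) _ 2]) simp_all
  qed
qed

text \<open>If \<open>q(l) = 0\<close>, then \<open>q\<close> is a Dirichlet solution of the homogeneous equation. Solving \<open>A u =
q\<close> for the operator \<open>A\<close> and using symmetry gives \<open>\<integral> q\<^sup>2 = \<integral> (A u) q = \<integral> u
(A q) = 0\<close>.\<close>

lemma resolvent_excludes_dirichlet_solution:
  assumes l: "0 < l" and V: "continuous_on {0..l} V"
    and spec: "0 \<notin> Spec l (dirichlet_dom l) (schroedinger_op V l)"
    and q: "schroedinger_solution {0..l} V q q'" "q 0 = 0" "q' 0 \<noteq> 0"
  shows "q l \<noteq> 0"
proof
  assume ql: "q l = 0"
  define Q where "Q x = complex_of_real (q x)" for x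
  define Q' where "Q' x = complex_of_real (q' x)" for x
  define k where "k x = - (complex_of_real (V x) * Q x)" for x
  have dq: "(q has_real_derivative q' x) (at x within {0..l})"
    "(q' has_real_derivative - (V x * q x)) (at x within {0..l})" if "x \<in> {0..l}" for x
    using q(1) that by (auto simp: schroedinger_solution_def)
  have cq: "continuous_on {0..l} q" "continuous_on {0..l} q'" using DERIV_continuous_on[OF dq(1)] DERIV_continuous_on[OF dq(2)] by auto
  have dQ: "(Q has_vector_derivative Q' x) (at x within {0..l})"
    "(Q' has_vector_derivative k x) (at x within {0..l})" if "x \<in> {0..l}" for x
  proof -
    show "(Q has_vector_derivative Q' x) (at x within {0..l})"
      unfolding Q_def[abs_def] Q'_def
      using dq(1)[OF that] by (intro has_vector_derivative_of_real) (simp add: has_real_derivative_iff_has_vector_derivative)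
    show "(Q' has_vector_derivative k x) (at x within {0..l})"
      using has_vector_derivative_of_real[of q' "- (V x * q x)" "at x within {0..l}", where 'a = complex] dq(2)[OF that]
      by (simp add: has_real_derivative_iff_has_vector_derivative Q'_def[abs_def] k_def Q_def)
  qed
  have cQ: "continuous_on {0..l} Q" "continuous_on {0..l} Q'" "continuous_on {0..l} k"
    unfolding Q_def[abs_def] Q'_def[abs_def] k_def[abs_def]
    using cq V by (auto intro!: continuous_intros continuous_on_of_real)
  have L2Q: "Q \<in> L2 l" by (rule L2_continuous[OF cQ(1)])
  have "0 \<in> resolvent_set l (dirichlet_dom l) (schroedinger_op V l)" using spec by (simp add: Spec_def)
  then obtain u where u: "u \<in> dirichlet_dom l" "ae_eq l (schroedinger_op V l u) Q"
    using L2Q by (auto simp: resolvent_set_def)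
  define g where "g = weak_diff l u"
  define h where "h = weak_diff l g"
  have pair: "H10_pair l u g" and wd: "weak_deriv l g h"
    using dirichlet_dom_D[OF u(1)] by (simp_all add: g_def h_def)
  have L2: "u \<in> L2 l" "h \<in> L2 l" "k \<in> L2 l" using pair wd L2_continuous[OF cQ(3)] by (auto simp: H10_pair_def weak_deriv_def)
  have pQ: "H10_pair l Q Q'" by (rule classical_H10_pair[OF l dQ(1) cQ(2)]) (use q ql in \<open>auto simp: Q_def\<close>)
  have wQ: "weak_deriv l Q' k" by (rule classical_weak_deriv[OF l dQ(2) cQ(3)])
  have "(LINT x|leb l. h x * Q x) = (LINT x|leb l. k x * u x)"
    using H10_pair_weak_deriv[OF pQ wd] H10_pair_weak_deriv[OF pair wQ] by (simp add: mult.commute)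
  moreover have "complex_of_real (LINT x|leb l. (cmod (Q x))\<^sup>2) = (LINT x|leb l. k x * u x - h x * Q x)"
    unfolding integral_complex_of_real[symmetric]
  proof (rule integral_cong_AE)
    show "(\<lambda>x. complex_of_real ((cmod (Q x))\<^sup>2)) \<in> borel_measurable (leb l)"
      unfolding complex_norm_square by (intro borel_measurable_times L2_D(1) L2_cnj L2Q)
    show "(\<lambda>x. k x * u x - h x * Q x) \<in> borel_measurable (leb l)"
      by (intro borel_measurable_diff borel_measurable_times L2_D(1) L2 L2Q)
    show "AE x in leb l. complex_of_real ((cmod (Q x))\<^sup>2) = k x * u x - h x * Q x"
      using u(2) unfolding ae_eq_def schroedinger_op_def
    proof eventually_elim
      case (elim x)
      have "complex_of_real ((cmod (Q x))\<^sup>2) = Q x * Q x"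
        unfolding complex_norm_square by (simp add: Q_def)
      also have "\<dots> = (- h x - complex_of_real (V x) * u x) * Q x" using elim by (simp add: g_def h_def)
      also have "\<dots> = k x * u x - h x * Q x" by (simp add: k_def algebra_simps)
      finally show ?case .
    qed
  qed
  ultimately have "(LINT x|leb l. (cmod (Q x))\<^sup>2) = 0"
    using L2_mult_integrable[OF L2(3,1)] L2_mult_integrable[OF L2(2) L2Q] by simp
  then have "L2_norm l Q = 0" by (simp add: L2_norm_def)
  then have zero: "ae_eq l Q (\<lambda>_. 0)" using L2_norm_eq_0_iff[OF L2Q] by simp
  have q_zero: "0 = q x" if "x \<in> {0..l}" for x
    using ae_eq_continuous[OF l cQ(1) _ zero that] by (simp add: Q_def)
  have "(q has_vector_derivative q' 0) (at 0 within {0..l})"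
    using dq(1)[of 0] l by (simp add: has_real_derivative_iff_has_vector_derivative)
  from has_vector_derivative_transform[OF _ q_zero this]
  have "((\<lambda>_. 0) has_vector_derivative q' 0) (at 0 within {0..l})" using l by simp
  then have "q' 0 = 0"
    using vector_derivative_unique_within_closed_interval[of 0 l 0 "\<lambda>_. 0 :: real" "q' 0" 0] l by simp
  with q(3) show False ..
qed

section \<open>From the profile to the eigenvalue curve\<close>

text \<open>The last claim is the linearization: \<open>V\<^sub>+\<close> is the derivative of the nonlinearity \<open>f(y\<^sup>2) y +
\<beta> y\<close> along the profile, so \<open>\<phi>'\<close> solves the equation of \<open>L\<^sub>+\<close>.\<close>

lemma profile_potentials:
  fixes f \<phi> \<phi>' :: "real \<Rightarrow> real"
  assumes f: "Ck_on 3 {0..} f"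
    and phi1: "\<forall>x\<in>{0..R}. (\<phi> has_real_derivative \<phi>' x) (at x within {0..R})"
    and phi2: "\<forall>x\<in>{0..R}. \<exists>\<phi>''. (\<phi>' has_real_derivative \<phi>'') (at x within {0..R}) \<and>
                 \<phi>'' + f ((\<phi> x)\<^sup>2) * \<phi> x + \<beta> * \<phi> x = 0"
  shows "continuous_on {0..R} (V_plus f \<beta> \<phi>)"
    and "continuous_on {0..R} (V_minus f \<beta> \<phi>)"
    and "x \<in> {0..R} \<Longrightarrow> (\<phi>' has_real_derivative - (V_minus f \<beta> \<phi> x * \<phi> x)) (at x within {0..R})"
    and "x \<in> {0..R} \<Longrightarrow> ((\<lambda>x. - (V_minus f \<beta> \<phi> x * \<phi> x)) has_real_derivative
           - V_plus f \<beta> \<phi> x * \<phi>' x) (at x within {0..R})"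
proof -
  obtain D where D0: "\<And>y. y \<in> {0..} \<Longrightarrow> D 0 y = f y"
    and D: "\<And>j y. j < 3 \<Longrightarrow> y \<in> {0..} \<Longrightarrow> (D j has_real_derivative D (Suc j) y) (at y within {0..})"
    using f unfolding Ck_on_def by blast
  have df: "(f has_real_derivative D 1 y) (at y within {0..})" if "0 \<le> y" for y
    using D[of 0 y] that D0
    by (auto intro: has_field_derivative_transform_within[where f = "D 0" and d = 1])
  have vd: "vector_derivative f (at y within {0..}) = D 1 y" if "0 \<le> y" for y
  proof (rule vector_derivative_within)
    have "y islimpt {y..y + 1}" by simp
    then have "y islimpt {0..}" by (rule islimpt_subset) (use that in auto)
    then show "at y within {0..} \<noteq> bot" by (simp add: trivial_limit_within)
    show "(f has_vector_derivative D 1 y) (at y within {0..})"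
      using df[OF that] by (simp add: has_real_derivative_iff_has_vector_derivative)
  qed
  have Vp: "V_plus f \<beta> \<phi> x = 2 * D 1 ((\<phi> x)\<^sup>2) * (\<phi> x)\<^sup>2 + f ((\<phi> x)\<^sup>2) + \<beta>" for x
    by (simp add: V_plus_def vd)
  have cphi: "continuous_on {0..R} \<phi>" using phi1 by (auto intro: DERIV_continuous_on)
  have cf: "continuous_on {0..} f" by (rule DERIV_continuous_on[OF df]) simp
  have cD1: "continuous_on {0..} (D 1)" by (rule DERIV_continuous_on[OF D]) auto
  have comp: "continuous_on {0..R} (\<lambda>x. F ((\<phi> x)\<^sup>2))" if "continuous_on {0..} F" for F :: "real \<Rightarrow> real"
    by (rule continuous_on_compose2[OF that]) (auto intro!: continuous_intros cphi)
  show "continuous_on {0..R} (V_plus f \<beta> \<phi>)"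
    unfolding Vp[abs_def] by (intro continuous_intros comp cf cD1 cphi)
  show "continuous_on {0..R} (V_minus f \<beta> \<phi>)"
    unfolding V_minus_def[abs_def] by (intro continuous_intros comp cf)
  assume x: "x \<in> {0..R}"
  show "(\<phi>' has_real_derivative - (V_minus f \<beta> \<phi> x * \<phi> x)) (at x within {0..R})"
  proof -
    obtain d where d: "(\<phi>' has_real_derivative d) (at x within {0..R})" "d + f ((\<phi> x)\<^sup>2) * \<phi> x + \<beta> * \<phi> x = 0"
      using phi2 x by blast
    from d(2) have "d = - (V_minus f \<beta> \<phi> x * \<phi> x)" by (simp add: V_minus_def algebra_simps)
    with d(1) show ?thesis by simp
  qed
  have dphi: "(\<phi> has_real_derivative \<phi>' x) (at x within {0..R})" using phi1 x by blast
  then have sq: "((\<lambda>x. (\<phi> x)\<^sup>2) has_real_derivative 2 * \<phi> x * \<phi>' x) (at x within {0..R})"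
    by (auto intro!: derivative_eq_intros)
  have "(f has_real_derivative D 1 ((\<phi> x)\<^sup>2)) (at ((\<phi> x)\<^sup>2) within (\<lambda>x. (\<phi> x)\<^sup>2) ` {0..R})"
    by (rule has_field_derivative_subset[OF df]) auto
  from DERIV_image_chain[OF this sq]
  have "((\<lambda>x. f ((\<phi> x)\<^sup>2)) has_real_derivative D 1 ((\<phi> x)\<^sup>2) * (2 * \<phi> x * \<phi>' x)) (at x within {0..R})"
    by (simp add: o_def)
  then show "((\<lambda>x. - (V_minus f \<beta> \<phi> x * \<phi> x)) has_real_derivative
           - V_plus f \<beta> \<phi> x * \<phi>' x) (at x within {0..R})"
    unfolding V_minus_def Vp using dphi
    by (auto intro!: derivative_eq_intros simp: algebra_simps power2_eq_square)
qed

lemma C2_derivatives: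
  assumes "Ck_on 2 {-e<..<e} s" "0 < e"
  shows "\<mu> \<in> {-e<..<e} \<Longrightarrow> (s has_real_derivative deriv s \<mu>) (at \<mu>)"
    and "(deriv s has_real_derivative deriv (deriv s) 0) (at 0)"
proof -
  obtain D where D0: "\<And>y. y \<in> {-e<..<e} \<Longrightarrow> D 0 y = s y"
    and D: "\<And>j y. j < 2 \<Longrightarrow> y \<in> {-e<..<e} \<Longrightarrow> (D j has_real_derivative D (Suc j) y) (at y within {-e<..<e})"
    using assms(1) unfolding Ck_on_def by blast
  have at: "at y within {-e<..<e} = at y" if "y \<in> {-e<..<e}" for y
    by (rule at_within_open[OF that]) simp
  have ds: "(s has_real_derivative D 1 y) (at y)" if "y \<in> {-e<..<e}" for y
  proof -
    have "(s has_real_derivative D 1 y) (at y within {-e<..<e})"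
      using D[of 0 y] that D0
      by (auto intro: has_field_derivative_transform_within[where f = "D 0" and d = 1])
    then show ?thesis unfolding at[OF that] .
  qed
  have deriv: "deriv s y = D 1 y" if "y \<in> {-e<..<e}" for y using ds[OF that] by (rule DERIV_imp_deriv)
  show "\<mu> \<in> {-e<..<e} \<Longrightarrow> (s has_real_derivative deriv s \<mu>) (at \<mu>)" using ds deriv by simp
  have 0: "0 \<in> {-e<..<e}" using assms(2) by simp
  have "(D 1 has_real_derivative D 2 0) (at 0)"
    using D[of 1 0] 0 at[OF 0] by (simp add: numeral_2_eq_2)
  then have "(deriv s has_real_derivative D 2 0) (at 0)"
    by (rule DERIV_cong_ev[THEN iffD1, rotated -1])
      (auto simp: eventually_nhds deriv intro!: exI[of _ "{-e<..<e}"] assms(2))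
  then show "(deriv s has_real_derivative deriv (deriv s) 0) (at 0)" using DERIV_imp_deriv by fastforce
qed

theorem proposition5p3:
  fixes f \<phi> \<phi>' p p' q q' s :: "real \<Rightarrow> real" and \<beta> l R :: real
  assumes f: "Ck_on 3 {0..} f"
    and l_pos: "0 < l"
    and l_less_R: "l < R"
    and phi1: "\<forall>x\<in>{0..R}. (\<phi> has_real_derivative \<phi>' x) (at x within {0..R})"
    and phi2: "\<forall>x\<in>{0..R}. \<exists>\<phi>''. (\<phi>' has_real_derivative \<phi>'') (at x within {0..R}) \<and>
                 \<phi>'' + f ((\<phi> x)\<^sup>2) * \<phi> x + \<beta> * \<phi> x = 0"
    and spec_plus: "0 \<in> Spec l (dirichlet_dom l) (L_plus f \<beta> \<phi> l)"
    and spec_minus: "0 \<notin> Spec l (dirichlet_dom l) (L_minus f \<beta> \<phi> l)"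
    and eigenfun: "is_eigenfunction l (dirichlet_dom l) (L_plus f \<beta> \<phi> l) 0
                     (\<lambda>x. complex_of_real (\<phi>' x))"
    and p: "schroedinger_solution {0..l} (V_minus f \<beta> \<phi>) p p'" "p 0 = 1" "p' 0 = 0"
    and q: "schroedinger_solution {0..l} (V_minus f \<beta> \<phi>) q q'" "q 0 = 0" "q' 0 = 1"
    and s: "eigenvalue_curve f \<beta> \<phi> l R s"
  shows "q l \<noteq> 0 \<and>
         sgn (deriv (deriv s) 0) =
         sgn (integral {0..l} (\<lambda>x. (p x)\<^sup>2) - p l / q l * l\<^sup>2)"
proof
  note pot = profile_potentials[OF f phi1 phi2]
  have sub: "continuous_on {0..L} (V_plus f \<beta> \<phi>)" "continuous_on {0..L} (V_minus f \<beta> \<phi>)" if "L \<le> R" for L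
    using that by (auto intro: continuous_on_subset[OF pot(1)] continuous_on_subset[OF pot(2)])
  show ql: "q l \<noteq> 0"
    by (rule resolvent_excludes_dirichlet_solution[OF l_pos sub(2) spec_minus[unfolded L_minus_def] q(1,2)])
      (use l_less_R q in auto)
  have "bounded (V_plus f \<beta> \<phi> ` {0..R} \<union> V_minus f \<beta> \<phi> ` {0..R})"
    using pot(1,2) by (intro bounded_Un[THEN iffD2] conjI compact_imp_bounded compact_continuous_image) auto
  then obtain M where M: "\<And>t. t \<in> {0..R} \<Longrightarrow> \<bar>V_plus f \<beta> \<phi> t\<bar> \<le> M" "\<And>t. t \<in> {0..R} \<Longrightarrow> \<bar>V_minus f \<beta> \<phi> t\<bar> \<le> M"
    unfolding bounded_iff by force
  have dom: "(\<lambda>x. complex_of_real (\<phi>' x)) \<in> dirichlet_dom l"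
    and not_zero: "\<not> ae_eq l (\<lambda>x. complex_of_real (\<phi>' x)) (\<lambda>_. 0)"
    using eigenfun by (auto simp: is_eigenfunction_def)
  obtain G where G: "continuous_on {0..l} G" "G 0 = 0" "G l = 0" "ae_eq l (\<lambda>x. complex_of_real (\<phi>' x)) G"
    using dirichlet_dom_continuous_representative[OF l_pos dom] by blast
  have "continuous_on {0..R} \<phi>'" by (rule DERIV_continuous_on[OF pot(3)])
  then have "continuous_on {0..l} (\<lambda>x. complex_of_real (\<phi>' x))"
    by (intro continuous_on_of_real) (rule continuous_on_subset, use l_less_R in auto)
  note phiG = ae_eq_continuous[OF l_pos this G(1) G(4)]
  have bdry: "\<phi>' 0 = 0" "\<phi>' l = 0" using phiG[of 0] phiG[of l] G l_pos by auto
  have ne: "\<exists>t\<in>{0..l}. \<phi>' t \<noteq> 0"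
  proof (rule ccontr)
    assume "\<not> ?thesis"
    then have "ae_eq l (\<lambda>x. complex_of_real (\<phi>' x)) (\<lambda>_. 0)" by (auto simp: ae_eq_def intro!: AE_I2)
    with not_zero show False ..
  qed
  obtain e where s0: "s 0 = 1" and e: "0 < e" and C2: "Ck_on 2 {-e<..<e} s"
    and eig: "\<And>\<mu>. \<mu> \<in> {-e<..<e} \<Longrightarrow> 0 < s \<mu> * l \<and> s \<mu> * l \<le> R \<and>
      is_eigenvalue2 (s \<mu> * l) (dirichlet_dom (s \<mu> * l) \<times> dirichlet_dom (s \<mu> * l))
            (N_op f \<beta> \<phi> (s \<mu> * l)) (complex_of_real \<mu>)"
    using s unfolding eigenvalue_curve_def by blast
  show "sgn (deriv (deriv s) 0) = sgn (integral {0..l} (\<lambda>x. (p x)\<^sup>2) - p l / q l * l\<^sup>2)"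
  proof (rule classical_sign_formula[OF l_pos l_less_R M _ pot(3,4) bdry ne p q ql s0 e C2_derivatives[OF C2 e]])
    show "(\<phi> has_real_derivative \<phi>' t) (at t within {0..R})" if "t \<in> {0..R}" for t using phi1 that by blast
    fix \<mu> assume "\<mu> \<in> {-e<..<e}"
    then have L: "0 < s \<mu> * l" "s \<mu> * l \<le> R"
      and E: "is_eigenvalue2 (s \<mu> * l) (dirichlet_dom (s \<mu> * l) \<times> dirichlet_dom (s \<mu> * l))
            (N_op f \<beta> \<phi> (s \<mu> * l)) (complex_of_real \<mu>)"
      using eig by auto
    show "0 < s \<mu> * l \<and> s \<mu> * l \<le> R \<and> (\<exists>U U1 W W1.
       (\<forall>t\<in>{0..s \<mu> * l}. (U has_real_derivative U1 t) (at t within {0..s \<mu> * l})) \<and>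
       (\<forall>t\<in>{0..s \<mu> * l}. (U1 has_real_derivative - \<mu> * W t - V_plus f \<beta> \<phi> t * U t) (at t within {0..s \<mu> * l})) \<and>
       (\<forall>t\<in>{0..s \<mu> * l}. (W has_real_derivative W1 t) (at t within {0..s \<mu> * l})) \<and>
       (\<forall>t\<in>{0..s \<mu> * l}. (W1 has_real_derivative \<mu> * U t - V_minus f \<beta> \<phi> t * W t) (at t within {0..s \<mu> * l})) \<and>
       U 0 = 0 \<and> U (s \<mu> * l) = 0 \<and> W 0 = 0 \<and> W (s \<mu> * l) = 0 \<and>
       (\<exists>t\<in>{0..s \<mu> * l}. U t \<noteq> 0 \<or> W t \<noteq> 0))"
      by (intro conjI L eigenvalue_classical_pair[OF L(1) sub[OF L(2)] E])
  qed
qed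

end
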